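(* Assume that $\mu$ is purifying and ergodic, and let $g:\mathrm{P}(\mathbb{C}^d)\to\mathbb{C}$ be Hölder continuous. Put $\overline{g}=g-\mathbb{E}_{\nu_{inv}}(g)$. Then the Poisson equation $$(\mathrm{Id}-\Pi)\tilde g=\overline{g}$$ admits a continuous solution $\tilde g:\mathrm{P}(\mathbb{C}^d)\to\mathbb{C}$, and any two continuous solutions are equal up to an additive constant. As a consequence, for such a continuous solution $\tilde g$, setting $$S_n(\overline{g})=\sum_{k=0}^{n-1}\overline{g}(\hat x_k),\qquad M_n(g)=\sum_{k=1}^{n}\big(\tilde g(\hat x_k)-\Pi\tilde g(\hat x_{k-1})\big),$$ one has, for every initial probability measure $\nu$ on $\mathrm{P}(\mathbb{C}^d)$, $\mathbb{P}_\nu$-almost surely, $$\sup_n|S_n(\overline{g})-M_n(g)|\le \operatorname{osc}(\tilde g)\le 2\|\tilde g\|_\infty .$$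
   Context: Setting. Let $d\ge 1$ be an integer, $\mathrm{P}(\mathbb{C}^d)$ the complex projective space of $\mathbb{C}^d$ with Borel $\sigma$-algebra $\mathcal{B}$. For nonzero $x\in\mathbb{C}^d$, $\hat x$ is its class in $\mathrm{P}(\mathbb{C}^d)$; for $\hat x\in \mathrm{P}(\mathbb{C}^d)$, $x$ denotes an arbitrary norm-one representative. The metric on $\mathrm{P}(\mathbb{C}^d)$ is $d(\hat x,\hat y)=\sqrt{1-|\langle x,y\rangle|^2}$. Hölder continuous means $\alpha$-Hölder for this metric for some $\alpha\in(0,1]$. For $v\in M_d(\mathbb{C})$ with $vx\neq 0$, $v\cdot\hat x$ is the class of $vx$. $\mu$ is a measure on the Borel sets of $M_d(\mathbb{C})$ with $\int\|v\|^2\mathrm{d}\mu(v)<\infty$ and $\int v^*v\,\mathrm{d}\mu(v)=\mathrm{Id}_{\mathbb{C}^d}$. Kernel. $\Pi(\hat x,S)=\int \mathbf{1}_S(v\cdot\hat x)\|vx\|^2\mathrm{d}\mu(v)$ for $S\in\mathcal{B}$ (the integrand is $0$ when $vx=0$), and $\Pi f(\hat x)=\int f(v\cdot\hat x)\|vx\|^2\mathrm{d}\mu(v)$. Process. $\Omega=M_d(\mathbb{C})^{\mathbb{N}}$, elements written $\omega=(v_1,v_2,\dots)$; $\mathcal{O}_n$ is the $\sigma$-algebra generated by the first $n$ coordinates and $\mathcal{O}$ the one generated by all coordinates; $V_i(\omega)=v_i$, $W_n=V_n\cdots V_1$, $W_0=\mathrm{Id}$. For a probability measure $\nu$ on $\mathrm{P}(\mathbb{C}^d)$,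 $\mathbb{P}_\nu$ is the unique probability measure on $(\mathrm{P}(\mathbb{C}^d)\times\Omega,\mathcal{B}\otimes\mathcal{O})$ with $\mathbb{P}_\nu(S\times O_n)=\int_{S\times O_n}\|W_n(\omega)x\|^2\,\mathrm{d}\nu(\hat x)\,\mathrm{d}\mu^{\otimes n}(\omega)$ for $S\in\mathcal{B}$, $O_n\in\mathcal{O}_n$. On it, $\hat x_n(\hat x,\omega)=W_n(\omega)\cdot\hat x$ when $W_n(\omega)x\ne0$ (which holds $\mathbb{P}_\nu$-a.s.), extended arbitrarily otherwise; $(\hat x_n)$ is a Markov chain with kernel $\Pi$ and initial law $\nu$. $\mathbb{E}_\nu$ is expectation under $\mathbb{P}_\nu$; in particular $\mathbb{E}_{\nu}(g)=\int g\,\mathrm{d}\nu$ for $g$ a function on $\mathrm{P}(\mathbb{C}^d)$. The oscillation is $\operatorname{osc}(f)=\sup_{\hat x,\hat y}|f(\hat x)-f(\hat y)|$ and $\|\cdot\|_\infty$ is the sup norm. Assumptions. $\mu$ is purifying (assumption (Pur)) if every nonzero orthogonal projector $\pi$ such that for all $n\in\mathbb{N}$, $\pi v_1^*\cdots v_n^*v_n\cdots v_1\pi\propto\pi$ for $\mu^{\otimes n}$-almost all $(v_1,\dots,v_n)$, has rank one. $\mu$ is ergodic (assumption (Erg)) if there is a unique minimal subspace $E\ne\{0\}$ of $\mathbb{C}^d$ such that $vE\subset E$ for all $v\in\operatorname{supp}\mu$ (minimal among nonzero subspaces with this property). It is known that if $\mu$ is purifying and ergodic then $\Pi$ has a unique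 invariant probability measure $\nu_{inv}$. *)

theory Defs
  imports "HOL-Probability.Probability"
begin

section \<open>The complex projective space\<close>

definition same_line :: "complex^'d \<Rightarrow> complex^'d \<Rightarrow> bool" where
  "same_line x y \<longleftrightarrow> x \<noteq> 0 \<and> y \<noteq> 0 \<and> (\<exists>c. c \<noteq> 0 \<and> y = c *s x)"

lemma part_equivp_same_line: "part_equivp same_line"
proof (rule part_equivpI)
  show "\<exists>x::complex^'d. same_line x x"
    by (rule exI[of _ "axis undefined 1"])
       (auto simp: same_line_def axis_eq_0_iff intro!: exI[of _ "1::complex"])
  show "symp (same_line :: complex^'d \<Rightarrow> _)"
  proof (rule sympI)
    fix x y :: "complex^'d"
    assume "same_line x y"
    then obtain c where c: "x \<noteq> 0" "y \<noteq> 0" "c \<noteq> 0" "y = c *s x"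
      by (auto simp: same_line_def)
    then have "x = inverse c *s y"
      by (simp add: vector_smult_assoc)
    with c show "same_line y x"
      unfolding same_line_def by (metis inverse_nonzero_iff_nonzero)
  qed
  show "transp (same_line :: complex^'d \<Rightarrow> _)"
  proof (rule transpI)
    fix x y z :: "complex^'d"
    assume "same_line x y" "same_line y z"
    then obtain c e where "x \<noteq> 0" "z \<noteq> 0" "c \<noteq> 0" "e \<noteq> 0" "y = c *s x" "z = e *s y"
      by (auto simp: same_line_def)
    then show "same_line x z"
      unfolding same_line_def by (metis mult_eq_0_iff vector_smult_assoc)
  qed
qed

quotient_type 'd cproj = "complex^('d::finite)" / partial: same_line
  morphisms rep_cproj line
  by (rule part_equivp_same_line)

text \<open>\<open>line x\<close> is the class of a nonzero vector \<open>x\<close>. The value \<open>line 0\<close> is an unspecified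
  point.\<close>

lemma line_eq_iff:
  fixes x y :: "complex^'d"
  assumes "x \<noteq> 0" "y \<noteq> 0"
  shows "line x = line y \<longleftrightarrow> (\<exists>c. c \<noteq> 0 \<and> y = c *s x)"
proof -
  have r: "same_line z z" if "z \<noteq> 0" for z :: "complex^'d"
    using that by (auto simp: same_line_def intro!: exI[of _ "1::complex"])
  show ?thesis
    using Quotient3_rel[OF Quotient3_cproj, of x y] r assms by (auto simp: same_line_def)
qed

lemma line_cases: "\<exists>x::complex^'d. x \<noteq> 0 \<and> line x = p"
  using Quotient3_rep_reflp[OF Quotient3_cproj, of p] Quotient3_abs_rep[OF Quotient3_cproj, of p]
  by (auto simp: same_line_def)

definition unit_rep :: "'d::finite cproj \<Rightarrow> complex^'d" where
  "unit_rep p = (SOME x. norm x = 1 \<and> line x = p)"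

lemma norm_smult_complex: "norm (c *s x) = cmod c * norm (x :: complex^'d)"
  by (simp add: norm_vec_def norm_mult L2_set_right_distrib)

lemma unit_rep: "norm (unit_rep p) = 1" "line (unit_rep p) = p"
proof -
  obtain x :: "complex^'a" where x: "x \<noteq> 0" "line x = p"
    using line_cases by blast
  define y where "y = complex_of_real (inverse (norm x)) *s x"
  have "norm y = 1"
    using x by (simp add: y_def norm_smult_complex norm_inverse del: of_real_inverse)
  moreover from this have "y \<noteq> 0"
    by auto
  then have "line x = line y"
    using x by (subst line_eq_iff) (auto simp: y_def intro!: exI[of _ "complex_of_real (inverse (norm x))"])
  ultimately have "norm y = 1 \<and> line y = p"
    using x by simp
  then have "norm (unit_rep p) = 1 \<and> line (unit_rep p) = p"
    unfolding unit_rep_def by (rule someI)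
  then show "norm (unit_rep p) = 1" "line (unit_rep p) = p"
    by auto
qed

lemma unit_rep_nonzero: "unit_rep p \<noteq> 0"
  using unit_rep(1)[of p] by auto

definition herm :: "complex^'d \<Rightarrow> complex^'d \<Rightarrow> complex" where
  "herm x y = (\<Sum>i\<in>UNIV. cnj (x $ i) * y $ i)"

text \<open>The metric is, up to the factor \<open>sqrt 2\<close>, the Frobenius distance between the orthogonal
  projectors onto the two lines; this yields the triangle inequality.\<close>

definition outer :: "complex^'d \<Rightarrow> complex^'d^'d" where
  "outer x = (\<chi> i j. x $ i * cnj (x $ j))"

lemma herm_self: "herm x x = complex_of_real ((norm x)\<^sup>2)"
proof -
  have "complex_of_real ((norm x)\<^sup>2) = (\<Sum>i\<in>UNIV. complex_of_real ((cmod (x $ i))\<^sup>2))"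
    by (simp add: norm_vec_def L2_set_def sum_nonneg)
  then show ?thesis
    by (simp only: herm_def complex_norm_square mult.commute)
qed

lemma inner_outer: "inner (outer x) (outer y) = (cmod (herm x y))\<^sup>2"
proof -
  have "complex_of_real ((cmod (herm x y))\<^sup>2) = cnj (herm x y) * herm x y"
    by (simp only: complex_norm_square mult.commute)
  also have "\<dots> = (\<Sum>i\<in>UNIV. \<Sum>j\<in>UNIV. (x $ i * cnj (x $ j)) * cnj (y $ i * cnj (y $ j)))"
    by (simp add: herm_def sum_product algebra_simps)
  finally have "(cmod (herm x y))\<^sup>2
      = Re (\<Sum>i\<in>UNIV. \<Sum>j\<in>UNIV. (x $ i * cnj (x $ j)) * cnj (y $ i * cnj (y $ j)))"
    by (metis Re_complex_of_real)
  also have "\<dots> = (\<Sum>i\<in>UNIV. \<Sum>j\<in>UNIV. inner (x $ i * cnj (x $ j)) (y $ i * cnj (y $ j)))"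
    by (simp add: inner_complex_def algebra_simps)
  finally show ?thesis
    by (simp add: inner_vec_def outer_def)
qed

lemma norm_outer_diff:
  assumes "norm x = 1" "norm y = 1"
  shows "sqrt (1 - (cmod (herm x y))\<^sup>2) = norm (outer x - outer y) / sqrt 2"
proof -
  have "inner (outer y) (outer x) = (cmod (herm x y))\<^sup>2"
    by (subst inner_commute) (rule inner_outer)
  then have "(norm (outer x - outer y))\<^sup>2 = 2 * (1 - (cmod (herm x y))\<^sup>2)"
    using assms
    by (simp add: power2_norm_eq_inner[of "outer x - outer y"] inner_diff inner_outer herm_self)
  then have "1 - (cmod (herm x y))\<^sup>2 = (norm (outer x - outer y) / sqrt 2)\<^sup>2"
    by (simp add: power_divide)
  then show ?thesis
    by (simp only: real_sqrt_abs) simp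
qed

lemma outer_eq_imp_smult:
  assumes "norm x = 1" "outer x = outer y"
  shows "x = herm y x *s y"
proof -
  have "x $ i = herm y x * y $ i" for i
  proof -
    have "x $ i = x $ i * herm x x"
      using assms by (simp add: herm_self)
    also have "\<dots> = (\<Sum>j\<in>UNIV. outer x $ i $ j * x $ j)"
      by (simp add: herm_def outer_def sum_distrib_left mult.assoc)
    also have "\<dots> = (\<Sum>j\<in>UNIV. outer y $ i $ j * x $ j)"
      by (simp add: assms)
    also have "\<dots> = herm y x * y $ i"
      by (simp add: herm_def outer_def sum_distrib_left algebra_simps)
    finally show ?thesis .
  qed
  then show ?thesis
    by (simp add: vec_eq_iff)
qed

instantiation cproj :: (finite) metric_space
begin

definition dist_cproj :: "'a cproj \<Rightarrow> 'a cproj \<Rightarrow> real" where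
  "dist_cproj p q = sqrt (1 - (cmod (herm (unit_rep p) (unit_rep q)))\<^sup>2)"

definition uniformity_cproj :: "('a cproj \<times> 'a cproj) filter" where
  "uniformity_cproj = (INF e\<in>{0 <..}. principal {(x, y). dist x y < e})"

definition open_cproj :: "'a cproj set \<Rightarrow> bool" where
  "open_cproj U = (\<forall>x\<in>U. \<forall>\<^sub>F (x', y) in uniformity. x' = x \<longrightarrow> y \<in> U)"

instance
proof
  have D: "dist p q = norm (outer (unit_rep p) - outer (unit_rep q)) / sqrt 2" for p q :: "'a cproj"
    unfolding dist_cproj_def by (intro norm_outer_diff unit_rep)
  fix p q r :: "'a cproj"
  show "dist p q = 0 \<longleftrightarrow> p = q"
  proof
    assume "dist p q = 0"
    then have "unit_rep p = herm (unit_rep q) (unit_rep p) *s unit_rep q"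
      by (intro outer_eq_imp_smult unit_rep) (simp add: D)
    moreover from this have "herm (unit_rep q) (unit_rep p) \<noteq> 0"
      using unit_rep_nonzero[of p] by (metis vector_smult_lzero)
    ultimately have "line (unit_rep q) = line (unit_rep p)"
      using line_eq_iff unit_rep_nonzero by blast
    then show "p = q"
      by (simp add: unit_rep)
  qed (simp add: D)
  have "norm (outer (unit_rep p) - outer (unit_rep q))
      \<le> norm (outer (unit_rep p) - outer (unit_rep r)) + norm (outer (unit_rep q) - outer (unit_rep r))"
    using norm_triangle_ineq4[of "outer (unit_rep p) - outer (unit_rep r)" "outer (unit_rep q) - outer (unit_rep r)"]
    by simp
  then show "dist p q \<le> dist p r + dist q r"
    by (simp add: D divide_right_mono flip: add_divide_distrib)
qed (simp_all add: uniformity_cproj_def open_cproj_def)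

end

lemma dist_line:
  assumes "norm x = 1" "norm y = 1"
  shows "dist (line x) (line y) = sqrt (1 - (cmod (herm x y))\<^sup>2)"
proof -
  have "outer z = outer (unit_rep (line z))" if z: "norm z = 1" for z :: "complex^'a"
  proof -
    have "z \<noteq> 0"
      using z by auto
    then obtain c where c: "unit_rep (line z) = c *s z"
      using line_eq_iff[of z "unit_rep (line z)"] unit_rep(2)[of "line z"] unit_rep_nonzero by metis
    then have "cmod c = 1"
      using unit_rep(1)[of "line z"] z by (simp add: norm_smult_complex)
    then have "c * cnj c = 1"
      by (simp flip: complex_norm_square)
    then have "c * a * (cnj c * b) = a * b" for a b :: complex
      by (metis mult.assoc mult.left_commute mult_1)
    then show ?thesis
      by (simp add: c outer_def vec_eq_iff)
  qed
  from this[OF assms(1)] this[OF assms(2)] show ?thesis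
    using assms unfolding dist_cproj_def by (simp add: norm_outer_diff unit_rep)
qed

definition hoelder_continuous :: "('d::finite cproj \<Rightarrow> complex) \<Rightarrow> bool" where
  "hoelder_continuous g \<longleftrightarrow>
     (\<exists>\<alpha> C. 0 < \<alpha> \<and> \<alpha> \<le> 1 \<and> (\<forall>p q. cmod (g p - g q) \<le> C * dist p q powr \<alpha>))"

definition osc :: "('d::finite cproj \<Rightarrow> complex) \<Rightarrow> real" where
  "osc f = (SUP (p, q). cmod (f p - f q))"

definition sup_norm :: "('d::finite cproj \<Rightarrow> complex) \<Rightarrow> real" where
  "sup_norm f = (SUP p. cmod (f p))"

section \<open>Matrices acting on the projective space\<close>

definition adj :: "complex^'d^'d \<Rightarrow> complex^'d^'d" where
  "adj v = (\<chi> i j. cnj (v $ j $ i))"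

text \<open>When \<open>v\<close> kills the line \<open>p\<close>, \<open>act v p\<close> is the unspecified point \<open>line 0\<close>.\<close>

definition act :: "complex^'d^'d \<Rightarrow> 'd::finite cproj \<Rightarrow> 'd cproj" where
  "act v p = line (v *v unit_rep p)"

lemma act_line:
  assumes "v *v x \<noteq> 0"
  shows "act v (line x) = line (v *v x)"
proof -
  have "x \<noteq> 0"
    using assms by auto
  then obtain c where c: "c \<noteq> 0" "unit_rep (line x) = c *s x"
    using line_eq_iff[of x "unit_rep (line x)"] unit_rep(2)[of "line x"] unit_rep_nonzero by metis
  then have "v *v unit_rep (line x) = c *s (v *v x)"
    by (simp add: vector_scalar_commute)
  then have "line (v *v x) = line (v *v unit_rep (line x))"
    using assms c by (subst line_eq_iff) auto
  then show ?thesis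
    by (simp add: act_def)
qed

text \<open>\<open>\<omega> 0, \<omega> 1, \<dots>\<close> are the coordinates \<open>v\<^sub>1, v\<^sub>2, \<dots>\<close>.\<close>

primrec W :: "nat \<Rightarrow> (nat \<Rightarrow> complex^'d^'d) \<Rightarrow> complex^'d^'d" where
  "W 0 \<omega> = mat 1"
| "W (Suc n) \<omega> = \<omega> n ** W n \<omega>"

section \<open>The driving measure\<close>

text \<open>The measure need be neither finite nor \<open>\<sigma>\<close>-finite, but the second moment only leaves room for
  an infinite atom at the zero matrix. Such an atom contributes nothing below: all integrands
  vanish and the proportionality in \<open>purifying\<close> holds as soon as one of the matrices is zero.\<close>

definition stochastic_measure :: "(complex^'d^'d) measure \<Rightarrow> bool" where
  "stochastic_measure \<mu> \<longleftrightarrow> sets \<mu> = sets borel \<and>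
     (\<integral>\<^sup>+ v. ennreal ((onorm ((*v) v))\<^sup>2) \<partial>\<mu>) < \<infinity> \<and>
     (\<integral> v. adj v ** v \<partial>\<mu>) = mat 1"

definition orthogonal_projector :: "complex^'d^'d \<Rightarrow> bool" where
  "orthogonal_projector \<pi> \<longleftrightarrow> \<pi> ** \<pi> = \<pi> \<and> adj \<pi> = \<pi>"

definition purifying :: "(complex^'d^'d) measure \<Rightarrow> bool" where
  "purifying \<mu> \<longleftrightarrow>
     (\<forall>\<pi>. orthogonal_projector \<pi> \<and> \<pi> \<noteq> 0 \<and>
        (\<forall>n. AE \<omega> in Pi\<^sub>M {..<n} (\<lambda>_. \<mu>).
           \<exists>c. \<pi> ** adj (W n \<omega>) ** W n \<omega> ** \<pi> = mat c ** \<pi>)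
      \<longrightarrow> rank \<pi> = 1)"

definition support :: "'a::topological_space measure \<Rightarrow> 'a set" where
  "support \<mu> = {v. \<forall>U. open U \<and> v \<in> U \<longrightarrow> emeasure \<mu> U > 0}"

definition stable_subspace :: "(complex^'d^'d) measure \<Rightarrow> (complex^'d) set \<Rightarrow> bool" where
  "stable_subspace \<mu> E \<longleftrightarrow>
     vec.subspace E \<and> E \<noteq> {0} \<and> (\<forall>v\<in>support \<mu>. (*v) v ` E \<subseteq> E)"

definition ergodic :: "(complex^'d^'d) measure \<Rightarrow> bool" where
  "ergodic \<mu> \<longleftrightarrow>
     (\<exists>!E. stable_subspace \<mu> E \<and> (\<forall>F. stable_subspace \<mu> F \<and> F \<subseteq> E \<longrightarrow> F = E))"

section \<open>The kernel and the trajectory measure\<close>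

definition kernel :: "(complex^'d^'d) measure \<Rightarrow> 'd::finite cproj \<Rightarrow> 'd cproj set \<Rightarrow> ennreal" where
  "kernel \<mu> p S = (\<integral>\<^sup>+ v. indicator S (act v p) * ennreal ((norm (v *v unit_rep p))\<^sup>2) \<partial>\<mu>)"

definition kernel_op ::
  "(complex^'d^'d) measure \<Rightarrow> ('d::finite cproj \<Rightarrow> complex) \<Rightarrow> 'd cproj \<Rightarrow> complex" where
  "kernel_op \<mu> f p = (\<integral> v. f (act v p) * complex_of_real ((norm (v *v unit_rep p))\<^sup>2) \<partial>\<mu>)"

definition borel_prob :: "'d::finite cproj measure \<Rightarrow> bool" where
  "borel_prob \<nu> \<longleftrightarrow> prob_space \<nu> \<and> sets \<nu> = sets borel"

definition invariant_prob :: "(complex^'d^'d) measure \<Rightarrow> 'd::finite cproj measure \<Rightarrow> bool" where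
  "invariant_prob \<mu> \<nu> \<longleftrightarrow> borel_prob \<nu> \<and>
     (\<forall>S\<in>sets borel. (\<integral>\<^sup>+ p. kernel \<mu> p S \<partial>\<nu>) = emeasure \<nu> S)"

text \<open>The events generated by the first \<open>n\<close> coordinates are the cylinders over measurable sets \<open>A\<close>
  of \<open>n\<close>-tuples.\<close>

definition trajectory_law ::
  "(complex^'d^'d) measure \<Rightarrow> 'd::finite cproj measure
     \<Rightarrow> ('d cproj \<times> (nat \<Rightarrow> complex^'d^'d)) measure \<Rightarrow> bool" where
  "trajectory_law \<mu> \<nu> P \<longleftrightarrow>
     prob_space P \<and> sets P = sets (borel \<Otimes>\<^sub>M Pi\<^sub>M UNIV (\<lambda>_. borel)) \<and>
     (\<forall>n. \<forall>S\<in>sets borel. \<forall>A\<in>sets (Pi\<^sub>M {..<n} (\<lambda>_. borel)).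
        emeasure P (S \<times> prod_emb UNIV (\<lambda>_. borel) {..<n} A) =
        (\<integral>\<^sup>+ p. indicator S p *
           (\<integral>\<^sup>+ \<omega>. indicator A \<omega> * ennreal ((norm (W n \<omega> *v unit_rep p))\<^sup>2)
              \<partial>Pi\<^sub>M {..<n} (\<lambda>_. \<mu>)) \<partial>\<nu>))"

definition xhat :: "nat \<Rightarrow> 'd::finite cproj \<times> (nat \<Rightarrow> complex^'d^'d) \<Rightarrow> 'd cproj" where
  "xhat n = (\<lambda>(p, \<omega>). act (W n \<omega>) p)"

definition centred :: "'d::finite cproj measure \<Rightarrow> ('d cproj \<Rightarrow> complex) \<Rightarrow> 'd cproj \<Rightarrow> complex" where
  "centred \<nu> g = (\<lambda>p. g p - (\<integral> q. g q \<partial>\<nu>))"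

definition continuous_poisson_solution ::
  "(complex^'d^'d) measure \<Rightarrow> ('d::finite cproj \<Rightarrow> complex) \<Rightarrow> ('d cproj \<Rightarrow> complex) \<Rightarrow> bool" where
  "continuous_poisson_solution \<mu> h f \<longleftrightarrow>
     continuous_on UNIV f \<and> (\<forall>p. f p - kernel_op \<mu> f p = h p)"

definition birkhoff_sum ::
  "('d::finite cproj \<Rightarrow> complex) \<Rightarrow> nat \<Rightarrow> 'd cproj \<times> (nat \<Rightarrow> complex^'d^'d) \<Rightarrow> complex" where
  "birkhoff_sum h n z = (\<Sum>k<n. h (xhat k z))"

definition poisson_martingale ::
  "(complex^'d^'d) measure \<Rightarrow> ('d::finite cproj \<Rightarrow> complex) \<Rightarrow> nat
     \<Rightarrow> 'd cproj \<times> (nat \<Rightarrow> complex^'d^'d) \<Rightarrow> complex" where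
  "poisson_martingale \<mu> f n z = (\<Sum>k=1..n. (f (xhat k z) - kernel_op \<mu> f (xhat (k - 1) z)))"

end

theory Submission
  imports Defs "HOL-Real_Asymp.Real_Asymp" "HOL-Complex_Analysis.Great_Picard"
begin

text \<open>
  Write \<open>T\<close> for the averaging operator \<open>(T \<phi>) x = \<integral> \<phi> (v x) d\<mu>(v)\<close> acting on functions on
  \<open>\<complex>\<^sup>d\<close> that are continuous and satisfy \<open>\<phi> (c x) = \<bar>c\<bar>\<^sup>2 \<phi> x\<close>. Such functions correspond to the continuous
  functions \<open>f\<close> on the projective space through \<open>\<phi> x = f (line x) \<parallel>x\<parallel>\<^sup>2\<close>, and \<open>T\<close> corresponds to the
  kernel; the weight \<open>\<parallel>v x\<parallel>\<^sup>2\<close> and the exceptional matrices killing \<open>x\<close> thereby disappear. Iterating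
  \<open>T\<close> replaces integration against products of \<open>\<mu>\<close>. The same averaging acts on functions of pairs
  \<open>(x, y)\<close>, moved by a common matrix, which makes it possible to compare two starting points.

  The quantity to follow is the area \<open>\<parallel>x \<and> y\<parallel>\<close> of a pair, because the distance of two lines is
  \<open>\<parallel>x \<and> y\<parallel> / (\<parallel>x\<parallel> \<parallel>y\<parallel>)\<close>. For an orthonormal pair,
  \<open>\<parallel>v x \<and> v y\<parallel> \<le> (\<parallel>v x\<parallel>\<^sup>2 + \<parallel>v y\<parallel>\<^sup>2) / 2\<close>, whose \<open>\<mu>\<close>-integral is 1, so averaging does not
  increase areas. If it never decreases the area of some orthonormal pair, then almost all products
  \<open>v\<^sub>n \<cdots> v\<^sub>1\<close> act on the plane of the pair as multiples of isometries, which purification forbids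
  (\<open>no_dark_pair\<close>). Compactness of the set of orthonormal pairs and the scaling of areas under linear
  substitutions then give a uniform contraction of areas (\<open>iter_area_factor\<close>).

  Two consequences follow. First, a continuous real invariant function satisfies the parallelogram
  law, since its defect vanishes on pairs of area 0 and is therefore controlled by areas. Hence the
  lines where it is maximal form a subspace, stable under the support of \<open>\<mu>\<close>, and so do the lines where
  it is minimal. Ergodicity makes the two subspaces meet, so the function is constant
  (\<open>invariant_constant\<close>); this is the uniqueness part. Second, \<open>T\<close> satisfies an inequality
  \<open>[T\<^sup>n \<phi>] \<le> [\<phi>] / 2 + 4 \<parallel>\<phi>\<parallel>\<close> between Hoelder seminorms and sup norms, for some fixed \<open>n\<close>
  (\<open>lasota_yorke_half\<close>).

  For existence, consider truncated Neumann series \<open>\<Sum>k<N. r\<^sup>k T\<^sup>k \<phi>\<close> with \<open>r \<rightarrow> 1\<close>. The seminorm inequality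
  bounds their Hoelder seminorms linearly in their sup norms. After division by the sup norm, or by 1
  if that is larger, a subsequence
  converges to some \<open>H\<close> with \<open>H - T H = \<tau> \<phi>\<close>. If \<open>\<tau> = 0\<close>, then \<open>H\<close> is invariant of sup norm 1, hence a
  nonzero constant, which contradicts its vanishing integral for the invariant measure; so \<open>H / \<tau>\<close>
  is a solution (\<open>poisson_limit\<close>).

  Finally, inserting \<open>h = f - \<Pi> f\<close> into \<open>S\<^sub>n - M\<^sub>n\<close> leaves the telescoped difference
  \<open>f (x\<^sub>0) - f (x\<^sub>n)\<close>, which is bounded by the oscillation of \<open>f\<close>.
\<close>

section \<open>The area spanned by two vectors\<close>

definition area :: "complex^'d \<Rightarrow> complex^'d \<Rightarrow> real" where
  "area x y = sqrt ((norm x)\<^sup>2 * (norm y)\<^sup>2 - (cmod (herm x y))\<^sup>2)"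

definition wedge :: "complex^'d \<Rightarrow> complex^'d \<Rightarrow> complex^'d^'d" where
  "wedge x y = (\<chi> i j. x $ i * y $ j - x $ j * y $ i)"

definition orthonormal :: "complex^'d \<Rightarrow> complex^'d \<Rightarrow> bool" where
  "orthonormal u w \<longleftrightarrow> norm u = 1 \<and> norm w = 1 \<and> herm u w = 0"

lemma herm_simps:
  "herm x (y + z) = herm x y + herm x z" "herm (x + y) z = herm x z + herm y z"
  "herm x (y - z) = herm x y - herm x z"
  "herm x (c *s y) = c * herm x y" "herm (c *s x) y = cnj c * herm x y"
  by (simp_all add: herm_def sum.distrib sum_subtractf sum_distrib_left algebra_simps)

lemma cnj_herm: "cnj (herm x y) = herm y x"
  by (simp add: herm_def mult.commute)

lemma norm_vec_square: "(norm x)\<^sup>2 = (\<Sum>i\<in>UNIV. (norm (x $ i))\<^sup>2)"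
  by (simp add: norm_vec_def L2_set_def sum_nonneg)

text \<open>Lagrange's identity. It identifies the area with the norm of a bilinear expression, from which the
  behaviour of areas under linear substitutions is read off.\<close>

lemma norm_wedge_square: "(norm (wedge x y))\<^sup>2 = 2 * ((norm x)\<^sup>2 * (norm y)\<^sup>2 - (cmod (herm x y))\<^sup>2)"
proof -
  have "complex_of_real ((norm (wedge x y))\<^sup>2)
      = (\<Sum>i\<in>UNIV. \<Sum>j\<in>UNIV. complex_of_real ((cmod (x $ i * y $ j - x $ j * y $ i))\<^sup>2))"
    by (simp add: norm_vec_square wedge_def)
  also have "\<dots> = (\<Sum>i\<in>UNIV. \<Sum>j\<in>UNIV. (cnj (x $ i) * x $ i) * (cnj (y $ j) * y $ j))
      + (\<Sum>i\<in>UNIV. \<Sum>j\<in>UNIV. (cnj (y $ i) * y $ i) * (cnj (x $ j) * x $ j))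
      - (\<Sum>i\<in>UNIV. \<Sum>j\<in>UNIV. (cnj (y $ i) * x $ i) * (cnj (x $ j) * y $ j))
      - (\<Sum>i\<in>UNIV. \<Sum>j\<in>UNIV. (cnj (x $ i) * y $ i) * (cnj (y $ j) * x $ j))"
    by (simp only: complex_norm_square sum.distrib [symmetric] sum_subtractf [symmetric])
       (intro sum.cong refl, simp add: algebra_simps)
  also have "\<dots> = herm x x * herm y y + herm y y * herm x x - herm y x * herm x y - herm x y * herm y x"
    by (simp only: herm_def sum_product)
  also have "\<dots> = complex_of_real (2 * ((norm x)\<^sup>2 * (norm y)\<^sup>2 - (cmod (herm x y))\<^sup>2))"
    by (simp only: herm_self of_real_mult of_real_diff complex_norm_square cnj_herm) (simp add: algebra_simps)
  finally show ?thesis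
    using of_real_eq_iff by blast
qed

lemma area_square: "(area x y)\<^sup>2 = (norm x)\<^sup>2 * (norm y)\<^sup>2 - (cmod (herm x y))\<^sup>2"
proof -
  have "0 \<le> (norm x)\<^sup>2 * (norm y)\<^sup>2 - (cmod (herm x y))\<^sup>2"
    using zero_le_power2[of "norm (wedge x y)"] unfolding norm_wedge_square by simp
  then show ?thesis
    by (simp add: area_def)
qed

lemma area_eq_norm_wedge: "area x y = norm (wedge x y) / sqrt 2"
proof -
  have "(norm (wedge x y) / sqrt 2)\<^sup>2 = (norm x)\<^sup>2 * (norm y)\<^sup>2 - (cmod (herm x y))\<^sup>2"
    by (simp add: norm_wedge_square power_divide)
  then show ?thesis
    unfolding area_def by (metis divide_nonneg_nonneg norm_ge_zero real_sqrt_ge_zero real_sqrt_unique zero_le_numeral)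
qed

lemma area_nonneg [simp]: "0 \<le> area x y"
  by (simp add: area_eq_norm_wedge)

lemma norm_smult_matrix: "norm (\<chi> i j. c * A $ i $ j) = cmod c * norm (A :: complex^'n^'m)"
  by (simp add: norm_vec_def norm_mult L2_set_right_distrib)

lemma area_combination: "area (s *s u) (t *s u + r *s w) = cmod s * cmod r * area u w"
proof -
  have "wedge (s *s u) (t *s u + r *s w) = (\<chi> i j. (s * r) * wedge u w $ i $ j)"
    by (simp add: wedge_def vec_eq_iff algebra_simps)
  then show ?thesis
    by (simp only: area_eq_norm_wedge norm_smult_matrix) (simp add: norm_mult)
qed

lemma area_zero_left [simp]: "area 0 y = 0"
  by (simp add: area_def herm_def)

lemma area_orthonormal: "orthonormal u w \<Longrightarrow> area u w = 1"
  by (simp add: area_def orthonormal_def)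

lemma area_le_norms: "area x y \<le> norm x * norm y"
proof -
  have "(area x y)\<^sup>2 \<le> (norm x * norm y)\<^sup>2"
    by (simp add: area_square power_mult_distrib)
  then show ?thesis
    by (rule power2_le_imp_le) simp
qed

lemma area_le: "area x y \<le> ((norm x)\<^sup>2 + (norm y)\<^sup>2) / 2"
proof -
  have "norm x * norm y \<le> ((norm x)\<^sup>2 + (norm y)\<^sup>2) / 2"
    using sum_squares_bound[of "norm x" "norm y"] by simp
  with area_le_norms show ?thesis
    by (rule order_trans)
qed

text \<open>The equality case in \<open>area_le\<close>: a pair of maximal area for its norms is orthogonal with both vectors
  of the same length. It is what turns a loss-free average into a statement about almost every matrix.\<close>

lemma area_extremal:
  assumes "area x y = ((norm x)\<^sup>2 + (norm y)\<^sup>2) / 2"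
  shows "norm x = norm y" "herm x y = 0"
proof -
  have "norm x * norm y \<ge> ((norm x)\<^sup>2 + (norm y)\<^sup>2) / 2"
    using area_le_norms[of x y] assms by linarith
  then have "(norm x - norm y)\<^sup>2 \<le> 0"
    by (simp add: power2_diff)
  then show eq: "norm x = norm y"
    by simp
  have "area x y = (norm x)\<^sup>2"
    using assms eq by simp
  then have "(cmod (herm x y))\<^sup>2 = 0"
    using area_square[of x y] eq by (simp add: power2_eq_square)
  then show "herm x y = 0"
    by simp
qed

text \<open>The coefficient \<open>r\<close> is the distance of the two lines; this is why differences of functions
  along \<open>x\<close> and \<open>y\<close> can be bounded by powers of that distance.\<close>

lemma gram_schmidt_unit:
  assumes x: "norm x = 1" and y: "\<not> (\<exists>c. y = c *s x)"
  obtains t r w where "orthonormal x w" "r > 0" "y = t *s x + complex_of_real r *s w"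
    "r = area x y"
proof -
  define t where "t = herm x y"
  define w' where "w' = y - t *s x"
  define r where "r = norm w'"
  define w where "w = complex_of_real (1 / r) *s w'"
  have "w' \<noteq> 0"
    using y by (auto simp: w'_def)
  then have r: "r > 0"
    by (simp add: r_def)
  have "herm x w' = 0"
    using x by (simp add: w'_def herm_simps t_def herm_self)
  then have on: "orthonormal x w"
    using x r by (simp add: orthonormal_def w_def herm_simps norm_smult_complex r_def norm_divide)
  moreover have eq: "y = t *s x + complex_of_real r *s w"
    using r by (simp add: w_def w'_def vector_smult_assoc)
  moreover have "r = area x y"
    using area_combination[of 1 x t "complex_of_real r" w] r area_orthonormal[OF on] by (simp flip: eq)
  ultimately show thesis
    using r that by blast
qed

lemma area_eq_0_imp:
  assumes "area x y = 0" "x \<noteq> 0"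
  shows "\<exists>c. y = c *s x"
proof (rule ccontr)
  define u where "u = complex_of_real (1 / norm x) *s x"
  have x: "x = complex_of_real (norm x) *s u"
    using assms by (simp add: u_def vector_smult_assoc)
  have u: "norm u = 1"
    using assms by (simp add: u_def norm_smult_complex norm_divide)
  assume no: "\<not> (\<exists>c. y = c *s x)"
  have "\<not> (\<exists>c. y = c *s u)"
  proof
    assume "\<exists>c. y = c *s u"
    then obtain c where "y = c *s u" by blast
    then have "y = (c * complex_of_real (1 / norm x)) *s x"
      by (simp add: u_def vector_smult_assoc)
    with no show False by blast
  qed
  from gram_schmidt_unit[OF u this] obtain t r w where *: "r > 0" "r = area u y"
    by metis
  have "area x y = norm x * area u y"
    using area_combination[of "complex_of_real (norm x)" u 0 1 y] x by simp
  with * assms show False by simp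
qed

lemma gram_schmidt:
  assumes "area x y \<noteq> 0"
  obtains s t r u w where "orthonormal u w" "s > 0" "r > 0"
    "x = complex_of_real s *s u" "y = t *s u + complex_of_real r *s w"
    "area x y = s * r"
proof -
  have "x \<noteq> 0"
    using assms by auto
  define s where "s = norm x"
  define u where "u = complex_of_real (1 / s) *s x"
  have s: "s > 0"
    using \<open>x \<noteq> 0\<close> by (simp add: s_def)
  have x: "x = complex_of_real s *s u"
    using s by (simp add: u_def vector_smult_assoc)
  have u: "norm u = 1"
    using s by (simp add: u_def norm_smult_complex norm_divide s_def[symmetric])
  have a: "area x y = s * area u y"
    using area_combination[of "complex_of_real s" u 0 1 y] x s by simp
  have "\<not> (\<exists>c. y = c *s u)"
  proof
    assume "\<exists>c. y = c *s u"
    then obtain c where "y = c *s u" by blast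
    with area_combination[of 1 u c 0 0] a assms show False by simp
  qed
  from gram_schmidt_unit[OF u this] show thesis
    using a s x that by metis
qed

lemma continuous_on_herm [continuous_intros]:
  assumes "continuous_on S f" "continuous_on S g"
  shows "continuous_on S (\<lambda>x. herm (f x) (g x))"
  unfolding herm_def by (intro continuous_intros assms)

lemma continuous_on_area [continuous_intros]:
  assumes "continuous_on S f" "continuous_on S g"
  shows "continuous_on S (\<lambda>x. area (f x) (g x))"
  unfolding area_def by (intro continuous_intros assms)

lemma continuous_on_smult [continuous_intros]:
  assumes "continuous_on S f" "continuous_on S g"
  shows "continuous_on S (\<lambda>x. f x *s (g x :: complex^'d))"
  unfolding vector_scalar_mult_def by (intro continuous_intros assms)

lemma continuous_on_matrix_vector [continuous_intros]:
  assumes "continuous_on S f" "continuous_on S g"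
  shows "continuous_on S (\<lambda>x. f x *v (g x :: complex^'d))"
  unfolding matrix_vector_mult_def by (intro continuous_intros assms)

lemma continuous_on_matrix_matrix [continuous_intros]:
  assumes "continuous_on S f" "continuous_on S g"
  shows "continuous_on S (\<lambda>x. f x ** (g x :: complex^'d^'d))"
  unfolding matrix_matrix_mult_def by (intro continuous_intros assms)

lemma dist_line_area:
  assumes "x \<noteq> 0" "y \<noteq> 0"
  shows "dist (line x) (line y) = area x y / (norm x * norm y)"
proof -
  have *: "norm (complex_of_real (1 / norm z) *s z) = 1"
    "line (complex_of_real (1 / norm z) *s z) = line z"
    if "z \<noteq> 0" for z :: "complex^'d"
  proof -
    show "norm (complex_of_real (1 / norm z) *s z) = 1"
      using that by (simp add: norm_smult_complex norm_divide)
    show "line (complex_of_real (1 / norm z) *s z) = line z"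
      using that by (subst line_eq_iff) (auto simp: vector_smult_assoc intro!: exI[of _ "complex_of_real (norm z)"])
  qed
  have "dist (line x) (line y) = area (complex_of_real (1 / norm x) *s x) (complex_of_real (1 / norm y) *s y)"
    using dist_line[OF *(1)[OF assms(1)] *(1)[OF assms(2)]]
    unfolding area_def *(2)[OF assms(1)] *(2)[OF assms(2)] *(1)[OF assms(1)] *(1)[OF assms(2)] by simp
  also have "\<dots> = area x y / (norm x * norm y)"
    using area_combination[of "complex_of_real (1 / norm x)" x 0 "complex_of_real (1 / norm y)" y]
    by (simp add: norm_divide)
  finally show ?thesis .
qed

lemma herm_adj: "herm x (adj v *v y) = herm (v *v x) y"
proof -
  have "herm x (adj v *v y) = (\<Sum>i\<in>UNIV. \<Sum>j\<in>UNIV. cnj (x $ i) * (cnj (v $ j $ i) * y $ j))"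
    by (simp add: herm_def adj_def matrix_vector_mult_def sum_distrib_left)
  also have "\<dots> = (\<Sum>j\<in>UNIV. \<Sum>i\<in>UNIV. cnj (x $ i) * (cnj (v $ j $ i) * y $ j))"
    by (rule sum.swap)
  also have "\<dots> = herm (v *v x) y"
    by (simp add: herm_def matrix_vector_mult_def sum_distrib_left sum_distrib_right mult_ac)
  finally show ?thesis .
qed

section \<open>Averaging over one step\<close>

definition pair_mean :: "(complex^'d^'d) measure \<Rightarrow> ((complex^'d) \<times> (complex^'d) \<Rightarrow> 'b)
    \<Rightarrow> (complex^'d) \<times> (complex^'d) \<Rightarrow> 'b::{banach, second_countable_topology}" where
  "pair_mean \<mu> F = (\<lambda>(x, y). \<integral> v. F (v *v x, v *v y) \<partial>\<mu>)"

definition mean :: "(complex^'d^'d) measure \<Rightarrow> ((complex^'d) \<Rightarrow> 'b)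
    \<Rightarrow> (complex^'d) \<Rightarrow> 'b::{banach, second_countable_topology}" where
  "mean \<mu> \<phi> = (\<lambda>x. \<integral> v. \<phi> (v *v x) \<partial>\<mu>)"

text \<open>The class of functions on which the averaging is well behaved: under the second moment condition,
  quadratic growth makes all averages absolutely convergent.\<close>

definition quad :: "('a::real_normed_vector \<Rightarrow> 'b::real_normed_vector) \<Rightarrow> bool" where
  "quad F \<longleftrightarrow> continuous_on UNIV F \<and> (\<exists>C. \<forall>X. norm (F X) \<le> C * (norm X)\<^sup>2)"

text \<open>Linear substitutions in a pair. They commute with the action of matrices on both components, so
  averages at one pair determine the averages at every pair in its span.\<close>

definition comb :: "complex \<Rightarrow> complex \<Rightarrow> complex \<Rightarrow> complex
    \<Rightarrow> (complex^'d) \<times> (complex^'d) \<Rightarrow> (complex^'d) \<times> (complex^'d)" where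
  "comb a b c d = (\<lambda>(x, y). (a *s x + b *s y, c *s x + d *s y))"

lemma pair_mean_fst: "pair_mean \<mu> (\<lambda>X. \<phi> (fst X)) = (\<lambda>X. mean \<mu> \<phi> (fst X))"
  by (simp add: pair_mean_def mean_def fun_eq_iff)

lemma iter_pair_mean_fst: "(pair_mean \<mu> ^^ n) (\<lambda>X. \<phi> (fst X)) = (\<lambda>X. (mean \<mu> ^^ n) \<phi> (fst X))"
  by (induction n) (simp_all add: pair_mean_fst)

lemma matrix_vector_comb: "v *v (a *s x + b *s y) = a *s (v *v x) + b *s (v *v y :: complex^'d)"
  by (simp add: matrix_vector_right_distrib vector_scalar_commute)

lemma pair_mean_comb: "pair_mean \<mu> (\<lambda>X. F (comb a b c d X)) = (\<lambda>X. pair_mean \<mu> F (comb a b c d X))"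
  by (simp add: pair_mean_def fun_eq_iff comb_def matrix_vector_comb)

lemma iter_pair_mean_comb: "(pair_mean \<mu> ^^ n) (\<lambda>X. F (comb a b c d X)) = (\<lambda>X. (pair_mean \<mu> ^^ n) F (comb a b c d X))"
  by (induction n) (simp_all add: pair_mean_comb)

lemma norm_pair_square: "(norm (x, y))\<^sup>2 = (norm x)\<^sup>2 + (norm y)\<^sup>2"
  by (simp add: norm_Pair)

lemma norm_matrix_vector_square_le:
  "(norm (v *v x))\<^sup>2 \<le> (norm v)\<^sup>2 * (norm (x :: complex^'d))\<^sup>2" for v :: "complex^'d^'d"
proof -
  have "cmod ((v *v x) $ i) \<le> norm (v $ i) * norm x" for i
  proof -
    have "cmod ((v *v x) $ i) \<le> (\<Sum>j\<in>UNIV. cmod (v $ i $ j) * cmod (x $ j))"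
      by (simp add: matrix_vector_mult_def) (rule order_trans[OF norm_sum], simp add: norm_mult)
    also have "\<dots> \<le> norm (v $ i) * norm x"
      unfolding norm_vec_def using L2_set_mult_ineq[of "\<lambda>j. cmod (v $ i $ j)" "\<lambda>j. cmod (x $ j)" UNIV]
      by simp
    finally show ?thesis .
  qed
  then have "(\<Sum>i\<in>UNIV. (cmod ((v *v x) $ i))\<^sup>2) \<le> (\<Sum>i\<in>UNIV. (norm (v $ i) * norm x)\<^sup>2)"
    by (intro sum_mono power_mono) auto
  then show ?thesis
    by (simp add: norm_vec_square[of v] norm_vec_square[of "v *v x"] power_mult_distrib sum_distrib_right)
qed

lemma quad_fst: "quad \<phi> \<Longrightarrow> quad (\<lambda>X. \<phi> (fst X))"
proof -
  assume "quad \<phi>"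
  then obtain C where C: "continuous_on UNIV \<phi>" "\<And>x. norm (\<phi> x) \<le> C * (norm x)\<^sup>2"
    by (auto simp: quad_def)
  have "norm (\<phi> (fst X)) \<le> \<bar>C\<bar> * (norm X)\<^sup>2" for X
  proof -
    have "norm (\<phi> (fst X)) \<le> \<bar>C\<bar> * (norm (fst X))\<^sup>2"
      by (rule order_trans[OF C(2)]) (simp add: mult_right_mono)
    also have "\<dots> \<le> \<bar>C\<bar> * (norm X)\<^sup>2"
      using norm_fst_le[of "fst X" "snd X"] by (intro mult_left_mono power_mono) auto
    finally show ?thesis .
  qed
  moreover have "continuous_on UNIV (\<lambda>X. \<phi> (fst X))"
    by (rule continuous_on_compose2[OF C(1)]) (auto intro: continuous_intros)
  ultimately show ?thesis
    unfolding quad_def by blast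
qed

lemma quad_add: "quad F \<Longrightarrow> quad G \<Longrightarrow> quad (\<lambda>X. F X + G X)"
proof -
  assume "quad F" "quad G"
  then obtain C D where *: "continuous_on UNIV F" "\<And>x. norm (F x) \<le> C * (norm x)\<^sup>2"
     "continuous_on UNIV G" "\<And>x. norm (G x) \<le> D * (norm x)\<^sup>2"
    by (auto simp: quad_def)
  have "norm (F X + G X) \<le> (C + D) * (norm X)\<^sup>2" for X
    using norm_triangle_ineq[of "F X" "G X"] *(2,4)[of X] by (simp add: distrib_right)
  with * show ?thesis
    by (auto simp: quad_def intro!: continuous_intros)
qed

lemma quad_bounded_linear: "quad F \<Longrightarrow> bounded_linear L \<Longrightarrow> quad (\<lambda>X. L (F X))"
proof -
  assume "quad F" and L: "bounded_linear L"
  then obtain C where *: "continuous_on UNIV F" "\<And>x. norm (F x) \<le> C * (norm x)\<^sup>2"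
    by (auto simp: quad_def)
  from L obtain K where K: "K > 0" "\<And>x. norm (L x) \<le> norm x * K"
    using bounded_linear.pos_bounded by blast
  have "norm (L (F X)) \<le> (K * C) * (norm X)\<^sup>2" for X
  proof -
    have "norm (L (F X)) \<le> K * norm (F X)" using K(2)[of "F X"] by (simp add: mult.commute)
    also have "\<dots> \<le> K * (C * (norm X)\<^sup>2)"
      by (intro mult_left_mono) (use K * in auto)
    finally show ?thesis by (simp add: mult.assoc)
  qed
  moreover have "continuous_on UNIV (\<lambda>X. L (F X))"
    by (rule bounded_linear.continuous_on[OF L *(1)])
  ultimately show ?thesis
    by (auto simp: quad_def)
qed

lemma quad_scaleR: "quad F \<Longrightarrow> quad (\<lambda>X. c *\<^sub>R F X)"
  by (rule quad_bounded_linear[OF _ bounded_linear_scaleR_right])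

lemma quad_mult: "quad F \<Longrightarrow> quad (\<lambda>X. c * (F X :: real))"
  by (rule quad_bounded_linear[OF _ bounded_linear_mult_right])

lemma quad_diff: "quad F \<Longrightarrow> quad G \<Longrightarrow> quad (\<lambda>X. F X - G X)"
  using quad_add[of F "\<lambda>X. - G X"] quad_bounded_linear[of G uminus] by (simp add: bounded_linear_minus[OF bounded_linear_ident])

lemma quad_norm: "quad F \<Longrightarrow> quad (\<lambda>X. norm (F X))"
  by (auto simp: quad_def intro!: continuous_intros)

lemma norm_comb_le: "\<exists>K\<ge>0. \<forall>X. norm (comb a b c d X) \<le> K * norm X"
proof (intro exI conjI allI)
  let ?K = "cmod a + cmod b + cmod c + cmod d"
  fix X :: "(complex^'a) \<times> (complex^'a)"
  obtain x y where X: "X = (x, y)" by fastforce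
  have le: "norm x \<le> norm X" "norm y \<le> norm X"
    unfolding X by (rule norm_fst_le norm_snd_le)+
  have "norm (comb a b c d X) \<le> norm (a *s x + b *s y) + norm (c *s x + d *s y)"
    unfolding X comb_def prod.case by (rule norm_Pair_le)
  also have "\<dots> \<le> (norm (a *s x) + norm (b *s y)) + (norm (c *s x) + norm (d *s y))"
    by (intro add_mono norm_triangle_ineq)
  also have "\<dots> \<le> (cmod a * norm X + cmod b * norm X) + (cmod c * norm X + cmod d * norm X)"
    unfolding norm_smult_complex by (intro add_mono mult_left_mono le norm_ge_zero)
  finally show "norm (comb a b c d X) \<le> ?K * norm X"
    by (simp add: algebra_simps)
qed simp

lemma quad_comb:
  fixes F :: "(complex^'d) \<times> (complex^'d) \<Rightarrow> 'b::real_normed_vector"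
  assumes "quad F"
  shows "quad (\<lambda>X. F (comb a b c d X))"
proof -
  from assms obtain C where *: "continuous_on UNIV F" "\<And>x. norm (F x) \<le> C * (norm x)\<^sup>2"
    by (auto simp: quad_def)
  obtain K where K: "K \<ge> 0" "\<And>X :: (complex^'d) \<times> (complex^'d). norm (comb a b c d X) \<le> K * norm X"
    using norm_comb_le[of a b c d] by blast
  have "norm (F (comb a b c d X)) \<le> (\<bar>C\<bar> * K\<^sup>2) * (norm X)\<^sup>2" for X
  proof -
    have "norm (F (comb a b c d X)) \<le> \<bar>C\<bar> * (norm (comb a b c d X))\<^sup>2"
      by (rule order_trans[OF *(2)]) (simp add: mult_right_mono)
    also have "\<dots> \<le> \<bar>C\<bar> * (K * norm X)\<^sup>2"
      by (intro mult_left_mono power_mono K) auto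
    finally show ?thesis by (simp add: power_mult_distrib mult.assoc)
  qed
  moreover have "continuous_on UNIV (\<lambda>X. F (comb a b c d X))"
    by (rule continuous_on_compose2[OF *(1)])
       (auto simp: comb_def case_prod_unfold intro!: continuous_intros)
  ultimately show ?thesis
    by (auto simp: quad_def)
qed

lemma quad_norm_square: "quad (\<lambda>X. (norm X)\<^sup>2)"
  by (auto simp: quad_def intro!: continuous_intros exI[of _ 1])

lemma quad_area: "quad (\<lambda>X. area (fst X) (snd X))"
  unfolding quad_def
proof (intro conjI exI allI)
  fix X :: "(complex^'a) \<times> (complex^'a)"
  have "area (fst X) (snd X) \<le> (norm X)\<^sup>2 / 2"
    using area_le[of "fst X" "snd X"] norm_pair_square[of "fst X" "snd X"] by simp
  then show "norm (area (fst X) (snd X)) \<le> 1 * (norm X)\<^sup>2"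
    using area_nonneg[of "fst X" "snd X"] by (simp del: area_nonneg)
qed (auto intro!: continuous_intros)

text \<open>The hypothesis \<open>\<integral> v* v d\<mu> = Id\<close> enters through \<open>integral_norm_square\<close>: the function \<open>\<parallel>x\<parallel>\<^sup>2\<close> is
  preserved by averaging, and hence so is every bound by a multiple of it.\<close>

locale stochastic =
  fixes \<mu> :: "(complex^'d::finite^'d) measure"
  assumes stochastic: "stochastic_measure \<mu>"
begin

abbreviation "iter n \<equiv> pair_mean \<mu> ^^ n"

lemma sets_\<mu> [measurable_cong]: "sets \<mu> = sets borel"
  using stochastic by (simp add: stochastic_measure_def)

text \<open>The Bochner integral of a non-integrable function is 0, whereas this one equals the identity matrix.\<close>

lemma integrable_adj: "integrable \<mu> (\<lambda>v. adj v ** v)"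
proof (rule ccontr)
  assume "\<not> ?thesis"
  then have "mat 1 = (0 :: complex^'d^'d)"
    using stochastic not_integrable_integral_eq[of \<mu> "\<lambda>v. adj v ** v"] by (simp add: stochastic_measure_def)
  then have "mat 1 $ i $ i = (0 :: complex^'d^'d) $ i $ i" for i
    by simp
  then show False
    by (simp add: mat_def)
qed

lemma integral_norm_square:
  "integrable \<mu> (\<lambda>v. (norm (v *v x))\<^sup>2)" "(\<integral> v. (norm (v *v x))\<^sup>2 \<partial>\<mu>) = (norm x)\<^sup>2"
proof -
  have lin: "bounded_linear (\<lambda>M::complex^'d^'d. Re (herm x (M *v x)))"
    unfolding herm_def matrix_vector_mult_def vec_lambda_beta
    by (intro bounded_linear_compose[OF bounded_linear_Re] bounded_linear_sum bounded_linear_const_mult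
        bounded_linear_mult_const bounded_linear_compose[OF bounded_linear_vec_nth bounded_linear_vec_nth])
  have eq: "Re (herm x ((adj v ** v) *v x)) = (norm (v *v x))\<^sup>2" for v
    by (simp add: matrix_vector_mul_assoc[symmetric] herm_adj herm_self del: of_real_power)
  show "integrable \<mu> (\<lambda>v. (norm (v *v x))\<^sup>2)"
    using integrable_bounded_linear[OF lin integrable_adj] by (simp only: eq)
  have "(\<integral> v. (norm (v *v x))\<^sup>2 \<partial>\<mu>) = Re (herm x ((\<integral> v. adj v ** v \<partial>\<mu>) *v x))"
    using integral_bounded_linear[OF lin integrable_adj] by (simp only: eq)
  also have "\<dots> = (norm x)\<^sup>2"
    using stochastic by (simp add: stochastic_measure_def herm_self del: of_real_power)
  finally show "(\<integral> v. (norm (v *v x))\<^sup>2 \<partial>\<mu>) = (norm x)\<^sup>2" .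
qed

text \<open>The Frobenius norm is the sum of the squared lengths of the columns, which are images of basis vectors.\<close>

lemma integrable_norm_square: "integrable \<mu> (\<lambda>v. (norm v)\<^sup>2)"
proof -
  have "(norm v)\<^sup>2 = (\<Sum>j\<in>UNIV. (norm (v *v axis j 1))\<^sup>2)" for v :: "complex^'d^'d"
  proof -
    have "(norm v)\<^sup>2 = (\<Sum>i\<in>UNIV. \<Sum>j\<in>UNIV. (cmod (v $ i $ j))\<^sup>2)"
      by (simp add: norm_vec_square)
    also have "\<dots> = (\<Sum>j\<in>UNIV. \<Sum>i\<in>UNIV. (cmod (v $ i $ j))\<^sup>2)"
      by (rule sum.swap)
    also have "\<dots> = (\<Sum>j\<in>UNIV. (norm (v *v axis j 1))\<^sup>2)"
      by (intro sum.cong refl)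
         (simp add: norm_vec_square matrix_vector_mult_def axis_def if_distrib [of "(*) _"] cong: if_cong)
    finally show ?thesis .
  qed
  then show ?thesis
    by (simp add: integral_norm_square)
qed

lemma integrable_pair: "integrable \<mu> (\<lambda>v. (norm (v *v x, v *v y))\<^sup>2)"
  by (simp add: norm_pair_square integral_norm_square)

lemma measurable_continuous:
  assumes "continuous_on UNIV (f :: complex^'d^'d \<Rightarrow> 'b::{second_countable_topology, metric_space})"
  shows "f \<in> borel_measurable \<mu>"
  using borel_measurable_continuous_onI[OF assms] measurable_cong_sets[OF sets_\<mu> refl] by blast

lemma integrable_quad:
  fixes F :: "_ \<Rightarrow> 'b::{banach, second_countable_topology}"
  assumes "quad F"
  shows "integrable \<mu> (\<lambda>v. F (v *v x, v *v y))"
proof -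
  obtain C where C: "continuous_on UNIV F" "\<And>X. norm (F X) \<le> C * (norm X)\<^sup>2"
    using assms by (auto simp: quad_def)
  show ?thesis
  proof (rule Bochner_Integration.integrable_bound)
    show "integrable \<mu> (\<lambda>v. C * (norm (v *v x, v *v y))\<^sup>2)"
      by (intro integrable_mult_right integrable_pair)
    show "(\<lambda>v. F (v *v x, v *v y)) \<in> borel_measurable \<mu>"
      by (intro measurable_continuous continuous_on_compose2[OF C(1)] continuous_intros) auto
    show "AE v in \<mu>. norm (F (v *v x, v *v y)) \<le> norm (C * (norm (v *v x, v *v y))\<^sup>2)"
      by (intro always_eventually allI order_trans[OF C(2)]) (simp add: order_trans[OF _ abs_ge_self])
  qed
qed

lemma pair_mean_bound:
  fixes F :: "_ \<Rightarrow> 'b::{banach, second_countable_topology}"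
  assumes "quad F" "\<And>X. norm (F X) \<le> C * (norm X)\<^sup>2"
  shows "norm (pair_mean \<mu> F X) \<le> C * (norm X)\<^sup>2"
proof -
  obtain x y where X: "X = (x, y)" by fastforce
  have "norm (pair_mean \<mu> F X) \<le> (\<integral> v. norm (F (v *v x, v *v y)) \<partial>\<mu>)"
    by (simp add: X pair_mean_def)
  also have "\<dots> \<le> (\<integral> v. C * (norm (v *v x, v *v y))\<^sup>2 \<partial>\<mu>)"
    by (intro integral_mono integrable_norm integrable_quad integrable_mult_right integrable_pair assms)
  also have "\<dots> = C * (norm X)\<^sup>2"
    by (simp add: X norm_pair_square integral_norm_square)
  finally show ?thesis .
qed

lemma quad_pair_mean:
  fixes F :: "(complex^'d) \<times> (complex^'d) \<Rightarrow> 'b::{banach, second_countable_topology}"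
  assumes "quad F"
  shows "quad (pair_mean \<mu> F)"
proof -
  obtain C where C: "continuous_on UNIV F" "\<And>X. norm (F X) \<le> C * (norm X)\<^sup>2"
    using assms by (auto simp: quad_def)
  have "isCont (pair_mean \<mu> F) X" for X
  proof (rule continuous_at_sequentiallyI)
    fix u assume u: "u \<longlonglongrightarrow> X"
    then obtain R where R: "\<And>n. norm (u n) \<le> R"
      using convergent_imp_Bseq[OF convergentI[OF u]] by (auto simp: Bseq_def)
    have "(\<lambda>n. \<integral> v. F (v *v fst (u n), v *v snd (u n)) \<partial>\<mu>)
        \<longlonglongrightarrow> (\<integral> v. F (v *v fst X, v *v snd X) \<partial>\<mu>)"
    proof (rule integral_dominated_convergence)
      show "integrable \<mu> (\<lambda>v. \<bar>C\<bar> * (R\<^sup>2 * (norm v)\<^sup>2))"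
        by (intro integrable_mult_right integrable_norm_square)
      show "AE v in \<mu>. (\<lambda>n. F (v *v fst (u n), v *v snd (u n))) \<longlonglongrightarrow> F (v *v fst X, v *v snd X)"
      proof (rule always_eventually, rule allI)
        fix v :: "complex^'d^'d"
        have "continuous_on UNIV (\<lambda>X. F (v *v fst X, v *v snd X))"
          by (intro continuous_on_compose2[OF C(1)] continuous_intros) auto
        then have "isCont (\<lambda>X. F (v *v fst X, v *v snd X)) X"
          by (simp add: continuous_on_eq_continuous_at del: split_paired_All)
        from isCont_tendsto_compose[OF this u]
        show "(\<lambda>n. F (v *v fst (u n), v *v snd (u n))) \<longlonglongrightarrow> F (v *v fst X, v *v snd X)" .
      qed
      show "AE v in \<mu>. norm (F (v *v fst (u n), v *v snd (u n))) \<le> \<bar>C\<bar> * (R\<^sup>2 * (norm v)\<^sup>2)" for n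
      proof (rule always_eventually, rule allI)
        fix v :: "complex^'d^'d"
        have "(norm (v *v fst (u n), v *v snd (u n)))\<^sup>2
            \<le> (norm v)\<^sup>2 * (norm (fst (u n)))\<^sup>2 + (norm v)\<^sup>2 * (norm (snd (u n)))\<^sup>2"
          unfolding norm_pair_square by (intro add_mono norm_matrix_vector_square_le)
        also have "\<dots> = (norm v)\<^sup>2 * (norm (u n))\<^sup>2"
          using norm_pair_square[of "fst (u n)" "snd (u n)"] by (simp add: distrib_left)
        also have "\<dots> \<le> (norm v)\<^sup>2 * R\<^sup>2"
          by (intro mult_left_mono power_mono R) auto
        finally have le: "(norm (v *v fst (u n), v *v snd (u n)))\<^sup>2 \<le> R\<^sup>2 * (norm v)\<^sup>2"
          by (simp only: mult.commute)
        have "norm (F (v *v fst (u n), v *v snd (u n))) \<le> \<bar>C\<bar> * (norm (v *v fst (u n), v *v snd (u n)))\<^sup>2"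
          by (rule order_trans[OF C(2)]) (simp add: mult_right_mono)
        also have "\<dots> \<le> \<bar>C\<bar> * (R\<^sup>2 * (norm v)\<^sup>2)"
          by (intro mult_left_mono le) simp
        finally show "norm (F (v *v fst (u n), v *v snd (u n))) \<le> \<bar>C\<bar> * (R\<^sup>2 * (norm v)\<^sup>2)" .
      qed
    qed (use integrable_quad[OF assms] in \<open>auto simp: integrable_iff_bounded\<close>)
    then show "(\<lambda>n. pair_mean \<mu> F (u n)) \<longlonglongrightarrow> pair_mean \<mu> F X"
      by (simp add: pair_mean_def case_prod_unfold)
  qed
  then show ?thesis
    using pair_mean_bound[OF assms C(2)] by (auto simp: quad_def continuous_on_eq_continuous_at)
qed

lemma quad_iter:
  fixes F :: "_ \<Rightarrow> 'b::{banach, second_countable_topology}"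
  shows "quad F \<Longrightarrow> quad (iter n F)"
  by (induction n) (simp_all add: quad_pair_mean)

lemma pair_mean_add:
  fixes F :: "_ \<Rightarrow> 'b::{banach, second_countable_topology}"
  shows "quad F \<Longrightarrow> quad G \<Longrightarrow> pair_mean \<mu> (\<lambda>X. F X + G X) = (\<lambda>X. pair_mean \<mu> F X + pair_mean \<mu> G X)"
  by (simp add: fun_eq_iff pair_mean_def integrable_quad)

lemma pair_mean_diff:
  fixes F :: "_ \<Rightarrow> 'b::{banach, second_countable_topology}"
  shows "quad F \<Longrightarrow> quad G \<Longrightarrow> pair_mean \<mu> (\<lambda>X. F X - G X) = (\<lambda>X. pair_mean \<mu> F X - pair_mean \<mu> G X)"
  by (simp add: fun_eq_iff pair_mean_def integrable_quad)

lemma pair_mean_bounded_linear: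
  fixes F :: "_ \<Rightarrow> 'b::{banach, second_countable_topology}"
    and L :: "'b \<Rightarrow> 'c::{banach, second_countable_topology}"
  shows "quad F \<Longrightarrow> bounded_linear L \<Longrightarrow> pair_mean \<mu> (\<lambda>X. L (F X)) = (\<lambda>X. L (pair_mean \<mu> F X))"
  by (simp add: fun_eq_iff pair_mean_def integral_bounded_linear[OF _ integrable_quad])

lemma pair_mean_mono: "quad F \<Longrightarrow> quad G \<Longrightarrow> (\<And>X. F X \<le> (G X :: real)) \<Longrightarrow> pair_mean \<mu> F X \<le> pair_mean \<mu> G X"
  by (simp add: pair_mean_def case_prod_unfold integrable_quad integral_mono)

lemma norm_pair_mean_le:
  fixes F :: "_ \<Rightarrow> 'b::{banach, second_countable_topology}"
  shows "norm (pair_mean \<mu> F X) \<le> pair_mean \<mu> (\<lambda>X. norm (F X)) X"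
  by (simp add: pair_mean_def case_prod_unfold)

lemma iter_add:
  fixes F :: "_ \<Rightarrow> 'b::{banach, second_countable_topology}"
  shows "quad F \<Longrightarrow> quad G \<Longrightarrow> iter n (\<lambda>X. F X + G X) = (\<lambda>X. iter n F X + iter n G X)"
  by (induction n) (simp_all add: pair_mean_add quad_iter)

lemma iter_bounded_linear:
  fixes F :: "_ \<Rightarrow> 'b::{banach, second_countable_topology}"
  shows "quad F \<Longrightarrow> bounded_linear L \<Longrightarrow> iter n (\<lambda>X. L (F X)) = (\<lambda>X. L (iter n F X))"
  by (induction n) (simp_all add: pair_mean_bounded_linear quad_iter)

lemma iter_scaleR:
  fixes F :: "_ \<Rightarrow> 'b::{banach, second_countable_topology}"
  shows "quad F \<Longrightarrow> iter n (\<lambda>X. c *\<^sub>R F X) = (\<lambda>X. c *\<^sub>R iter n F X)"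
  by (rule iter_bounded_linear[OF _ bounded_linear_scaleR_right])

lemma iter_mult: "quad F \<Longrightarrow> iter n (\<lambda>X. c * F X) = (\<lambda>X. c * (iter n F X :: real))"
  by (rule iter_bounded_linear[OF _ bounded_linear_mult_right])

lemma iter_diff:
  fixes F :: "_ \<Rightarrow> 'b::{banach, second_countable_topology}"
  assumes "quad F" "quad G"
  shows "iter n (\<lambda>X. F X - G X) = (\<lambda>X. iter n F X - iter n G X)"
  using iter_add[OF assms(1) quad_scaleR[OF assms(2), of "-1"]] iter_scaleR[OF assms(2), of n "-1"]
  by simp

lemma iter_mono: "quad F \<Longrightarrow> quad G \<Longrightarrow> (\<And>X. F X \<le> (G X :: real)) \<Longrightarrow> iter n F X \<le> iter n G X"
  by (induction n arbitrary: X) (simp_all add: pair_mean_mono quad_iter)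

lemma norm_iter_le:
  fixes F :: "_ \<Rightarrow> 'b::{banach, second_countable_topology}"
  assumes "quad F"
  shows "norm (iter n F X) \<le> iter n (\<lambda>X. norm (F X)) X"
proof (induction n arbitrary: X)
  case (Suc n)
  have "norm (iter (Suc n) F X) \<le> pair_mean \<mu> (\<lambda>X. norm (iter n F X)) X"
    by (simp add: norm_pair_mean_le)
  also have "\<dots> \<le> pair_mean \<mu> (iter n (\<lambda>X. norm (F X))) X"
    by (intro pair_mean_mono quad_norm quad_iter assms Suc)
  finally show ?case by simp
qed simp

lemma pair_mean_norm_square: "pair_mean \<mu> (\<lambda>X. (norm X)\<^sup>2) = (\<lambda>X. (norm X)\<^sup>2)"
  by (simp add: fun_eq_iff pair_mean_def norm_pair_square integral_norm_square)

lemma iter_norm_square: "iter n (\<lambda>X. (norm X)\<^sup>2) = (\<lambda>X. (norm X)\<^sup>2)"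
  by (induction n) (simp_all add: pair_mean_norm_square)

end

section \<open>Almost sure properties of matrix products\<close>

text \<open>The product measure is defined as an extension of the rectangle premeasure, chosen arbitrarily
  when there are several and null when there is none. This is what remains of the product
  formula for factors that are not \<open>\<sigma>\<close>-finite.\<close>

lemma PiM_rectangles_or_null:
  assumes "finite I"
  shows "(\<forall>A. (\<forall>i\<in>I. A i \<in> sets (M i)) \<longrightarrow>
            emeasure (Pi\<^sub>M I M) (Pi\<^sub>E I A) = (\<Prod>i\<in>I. emeasure (M i) (A i)))
       \<or> (\<forall>B. emeasure (Pi\<^sub>M I M) B = 0)"
proof -
  define \<Omega> where "\<Omega> = (\<Pi>\<^sub>E i\<in>I. space (M i))"
  define J where "J = {(J, X). (J \<noteq> {} \<or> I = {}) \<and> finite J \<and> J \<subseteq> I \<and> X \<in> (\<Pi> j\<in>J. sets (M j))}"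
  define G where "G = (\<lambda>(J, X). prod_emb I M J (\<Pi>\<^sub>E j\<in>J. X j))"
  define m where "m = (\<lambda>(J, X). \<Prod>j\<in>J \<union> {i\<in>I. emeasure (M i) (space (M i)) \<noteq> 1}.
      if j \<in> J then emeasure (M j) (X j) else emeasure (M j) (space (M j)))"
  have P: "Pi\<^sub>M I M = extend_measure \<Omega> J G m"
    unfolding PiM_def \<Omega>_def J_def G_def m_def ..
  have sub: "G ` J \<subseteq> Pow \<Omega>"
    using prod_algebra_sets_into_space[of I M] by (simp add: prod_algebra_def G_def J_def \<Omega>_def)
  show ?thesis
  proof (cases "\<exists>\<mu>'. (\<forall>i\<in>J. \<mu>' (G i) = m i) \<and> measure_space \<Omega> (sigma_sets \<Omega> (G ` J)) \<mu>'")
    case True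
    then obtain \<mu>' where \<mu>': "\<And>i. i \<in> J \<Longrightarrow> \<mu>' (G i) = m i" "measure_space \<Omega> (sigma_sets \<Omega> (G ` J)) \<mu>'"
      by blast
    have sets: "sets (Pi\<^sub>M I M) = sigma_sets \<Omega> (G ` J)"
      unfolding P by (rule sets_extend_measure[OF sub])
    have "emeasure (Pi\<^sub>M I M) (Pi\<^sub>E I A) = (\<Prod>i\<in>I. emeasure (M i) (A i))" if A: "\<forall>i\<in>I. A i \<in> sets (M i)" for A
    proof -
      have iJ: "(I, A) \<in> J"
        using A assms by (auto simp: J_def)
      have "emeasure (Pi\<^sub>M I M) (G (I, A)) = m (I, A)"
        using \<mu>' by (intro emeasure_extend_measure[OF P \<mu>'(1) sub _ _ iJ]) (auto simp: measure_space_def sets)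
      moreover have "G (I, A) = Pi\<^sub>E I A"
        unfolding G_def prod.case by (rule prod_emb_PiE_same_index) (use A sets.sets_into_space in blast)
      moreover have "m (I, A) = (\<Prod>i\<in>I. emeasure (M i) (A i))"
        unfolding m_def by (auto intro!: prod.cong)
      ultimately show ?thesis by simp
    qed
    then show ?thesis by blast
  next
    case False
    then have "Pi\<^sub>M I M = measure_of \<Omega> (G ` J) (\<lambda>_. 0)"
      unfolding P extend_measure_def by auto
    then show ?thesis
      by (simp add: emeasure_measure_of_conv)
  qed
qed

lemma W_fun_upd: "W (Suc n) (fun_upd \<omega> n v) = v ** W n \<omega>"
proof -
  have "W m (fun_upd \<omega> n v) = W m \<omega>" if "m \<le> n" for m
    using that by (induction m) auto
  then show ?thesis by simp
qed

lemma W_eq_0: "k < n \<Longrightarrow> \<omega> k = 0 \<Longrightarrow> W n \<omega> = (0 :: complex^'d^'d)"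
  by (induction n) (auto simp: less_Suc_eq)

lemma measurable_W:
  assumes [measurable_cong]: "sets M = sets (borel :: (complex^'d^'d) measure)" and "n \<le> m"
  shows "W n \<in> borel_measurable (Pi\<^sub>M {..<m} (\<lambda>_. M))"
  using \<open>n \<le> m\<close>
proof (induction n)
  case 0
  have "W 0 = (\<lambda>_. mat 1 :: complex^'d^'d)"
    by (simp add: fun_eq_iff)
  then show ?case by simp
next
  case (Suc n)
  have [measurable]: "W n \<in> borel_measurable (Pi\<^sub>M {..<m} (\<lambda>_. M))"
    using Suc by simp
  have "(\<lambda>\<omega>. \<omega> n) \<in> measurable (Pi\<^sub>M {..<m} (\<lambda>_. M)) M"
    using Suc by (intro measurable_component_singleton) simp
  then have [measurable]: "(\<lambda>\<omega>. \<omega> n) \<in> borel_measurable (Pi\<^sub>M {..<m} (\<lambda>_. M))"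
    using measurable_cong_sets[OF refl assms(1)] by blast
  have "continuous_on UNIV (\<lambda>p::(complex^'d^'d) \<times> (complex^'d^'d). fst p ** snd p)"
    by (intro continuous_intros)
  then have "(\<lambda>\<omega>. \<omega> n ** W n \<omega>) \<in> borel_measurable (Pi\<^sub>M {..<m} (\<lambda>_. M))"
    by (rule borel_measurable_continuous_Pair[where H = "(**)", rotated 2]) measurable
  then show ?case by simp
qed

text \<open>The step hypothesis passes from a product to the product with one more factor. The
  measure is \<open>\<sigma>\<close>-finite away from the zero matrix, so Fubini's theorem applies to its restriction
  to nonzero matrices; a tuple with a zero entry has product 0, which lies in the set.\<close>

lemma AE_W_closed:
  fixes \<mu> :: "(complex^'d^'d) measure"
  assumes sets: "sets \<mu> = sets borel"
    and int: "integrable \<mu> (\<lambda>v. (norm v)\<^sup>2)"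
    and C: "closed C" "mat 1 \<in> C" "0 \<in> C"
    and step: "\<And>w. w \<in> C \<Longrightarrow> AE v in \<mu>. v ** w \<in> C"
  shows "AE \<omega> in Pi\<^sub>M {..<n} (\<lambda>_. \<mu>). W n \<omega> \<in> C"
proof -
  note [measurable_cong] = sets
  have sp: "space \<mu> = UNIV"
    using sets_eq_imp_space_eq[OF sets] by simp
  \<comment> \<open>the restriction to nonzero matrices, which is \<open>\<sigma>\<close>-finite by the second moment condition\<close>
  define \<mu>' where "\<mu>' = density \<mu> (indicator (- {0}))"
  have sets': "sets \<mu>' = sets borel" "sets \<mu>' = sets \<mu>"
    by (simp_all add: \<mu>'_def sets)
  have em': "emeasure \<mu>' A = emeasure \<mu> (A - {0})" if "A \<in> sets borel" for A
  proof -
    have "emeasure \<mu>' A = (\<integral>\<^sup>+ v. indicator (- {0}) v * indicator A v \<partial>\<mu>)"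
      unfolding \<mu>'_def using that by (intro emeasure_density) (auto simp: sets)
    also have "\<dots> = (\<integral>\<^sup>+ v. indicator (A - {0}) v \<partial>\<mu>)"
      by (intro nn_integral_cong) (auto simp: indicator_def)
    finally show ?thesis
      using that by (simp add: sets)
  qed
  have sf: "sigma_finite_measure \<mu>'"
  proof
    define B where "B k = {v::complex^'d^'d. norm v \<ge> 1 / real (Suc k)} \<union> {0}" for k
    have B_sets: "B k \<in> sets borel" for k
      unfolding B_def by (intro sets.Un borel_closed closed_Collect_le continuous_intros) auto
    have "emeasure \<mu>' (B k) \<noteq> \<infinity>" for k
    proof -
      let ?c = "(real (Suc k))\<^sup>2"
      have le: "indicator (B k - {0}) v \<le> ennreal (?c * (norm v)\<^sup>2)" for v
      proof (cases "v \<in> B k - {0}")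
        case True
        then have "1 \<le> real (Suc k) * norm v"
          by (auto simp: B_def field_simps)
        then have "1 \<le> (real (Suc k) * norm v)\<^sup>2"
          by (rule one_le_power)
        then have "ennreal 1 \<le> ennreal (?c * (norm v)\<^sup>2)"
          unfolding power_mult_distrib by (rule ennreal_leI)
        with True show ?thesis
          by (simp del: of_nat_Suc)
      next
        case False
        then have "indicator (B k - {0}) v = (0 :: ennreal)"
          unfolding indicator_def by auto
        then show ?thesis by simp
      qed
      have "emeasure \<mu>' (B k) = (\<integral>\<^sup>+ v. indicator (B k - {0}) v \<partial>\<mu>)"
        using em'[OF B_sets] B_sets by (simp add: sets)
      also have "\<dots> \<le> (\<integral>\<^sup>+ v. ennreal (?c * (norm v)\<^sup>2) \<partial>\<mu>)"
        by (intro nn_integral_mono le)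
      also have "\<dots> < \<infinity>"
        using integrable_mult_right[OF int, of ?c] by (subst (asm) integrable_iff_bounded) simp
      finally show ?thesis by simp
    qed
    moreover have "\<exists>k. v \<in> B k" for v
    proof (cases "v = 0")
      case False
      then obtain k where "inverse (real (Suc k)) < norm v"
        using reals_Archimedean[of "norm v"] by auto
      then show ?thesis
        by (auto simp: B_def inverse_eq_divide intro!: exI[of _ k])
    qed (simp add: B_def)
    ultimately show "\<exists>A. countable A \<and> A \<subseteq> sets \<mu>' \<and> \<Union> A = space \<mu>' \<and> (\<forall>a\<in>A. emeasure \<mu>' a \<noteq> \<infinity>)"
      using B_sets sets' sets_eq_imp_space_eq[OF sets'(1)] by (intro exI[of _ "range B"]) auto
  qed
  interpret product_sigma_finite "\<lambda>_::nat. \<mu>'"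
    using sf by (simp add: product_sigma_finite_def)
  have C_sets [measurable]: "C \<in> sets borel"
    using C by simp
  have step': "(\<integral>\<^sup>+ v. indicator (- C) (v ** w) \<partial>\<mu>') = 0" if "w \<in> C" for w
  proof -
    have "AE v in \<mu>'. v ** w \<in> C"
      unfolding \<mu>'_def using step[OF that] by (subst AE_density) (auto simp: sets)
    then have "(\<integral>\<^sup>+ v. indicator (- C) (v ** w) \<partial>\<mu>') = (\<integral>\<^sup>+ v. 0 \<partial>\<mu>')"
      by (intro nn_integral_cong_AE) auto
    then show ?thesis by simp
  qed
  have AE': "AE \<omega> in Pi\<^sub>M {..<n} (\<lambda>_. \<mu>'). W n \<omega> \<in> C" for n
  proof (induction n)
    case 0
    then show ?case using C by simp
  next
    case (Suc n)
    have W_meas: "W (Suc n) \<in> borel_measurable (Pi\<^sub>M {..<Suc n} (\<lambda>_. \<mu>'))"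
      by (rule measurable_W[OF sets'(1)]) simp
    have ind0: "(\<lambda>\<omega>. indicator (- C) (W (Suc n) \<omega>) :: ennreal) \<in> borel_measurable (Pi\<^sub>M {..<Suc n} (\<lambda>_. \<mu>'))"
      by (rule measurable_compose[OF W_meas borel_measurable_indicator]) (rule borel_comp[OF C_sets])
    note ind = ind0[unfolded lessThan_Suc]
    have "(\<integral>\<^sup>+ \<omega>. indicator (- C) (W (Suc n) \<omega>) \<partial>Pi\<^sub>M {..<Suc n} (\<lambda>_. \<mu>'))
        = (\<integral>\<^sup>+ \<omega>. (\<integral>\<^sup>+ v. indicator (- C) (W (Suc n) (fun_upd \<omega> n v)) \<partial>\<mu>') \<partial>Pi\<^sub>M {..<n} (\<lambda>_. \<mu>'))"
      unfolding lessThan_Suc by (subst product_nn_integral_insert[OF _ _ ind]) auto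
    also have "\<dots> = (\<integral>\<^sup>+ \<omega>. 0 \<partial>Pi\<^sub>M {..<n} (\<lambda>_. \<mu>'))"
      using Suc by (intro nn_integral_cong_AE) (auto simp: W_fun_upd step' simp del: W.simps)
    finally have "(\<integral>\<^sup>+ \<omega>. indicator (- C) (W (Suc n) \<omega>) \<partial>Pi\<^sub>M {..<Suc n} (\<lambda>_. \<mu>')) = 0"
      by simp
    then have "AE \<omega> in Pi\<^sub>M {..<Suc n} (\<lambda>_. \<mu>'). indicator (- C) (W (Suc n) \<omega>) = (0 :: ennreal)"
      by (subst (asm) nn_integral_0_iff_AE[OF ind0])
    then show ?case
      by eventually_elim (auto simp: indicator_def split: if_splits)
  qed
  let ?Q = "Pi\<^sub>M {..<n} (\<lambda>_. \<mu>)"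
  consider (null) "\<And>B. emeasure ?Q B = 0"
    | (rect) "\<And>A. (\<forall>i\<in>{..<n}. A i \<in> sets \<mu>) \<Longrightarrow> emeasure ?Q (Pi\<^sub>E {..<n} A) = (\<Prod>i\<in>{..<n}. emeasure \<mu> (A i))"
    using PiM_rectangles_or_null[of "{..<n}" "\<lambda>_. \<mu>"] by auto
  then show ?thesis
  proof cases
    case null
    then show ?thesis
      by (intro AE_I[of _ _ "space ?Q"]) auto
  next
    case rect
    \<comment> \<open>on tuples of nonzero matrices the two product measures agree on rectangles, hence everywhere\<close>
    define Y where "Y = Pi\<^sub>E {..<n} (\<lambda>_. - {0 :: complex^'d^'d})"
    have Y: "Y \<in> sets ?Q"
      unfolding Y_def by (intro sets_PiM_I_finite) (auto simp: sets)
    have D: "density ?Q (indicator Y) = Pi\<^sub>M {..<n} (\<lambda>_. \<mu>')"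
    proof (rule PiM_eqI)
      show "sets (density ?Q (indicator Y)) = sets (Pi\<^sub>M {..<n} (\<lambda>_. \<mu>'))"
        using sets'(2) by (simp cong: sets_PiM_cong)
      fix A :: "nat \<Rightarrow> (complex^'d^'d) set"
      assume "\<And>i. i \<in> {..<n} \<Longrightarrow> A i \<in> sets \<mu>'"
      then have A: "\<And>i. i \<in> {..<n} \<Longrightarrow> A i \<in> sets borel"
        by (simp add: sets')
      then have PA: "Pi\<^sub>E {..<n} A \<in> sets ?Q"
        by (intro sets_PiM_I_finite) (auto simp: sets)
      have "emeasure (density ?Q (indicator Y)) (Pi\<^sub>E {..<n} A)
          = (\<integral>\<^sup>+ \<omega>. indicator Y \<omega> * indicator (Pi\<^sub>E {..<n} A) \<omega> \<partial>?Q)"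
        by (intro emeasure_density borel_measurable_indicator Y PA)
      also have "\<dots> = (\<integral>\<^sup>+ \<omega>. indicator (Pi\<^sub>E {..<n} A \<inter> Y) \<omega> \<partial>?Q)"
        by (intro nn_integral_cong) (auto simp: indicator_def)
      also have "\<dots> = emeasure ?Q (Pi\<^sub>E {..<n} A \<inter> Y)"
        using PA Y by simp
      also have "Pi\<^sub>E {..<n} A \<inter> Y = Pi\<^sub>E {..<n} (\<lambda>i. A i - {0})"
        unfolding Y_def PiE_Int by (intro PiE_cong) auto
      also have "emeasure ?Q \<dots> = (\<Prod>i\<in>{..<n}. emeasure \<mu> (A i - {0}))"
        using A by (intro rect) (auto simp: sets)
      also have "\<dots> = (\<Prod>i\<in>{..<n}. emeasure \<mu>' (A i))"
        using A by (intro prod.cong refl) (simp add: em')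
      finally show "emeasure (density ?Q (indicator Y)) (Pi\<^sub>E {..<n} A) = (\<Prod>i\<in>{..<n}. emeasure \<mu>' (A i))" .
    qed simp
    have "AE \<omega> in density ?Q (indicator Y). W n \<omega> \<in> C"
      unfolding D by (rule AE')
    then have "AE \<omega> in ?Q. 0 < (indicator Y \<omega> :: ennreal) \<longrightarrow> W n \<omega> \<in> C"
      by (simp only: AE_density[OF borel_measurable_indicator[OF Y]])
    then have "AE \<omega> in ?Q. \<omega> \<in> Y \<longrightarrow> W n \<omega> \<in> C"
      by eventually_elim (simp add: indicator_def)
    moreover have "W n \<omega> \<in> C" if "\<omega> \<in> space ?Q" "\<omega> \<notin> Y" for \<omega>
    proof -
      from that obtain k where "k < n" "\<omega> k = 0"
        by (auto simp: Y_def space_PiM sp PiE_iff)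
      then show ?thesis
        using C(3) W_eq_0 by metis
    qed
    ultimately show ?thesis
      by (elim AE_mp) (rule AE_I2, blast)
  qed
qed

section \<open>Purification contracts areas\<close>

context stochastic
begin

abbreviation "ar \<equiv> (\<lambda>X :: (complex^'d) \<times> (complex^'d). area (fst X) (snd X))"

lemma iter_area_comb:
  "iter n ar (complex_of_real s *s u, t *s u + complex_of_real r *s w) = \<bar>s\<bar> * \<bar>r\<bar> * iter n ar (u, w)"
proof -
  have "iter n ar (complex_of_real s *s u, t *s u + complex_of_real r *s w)
      = iter n ar (comb s 0 t r (u, w))"
    by (simp add: comb_def)
  also have "\<dots> = iter n (\<lambda>X. ar (comb s 0 t r X)) (u, w)"
    by (simp only: iter_pair_mean_comb[where F = ar])
  also have "(\<lambda>X. ar (comb s 0 t r X)) = (\<lambda>X. (\<bar>s\<bar> * \<bar>r\<bar>) * ar X)"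
    by (simp add: fun_eq_iff comb_def area_combination)
  also have "iter n \<dots> (u, w) = \<bar>s\<bar> * \<bar>r\<bar> * iter n ar (u, w)"
    by (simp only: iter_mult[OF quad_area])
  finally show ?thesis .
qed

lemma iter_area_zero:
  assumes "area x y = 0"
  shows "iter n ar (x, y) = 0"
proof (cases "x = 0")
  case True
  then show ?thesis
    using iter_area_comb[of n 0 0 0 1 y] by simp
next
  case False
  then obtain c where "y = c *s x"
    using area_eq_0_imp assms by blast
  then show ?thesis
    using iter_area_comb[of n 1 x c 0 0] by simp
qed

text \<open>For an orthonormal pair this is \<open>area_le\<close> integrated, as both squared lengths have mean 1; every
  other pair of positive area is a linear substitution in an orthonormal one.\<close>

lemma pair_mean_area_le: "pair_mean \<mu> ar X \<le> ar X"
proof (cases "ar X = 0")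
  case True
  then show ?thesis
    using iter_area_zero[of "fst X" "snd X" 1] by simp
next
  case False
  obtain x y where X: "X = (x, y)" by fastforce
  from False obtain s t r u w where *: "orthonormal u w" "s > 0" "r > 0"
    "x = complex_of_real s *s u" "y = t *s u + complex_of_real r *s w" "area x y = s * r"
    unfolding X fst_conv snd_conv by (rule gram_schmidt)
  have "pair_mean \<mu> ar (u, w) \<le> pair_mean \<mu> (\<lambda>X. (1 / 2) * (norm X)\<^sup>2) (u, w)"
  proof (intro pair_mean_mono quad_area quad_mult quad_norm_square)
    fix X :: "(complex^'d) \<times> (complex^'d)"
    show "ar X \<le> (1 / 2) * (norm X)\<^sup>2"
      using area_le[of "fst X" "snd X"] norm_pair_square[of "fst X" "snd X"] by simp
  qed
  also have "\<dots> = (1 / 2) * (norm (u, w))\<^sup>2"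
    by (simp only: pair_mean_bounded_linear[OF quad_norm_square bounded_linear_mult_right] pair_mean_norm_square)
  also have "\<dots> = 1"
    using *(1) by (simp add: norm_pair_square orthonormal_def)
  finally have "s * r * pair_mean \<mu> ar (u, w) \<le> s * r"
    using * by (simp add: mult_left_le)
  then show ?thesis
    using iter_area_comb[of 1 s u t r w] * by (simp add: X)
qed

lemma iter_area_Suc_le: "iter (Suc n) ar X \<le> iter n ar X"
proof -
  have "iter (Suc n) ar X = iter n (pair_mean \<mu> ar) X"
    by (simp add: funpow_swap1)
  also have "\<dots> \<le> iter n ar X"
    by (intro iter_mono quad_pair_mean quad_area pair_mean_area_le)
  finally show ?thesis .
qed

lemma iter_area_antimono: "m \<le> n \<Longrightarrow> iter n ar X \<le> iter m ar X"
  by (rule lift_Suc_antimono_le[where f = "\<lambda>n. iter n ar X"]) (rule iter_area_Suc_le)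

lemma iter_area_le: "iter n ar X \<le> ar X"
  using iter_area_antimono[of 0 n X] by simp

text \<open>The obstruction to contraction: a pair, orthogonal with equal lengths, whose area no number of
  averaging steps decreases. Zero vectors are included so that the condition is closed and survives
  matrices that kill the pair.\<close>

definition dark_pair :: "complex^'d \<Rightarrow> complex^'d \<Rightarrow> bool" where
  "dark_pair x y \<longleftrightarrow> norm x = norm y \<and> herm x y = 0 \<and> (\<forall>n. iter n ar (x, y) = ar (x, y))"

text \<open>If an average of nonnegative terms vanishes, then so does almost every term. This is applied to the
  gap in \<open>area_le\<close>, which gives orthogonality and equal lengths after one step, and to the decrease of
  the area over \<open>n\<close> further steps.\<close>

lemma dark_pair_step:
  assumes "dark_pair x y"
  shows "AE v in \<mu>. dark_pair (v *v x) (v *v y)"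
proof -
  have xy: "norm x = norm y" "herm x y = 0" and inv: "\<And>n. iter n ar (x, y) = ar (x, y)"
    using assms by (auto simp: dark_pair_def)
  have zero: "AE v in \<mu>. F (v *v x, v *v y) = 0"
    if "quad F" "\<And>X. 0 \<le> (F X :: real)" "pair_mean \<mu> F (x, y) = 0" for F
    using that integral_nonneg_eq_0_iff_AE[OF integrable_quad[OF that(1), of x y]] by (simp add: pair_mean_def)
  have "(area x y)\<^sup>2 = ((norm y)\<^sup>2)\<^sup>2"
    by (simp add: area_square xy)
  then have "area x y = (norm y)\<^sup>2"
    by (simp only: power2_eq_iff_nonneg area_nonneg zero_le_power2)
  then have "ar (x, y) = (1 / 2) * (norm (x, y))\<^sup>2"
    by (simp add: xy norm_pair_square)
  then have "pair_mean \<mu> (\<lambda>X. (1 / 2) * (norm X)\<^sup>2 - ar X) (x, y) = 0"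
    using inv[of 1] iter_diff[OF quad_mult[OF quad_norm_square] quad_area, of 1 "1/2"]
      pair_mean_bounded_linear[OF quad_norm_square bounded_linear_mult_right, of "1/2"] pair_mean_norm_square by simp
  moreover have "ar X \<le> (1 / 2) * (norm X)\<^sup>2" for X :: "(complex^'d) \<times> (complex^'d)"
    using area_le[of "fst X" "snd X"] norm_pair_square[of "fst X" "snd X"] by simp
  ultimately have "AE v in \<mu>. (1 / 2) * (norm (v *v x, v *v y))\<^sup>2 - ar (v *v x, v *v y) = 0"
    by (intro zero[of "\<lambda>X. (1 / 2) * (norm X)\<^sup>2 - ar X"] quad_diff quad_mult quad_norm_square quad_area) auto
  then have 1: "AE v in \<mu>. norm (v *v x) = norm (v *v y) \<and> herm (v *v x) (v *v y) = 0"
  proof eventually_elim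
    case (elim v)
    then have "area (v *v x) (v *v y) = ((norm (v *v x))\<^sup>2 + (norm (v *v y))\<^sup>2) / 2"
      by (simp add: norm_pair_square)
    from area_extremal[OF this] show ?case by blast
  qed
  have "AE v in \<mu>. ar (v *v x, v *v y) - iter n ar (v *v x, v *v y) = 0" for n
  proof (intro zero[of "\<lambda>X. ar X - iter n ar X"] quad_diff quad_iter quad_area)
    show "0 \<le> ar X - iter n ar X" for X
      using iter_area_le[of n X] by simp
    show "pair_mean \<mu> (\<lambda>X. ar X - iter n ar X) (x, y) = 0"
      using iter_diff[OF quad_area quad_iter[OF quad_area], of 1 n] inv[of 1] inv[of "Suc n"] by simp
  qed
  then have "AE v in \<mu>. \<forall>n. ar (v *v x, v *v y) - iter n ar (v *v x, v *v y) = 0"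
    by (simp only: AE_all_countable) simp
  with 1 show ?thesis
    by eventually_elim (auto simp: dark_pair_def)
qed

lemma closed_dark_pair: "closed {w. dark_pair (w *v x) (w *v y)}"
proof -
  have "continuous_on UNIV (\<lambda>w. iter n ar (w *v x, w *v y))" for n
  proof (rule continuous_on_compose2[of UNIV "iter n ar"])
    show "continuous_on UNIV (iter n ar)"
      using quad_iter[OF quad_area, of n] unfolding quad_def by blast
  qed (auto intro!: continuous_intros)
  then show ?thesis
    unfolding dark_pair_def by (auto intro!: closed_Collect_conj closed_Collect_all closed_Collect_eq continuous_intros)
qed

lemma AE_dark_pair:
  assumes "dark_pair x y"
  shows "AE \<omega> in Pi\<^sub>M {..<n} (\<lambda>_. \<mu>). dark_pair (W n \<omega> *v x) (W n \<omega> *v y)"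
proof -
  have "dark_pair 0 0"
    by (simp add: dark_pair_def herm_def iter_area_zero)
  then have "AE \<omega> in Pi\<^sub>M {..<n} (\<lambda>_. \<mu>). W n \<omega> \<in> {w. dark_pair (w *v x) (w *v y)}"
    using assms dark_pair_step
    by (intro AE_W_closed sets_\<mu> integrable_norm_square closed_dark_pair)
       (auto simp: matrix_vector_mul_assoc[symmetric])
  then show ?thesis by simp
qed

end

definition plane_projector :: "complex^'d \<Rightarrow> complex^'d \<Rightarrow> complex^'d^'d" where
  "plane_projector u w = outer u + outer w"

lemma outer_vector: "outer x *v y = herm x y *s x"
  by (simp add: outer_def herm_def matrix_vector_mult_def vec_eq_iff sum_distrib_left mult_ac)

lemma plane_projector_vector: "plane_projector u w *v y = herm u y *s u + herm w y *s w"
  by (simp add: plane_projector_def matrix_vector_mult_add_rdistrib outer_vector)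

lemma orthonormal_herm:
  assumes "orthonormal u w"
  shows "herm u u = 1" "herm w w = 1" "herm u w = 0" "herm w u = 0"
  using assms cnj_herm[of u w] by (auto simp: orthonormal_def herm_self)

lemma orthogonal_projector_plane:
  assumes "orthonormal u w"
  shows "orthogonal_projector (plane_projector u w)"
  unfolding orthogonal_projector_def
proof
  show "plane_projector u w ** plane_projector u w = plane_projector u w"
    by (simp add: matrix_eq matrix_vector_mul_assoc[symmetric] plane_projector_vector herm_simps
        orthonormal_herm[OF assms])
  show "adj (plane_projector u w) = plane_projector u w"
    by (simp add: adj_def plane_projector_def outer_def vec_eq_iff mult.commute)
qed

text \<open>If the row rank were 1, all rows would be multiples of one vector and the image would be a line,
  yet it contains the two orthogonal unit vectors.\<close>

lemma rank_plane_projector: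
  assumes "orthonormal u w"
  shows "rank (plane_projector u w) \<noteq> 1"
proof
  let ?P = "plane_projector u w"
  assume "rank ?P = 1"
  then have dim: "vec.dim (rows ?P) = 1"
    by (simp add: row_rank_def_gen)
  obtain B where B: "rows ?P \<subseteq> vec.span B" "card B = 1"
    using vec.basis_exists[of "rows ?P"] dim by metis
  then obtain b where b: "B = {b}"
    by (auto simp: card_1_singleton_iff)
  have "\<exists>k. row i ?P = k *s b" for i
    using B(1) unfolding b vec.span_singleton by (auto simp: rows_def)
  then obtain k where k: "\<And>i. row i ?P = k i *s b"
    by metis
  have img: "?P *v z = (\<Sum>j\<in>UNIV. b $ j * z $ j) *s (\<chi> i. k i)" for z
  proof -
    have "?P $ i $ j = k i * b $ j" for i j
      using k[of i] by (simp add: row_def vec_eq_iff)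
    then show ?thesis
      by (simp add: vec_eq_iff matrix_vector_mult_def sum_distrib_left sum_distrib_right mult_ac)
  qed
  obtain a c where ac: "u = a *s (\<chi> i. k i)" "w = c *s (\<chi> i. k i)"
    using img[of u] img[of w] by (simp add: plane_projector_vector orthonormal_herm[OF assms])
  then have "u \<noteq> 0" "w \<noteq> 0" "herm u w = 0"
    using assms by (auto simp: orthonormal_def)
  with ac show False
    by (auto simp: herm_simps herm_self)
qed

context stochastic
begin

text \<open>Almost every product of matrices keeps a dark pair orthogonal with equal lengths, that is,
  it satisfies \<open>\<pi> W* W \<pi> = c \<pi>\<close> for the projector \<open>\<pi>\<close> onto the plane of the pair. Purification would make
  this projector have rank one.\<close>

lemma no_dark_pair:
  assumes "purifying \<mu>" "orthonormal u w"
  shows "\<not> dark_pair u w"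
proof
  assume "dark_pair u w"
  let ?P = "plane_projector u w"
  have "AE \<omega> in Pi\<^sub>M {..<n} (\<lambda>_. \<mu>). \<exists>c. ?P ** adj (W n \<omega>) ** W n \<omega> ** ?P = mat c ** ?P" for n
    using AE_dark_pair[OF \<open>dark_pair u w\<close>, of n]
  proof eventually_elim
    case (elim \<omega>)
    let ?W = "W n \<omega>"
    have e: "herm (?W *v u) (?W *v w) = 0" "herm (?W *v w) (?W *v u) = 0"
      "herm (?W *v w) (?W *v w) = herm (?W *v u) (?W *v u)"
      using elim cnj_herm[of "?W *v u" "?W *v w"] by (auto simp: dark_pair_def herm_self)
    have "?P ** adj ?W ** ?W ** ?P = mat (herm (?W *v u) (?W *v u)) ** ?P"
      unfolding matrix_eq
    proof
      fix z
      have m: "mat c *v x = c *s x" for c and x :: "complex^'d"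
        by (simp add: mat_def matrix_vector_mult_def vec_eq_iff if_distrib[of "\<lambda>a. a * _"] cong: if_cong)
      show "(?P ** adj ?W ** ?W ** ?P) *v z = (mat (herm (?W *v u) (?W *v u)) ** ?P) *v z"
        by (simp add: matrix_vector_mul_assoc[symmetric] m plane_projector_vector herm_adj matrix_vector_comb
            herm_simps e vec.scale_right_distrib mult.commute)
    qed
    then show ?case by blast
  qed
  moreover have "?P \<noteq> 0"
  proof
    assume "?P = 0"
    then have "u = 0"
      using plane_projector_vector[of u w u] by (simp add: orthonormal_herm[OF assms(2)])
    with assms(2) show False
      by (simp add: orthonormal_def)
  qed
  ultimately have "rank ?P = 1"
    using assms orthogonal_projector_plane by (auto simp: purifying_def)
  with rank_plane_projector[OF assms(2)] show False
    by simp
qed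

lemma iter_area_decrease:
  assumes "purifying \<mu>" "orthonormal u w"
  shows "\<exists>n. iter n ar (u, w) < 1"
proof (rule ccontr)
  assume "\<not> ?thesis"
  then have "iter n ar (u, w) = 1" for n
    using iter_area_le[of n "(u, w)"] area_orthonormal[OF assms(2)] by (simp add: not_less order_antisym)
  then have "dark_pair u w"
    using assms(2) by (simp add: dark_pair_def orthonormal_def area_orthonormal[OF assms(2)])
  with no_dark_pair assms show False by blast
qed

text \<open>The averages decrease with the number of steps, so the open sets of orthonormal pairs contracted
  after \<open>n\<close> steps increase with \<open>n\<close>; they cover a compact set. Linear substitutions extend the bound
  to all pairs.\<close>

lemma iter_area_factor:
  assumes "purifying \<mu>"
  shows "\<exists>p \<theta>. 0 \<le> \<theta> \<and> \<theta> < 1 \<and> (\<forall>X. iter p ar X \<le> \<theta> * ar X)"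
proof -
  define K where "K = {X :: (complex^'d) \<times> (complex^'d). orthonormal (fst X) (snd X)}"
  have "closed K"
    unfolding K_def orthonormal_def
    by (intro closed_Collect_conj closed_Collect_eq continuous_intros)
  moreover have "bounded K"
  proof (rule boundedI)
    fix X assume "X \<in> K"
    then have "(norm X)\<^sup>2 = 2"
      using norm_pair_square[of "fst X" "snd X"] by (simp add: K_def orthonormal_def)
    then have "norm X = sqrt 2"
      by (metis norm_ge_zero real_sqrt_unique)
    then show "norm X \<le> sqrt 2" by simp
  qed
  ultimately have K: "compact K"
    by (simp add: compact_eq_bounded_closed)
  have cont: "continuous_on UNIV (iter n ar)" for n
    using quad_iter[OF quad_area, of n] by (simp add: quad_def)
  define U where "U n = {X. iter n ar X < 1}" for n
  have "\<exists>p. K \<subseteq> U p"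
  proof -
    have o: "open (U n)" for n
      unfolding U_def by (intro open_Collect_less cont continuous_intros)
    have c: "K \<subseteq> (\<Union>n. U n)"
      using iter_area_decrease[OF assms] by (force simp: K_def U_def)
    obtain C where C: "finite C" "K \<subseteq> (\<Union>n\<in>C. U n)"
      by (rule compactE_image[OF K o c])
    have "U n \<subseteq> U (Max C)" if "n \<in> C" for n
    proof
      fix X assume "X \<in> U n"
      then show "X \<in> U (Max C)"
        using iter_area_antimono[OF Max_ge[OF C(1) that], of X] unfolding U_def mem_Collect_eq
        by (rule le_less_trans[rotated])
    qed
    then have "K \<subseteq> U (Max C)"
      using C by blast
    then show ?thesis ..
  qed
  then obtain p where p: "K \<subseteq> U p" ..
  have "\<exists>\<theta>. 0 \<le> \<theta> \<and> \<theta> < 1 \<and> (\<forall>X\<in>K. iter p ar X \<le> \<theta>)"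
  proof (cases "K = {}")
    case True
    then show ?thesis by (intro exI[of _ 0]) simp
  next
    case False
    obtain Y where Y: "Y \<in> K" "\<And>X. X \<in> K \<Longrightarrow> iter p ar X \<le> iter p ar Y"
      using continuous_attains_sup[OF K False continuous_on_subset[OF cont subset_UNIV]] by blast
    have "iter p ar Y < 1"
      using Y(1) p unfolding U_def by blast
    moreover have "\<forall>X\<in>K. iter p ar X \<le> max 0 (iter p ar Y)"
      using Y(2) by (intro ballI max.coboundedI2)
    ultimately show ?thesis
      by (intro exI[of _ "max 0 (iter p ar Y)"]) simp
  qed
  then obtain \<theta> where \<theta>: "0 \<le> \<theta>" "\<theta> < 1" "\<And>X. X \<in> K \<Longrightarrow> iter p ar X \<le> \<theta>"
    by blast
  have "iter p ar X \<le> \<theta> * ar X" for X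
  proof (cases "ar X = 0")
    case True
    then show ?thesis
      using iter_area_zero[of "fst X" "snd X" p] by simp
  next
    case False
    obtain x y where X: "X = (x, y)" by fastforce
    from False obtain s t r u w where *: "orthonormal u w" "s > 0" "r > 0"
      "x = complex_of_real s *s u" "y = t *s u + complex_of_real r *s w" "area x y = s * r"
      unfolding X fst_conv snd_conv by (rule gram_schmidt)
    have "iter p ar (u, w) \<le> \<theta>"
      using *(1) by (intro \<theta>) (simp add: K_def)
    then have "s * r * iter p ar (u, w) \<le> s * r * \<theta>"
      using * by (intro mult_left_mono) auto
    then show ?thesis
      using iter_area_comb[of p s u t r w] * by (simp add: X mult.commute)
  qed
  with \<theta> show ?thesis by blast
qed

lemma iter_area_tends_to_0:
  assumes "purifying \<mu>" "\<delta> > 0"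
  shows "\<exists>n. \<forall>X. iter n ar X \<le> \<delta> * ar X"
proof -
  obtain p \<theta> where p: "0 \<le> \<theta>" "\<theta> < 1" "\<And>X. iter p ar X \<le> \<theta> * ar X"
    using iter_area_factor[OF assms(1)] by blast
  have pow: "iter (p * k) ar X \<le> \<theta> ^ k * ar X" for k X
  proof (induction k arbitrary: X)
    case (Suc k)
    have "iter (p * Suc k) ar X = iter p (iter (p * k) ar) X"
      by (simp add: funpow_add)
    also have "\<dots> \<le> iter p (\<lambda>X. \<theta> ^ k * ar X) X"
      by (intro iter_mono quad_iter quad_mult quad_area Suc)
    also have "\<dots> = \<theta> ^ k * iter p ar X"
      by (simp only: iter_mult[OF quad_area])
    also have "\<dots> \<le> \<theta> ^ k * (\<theta> * ar X)"
      using p by (intro mult_left_mono) auto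
    finally show ?case by (simp add: mult_ac)
  qed simp
  obtain k where "\<theta> ^ k < \<delta>"
    using real_arch_pow_inv[OF assms(2) p(2)] by blast
  then have "iter (p * k) ar X \<le> \<delta> * ar X" for X
    using pow[of k X] by (meson area_nonneg less_imp_le mult_right_mono order_trans)
  then show ?thesis by blast
qed

end

section \<open>Homogeneous functions\<close>

text \<open>The homogeneous counterparts on \<open>\<complex>\<^sup>d\<close> of the continuous functions on the projective space.\<close>

definition homog :: "(complex^'d \<Rightarrow> 'b::real_normed_vector) \<Rightarrow> bool" where
  "homog \<phi> \<longleftrightarrow> continuous_on UNIV \<phi> \<and> (\<forall>c x. \<phi> (c *s x) = (cmod c)\<^sup>2 *\<^sub>R \<phi> x)"

lemma scaleR_eq_smult: "t *\<^sub>R x = complex_of_real t *s (x :: complex^'d)"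
proof -
  have "t *\<^sub>R x $ i = complex_of_real t * x $ i" for i
    by (rule scaleR_conv_of_real)
  then show ?thesis
    by (simp add: vec_eq_iff)
qed

lemma homog_zero: "homog \<phi> \<Longrightarrow> \<phi> 0 = 0"
  unfolding homog_def by (metis norm_zero power_zero_numeral scale_zero_left vector_smult_lzero)

lemma homog_normalise:
  assumes "homog \<phi>" "x \<noteq> 0"
  shows "\<phi> x = (norm x)\<^sup>2 *\<^sub>R \<phi> ((1 / norm x) *\<^sub>R x)" "norm ((1 / norm x) *\<^sub>R x) = 1"
proof -
  have "x = complex_of_real (norm x) *s ((1 / norm x) *\<^sub>R x)"
    using assms(2) by (simp flip: scaleR_eq_smult)
  then have "\<phi> x = \<phi> (complex_of_real (norm x) *s ((1 / norm x) *\<^sub>R x))"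
    by simp
  also have "\<dots> = (norm x)\<^sup>2 *\<^sub>R \<phi> ((1 / norm x) *\<^sub>R x)"
    using assms(1) unfolding homog_def by (metis norm_of_real power2_abs)
  finally show "\<phi> x = (norm x)\<^sup>2 *\<^sub>R \<phi> ((1 / norm x) *\<^sub>R x)" .
qed (use assms in simp)

lemma homog_bound_sphere:
  assumes "homog \<phi>" "\<And>x. norm x = 1 \<Longrightarrow> norm (\<phi> x) \<le> B"
  shows "norm (\<phi> x) \<le> B * (norm x)\<^sup>2"
proof (cases "x = 0")
  case False
  have "norm (\<phi> x) = (norm x)\<^sup>2 * norm (\<phi> ((1 / norm x) *\<^sub>R x))"
    using homog_normalise(1)[OF assms(1) False] by (metis abs_power2 norm_scaleR)
  also have "\<dots> \<le> (norm x)\<^sup>2 * B"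
    by (intro mult_left_mono assms homog_normalise(2)[OF assms(1) False]) simp
  finally show ?thesis by (simp add: mult.commute)
qed (use homog_zero[OF assms(1)] in simp)

lemma unit_vector_exists: "\<exists>x :: complex^'d. norm x = 1"
  by (intro exI[of _ "axis undefined 1"]) (simp add: norm_axis_1)

lemma homog_quad:
  assumes "homog \<phi>"
  shows "quad \<phi>"
proof -
  have "continuous_on (sphere 0 1) \<phi>"
    using assms by (auto simp: homog_def intro: continuous_on_subset)
  then have "bounded (\<phi> ` sphere 0 1)"
    by (intro compact_imp_bounded compact_continuous_image compact_sphere)
  then obtain B where "\<forall>y\<in>\<phi> ` sphere 0 1. norm y \<le> B"
    unfolding bounded_iff by blast
  then have "norm (\<phi> x) \<le> B" if "norm x = 1" for x
    using that by simp
  then show ?thesis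
    using homog_bound_sphere[OF assms] assms unfolding quad_def homog_def by blast
qed

lemma homog_diff: "homog \<phi> \<Longrightarrow> homog \<psi> \<Longrightarrow> homog (\<lambda>x. \<phi> x - \<psi> x)"
  by (auto simp: homog_def scaleR_diff_right intro!: continuous_intros)

lemma homog_bounded_linear: "homog \<phi> \<Longrightarrow> bounded_linear L \<Longrightarrow> homog (\<lambda>x. L (\<phi> x))"
  by (auto simp: homog_def linear_simps intro: bounded_linear.continuous_on)

lemma homog_sum: "(\<And>i. i \<in> I \<Longrightarrow> homog (\<phi> i)) \<Longrightarrow> homog (\<lambda>x. \<Sum>i\<in>I. \<phi> i x)"
  by (auto simp: homog_def scaleR_sum_right intro!: continuous_intros)

lemma homog_norm_square: "homog (\<lambda>x. (norm x)\<^sup>2)"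
  by (auto simp: homog_def norm_smult_complex power_mult_distrib intro!: continuous_intros)

lemma norm_cmod_parallelogram: "(cmod (1 + c))\<^sup>2 + (cmod (1 - c))\<^sup>2 = 2 + 2 * (cmod c)\<^sup>2"
  unfolding cmod_power2 by (simp add: power2_eq_square algebra_simps)

text \<open>Both \<open>\<parallel>X\<parallel>\<^sup>2\<close> and the area are homogeneous of degree 2, so only the unit sphere matters. There, the
  set where \<open>E \<ge> \<epsilon>\<close> is compact and misses the pairs of area 0, so the area has a positive minimum on it
  (or the set is empty).\<close>

lemma area_dominates:
  fixes E :: "(complex^'d) \<times> (complex^'d) \<Rightarrow> real"
  assumes cont: "continuous_on UNIV E" and hom: "\<And>t X. E (t *\<^sub>R X) = t\<^sup>2 * E X"
    and zero: "\<And>X. area (fst X) (snd X) = 0 \<Longrightarrow> E X = 0" and "\<epsilon> > 0"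
  shows "\<exists>K\<ge>0. \<forall>X. E X \<le> \<epsilon> * (norm X)\<^sup>2 + K * area (fst X) (snd X)"
proof -
  define S where "S = sphere 0 1 \<inter> {X. \<epsilon> \<le> E X}"
  have S: "compact S"
    unfolding S_def by (intro compact_Int_closed compact_sphere closed_Collect_le cont continuous_intros)
  have "\<exists>K\<ge>0. \<forall>X\<in>sphere 0 1. E X \<le> \<epsilon> + K * area (fst X) (snd X)"
  proof (cases "S = {}")
    case True
    then show ?thesis
      by (intro exI[of _ 0]) (auto simp: S_def not_le less_imp_le)
  next
    case False
    have "continuous_on S (\<lambda>X. area (fst X) (snd X))"
      by (intro continuous_intros)
    from continuous_attains_inf[OF S False this]
    obtain Y where Y: "Y \<in> S" "\<And>X. X \<in> S \<Longrightarrow> area (fst Y) (snd Y) \<le> area (fst X) (snd X)"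
      by blast
    from continuous_attains_sup[OF S False continuous_on_subset[OF cont subset_UNIV]]
    obtain Z where Z: "Z \<in> S" "\<And>X. X \<in> S \<Longrightarrow> E X \<le> E Z"
      by blast
    define c where "c = area (fst Y) (snd Y)"
    have "c \<noteq> 0"
      using Y(1) zero[of Y] \<open>\<epsilon> > 0\<close> by (auto simp: S_def c_def)
    then have c: "c > 0"
      by (simp add: c_def order_less_le)
    have EZ: "E Z \<ge> 0"
      using Z(1) \<open>\<epsilon> > 0\<close> by (auto simp: S_def)
    have "E X \<le> \<epsilon> + E Z / c * area (fst X) (snd X)" if X: "X \<in> sphere 0 1" for X
    proof (cases "X \<in> S")
      case True
      have "E X \<le> E Z / c * c"
        using Z(2)[OF True] c by simp
      also have "\<dots> \<le> E Z / c * area (fst X) (snd X)"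
        using Y(2)[OF True] EZ c unfolding c_def[symmetric] by (intro mult_left_mono) auto
      finally show ?thesis
        using \<open>\<epsilon> > 0\<close> by linarith
    next
      case False
      then have "E X \<le> \<epsilon>"
        using X unfolding S_def by auto
      moreover have "0 \<le> E Z / c * area (fst X) (snd X)"
        using EZ c by simp
      ultimately show ?thesis by linarith
    qed
    then show ?thesis
      using EZ c by (intro exI[of _ "E Z / c"]) auto
  qed
  then obtain K where K: "K \<ge> 0" "\<And>X. X \<in> sphere 0 1 \<Longrightarrow> E X \<le> \<epsilon> + K * area (fst X) (snd X)"
    by blast
  have "E X \<le> \<epsilon> * (norm X)\<^sup>2 + K * area (fst X) (snd X)" for X
  proof (cases "X = 0")
    case True
    then show ?thesis
      using zero[of X] by simp
  next
    case False
    define t where "t = norm X"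
    define Y where "Y = (1 / t) *\<^sub>R X"
    have t: "t > 0" and X: "X = t *\<^sub>R Y" and Y: "Y \<in> sphere 0 1"
      using False by (auto simp: t_def Y_def)
    have a: "area (fst X) (snd X) = t\<^sup>2 * area (fst Y) (snd Y)"
      unfolding X using area_combination[of t "fst Y" 0 t "snd Y"] t
      by (simp add: scaleR_eq_smult power2_eq_square)
    have "E X = t\<^sup>2 * E Y"
      unfolding X by (rule hom)
    also have "\<dots> \<le> t\<^sup>2 * (\<epsilon> + K * area (fst Y) (snd Y))"
      by (intro mult_left_mono K Y) simp
    also have "\<dots> = \<epsilon> * (norm X)\<^sup>2 + K * area (fst X) (snd X)"
      unfolding a t_def[symmetric] by (simp add: algebra_simps)
    finally show ?thesis .
  qed
  with K(1) show ?thesis by blast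
qed

context stochastic
begin

lemma quad_homog_fst:
  "homog \<phi> \<Longrightarrow> quad (\<lambda>X :: (complex^'d) \<times> (complex^'d). \<phi> (fst X))"
  by (intro quad_fst homog_quad)

lemma integrable_homog:
  fixes \<phi> :: "complex^'d \<Rightarrow> 'b::{banach, second_countable_topology}"
  shows "homog \<phi> \<Longrightarrow> integrable \<mu> (\<lambda>v. \<phi> (v *v x))"
  using integrable_quad[OF quad_homog_fst, of \<phi> x x] by simp

lemma homog_mean:
  fixes \<phi> :: "complex^'d \<Rightarrow> 'b::{banach, second_countable_topology}"
  assumes "homog \<phi>"
  shows "homog (mean \<mu> \<phi>)"
proof -
  have "continuous_on UNIV (\<lambda>X. mean \<mu> \<phi> (fst (X :: (complex^'d) \<times> (complex^'d))))"
    using quad_pair_mean[OF quad_homog_fst[OF assms]] by (simp add: pair_mean_fst quad_def)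
  then have "continuous_on UNIV (\<lambda>x. mean \<mu> \<phi> (fst (x, x :: complex^'d)))"
    by (rule continuous_on_compose2) (auto intro!: continuous_intros)
  then show ?thesis
    using assms by (simp add: homog_def mean_def vector_scalar_commute)
qed

lemma homog_iter_mean:
  fixes \<phi> :: "complex^'d \<Rightarrow> 'b::{banach, second_countable_topology}"
  shows "homog \<phi> \<Longrightarrow> homog ((mean \<mu> ^^ n) \<phi>)"
  by (induction n) (simp_all add: homog_mean)

lemma mean_bounded_linear:
  fixes \<phi> :: "complex^'d \<Rightarrow> 'b::{banach, second_countable_topology}"
    and L :: "'b \<Rightarrow> 'c::{banach, second_countable_topology}"
  shows "homog \<phi> \<Longrightarrow> bounded_linear L \<Longrightarrow> mean \<mu> (\<lambda>x. L (\<phi> x)) = (\<lambda>x. L (mean \<mu> \<phi> x))"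
  by (simp add: fun_eq_iff mean_def integral_bounded_linear[OF _ integrable_homog])

lemma mean_diff:
  fixes \<phi> :: "complex^'d \<Rightarrow> 'b::{banach, second_countable_topology}"
  shows "homog \<phi> \<Longrightarrow> homog \<psi> \<Longrightarrow> mean \<mu> (\<lambda>x. \<phi> x - \<psi> x) = (\<lambda>x. mean \<mu> \<phi> x - mean \<mu> \<psi> x)"
  by (simp add: fun_eq_iff mean_def integrable_homog)

lemma mean_sum:
  fixes \<phi> :: "'i \<Rightarrow> complex^'d \<Rightarrow> 'b::{banach, second_countable_topology}"
  shows "(\<And>i. i \<in> I \<Longrightarrow> homog (\<phi> i)) \<Longrightarrow> mean \<mu> (\<lambda>x. \<Sum>i\<in>I. \<phi> i x) = (\<lambda>x. \<Sum>i\<in>I. mean \<mu> (\<phi> i) x)"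
  by (simp add: fun_eq_iff mean_def integrable_homog)

lemma mean_norm_square: "mean \<mu> (\<lambda>x. (norm x)\<^sup>2) = (\<lambda>x. (norm x)\<^sup>2)"
  by (simp add: fun_eq_iff mean_def integral_norm_square)

end

section \<open>Invariant functions are constant\<close>

context stochastic
begin

text \<open>The averages of \<open>\<bar>E\<bar>\<close> are bounded by \<open>\<epsilon> \<parallel>X\<parallel>\<^sup>2\<close>, which averaging preserves, plus a multiple of
  averaged areas, which tend to 0.\<close>

lemma invariant_vanishes:
  fixes E :: "(complex^'d) \<times> (complex^'d) \<Rightarrow> real"
  assumes "purifying \<mu>" "quad E" "pair_mean \<mu> E = E" "\<And>t X. E (t *\<^sub>R X) = t\<^sup>2 * E X"
    "\<And>X. area (fst X) (snd X) = 0 \<Longrightarrow> E X = 0"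
  shows "E X = 0"
proof -
  have inv: "iter n E = E" for n
    by (induction n) (simp_all add: assms)
  have "\<bar>E X\<bar> \<le> \<epsilon> * (norm X)\<^sup>2 + \<epsilon> * ar X" if \<epsilon>: "\<epsilon> > 0" for \<epsilon>
  proof -
    have "continuous_on UNIV (\<lambda>X. \<bar>E X\<bar>)"
      using assms(2) by (auto simp: quad_def intro!: continuous_intros)
    then obtain K where K: "K \<ge> 0" "\<And>X. \<bar>E X\<bar> \<le> \<epsilon> * (norm X)\<^sup>2 + K * ar X"
      using area_dominates[of "\<lambda>X. \<bar>E X\<bar>" \<epsilon>] assms(4,5) \<epsilon> by (auto simp: abs_mult)
    have "\<epsilon> / (K + 1) > 0"
      using \<epsilon> K(1) by simp
    then obtain n where n: "\<And>X. iter n ar X \<le> \<epsilon> / (K + 1) * ar X"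
      using iter_area_tends_to_0[OF assms(1)] by blast
    have "\<bar>E X\<bar> = norm (iter n E X)"
      by (simp add: inv)
    also have "\<dots> \<le> iter n (\<lambda>X. norm (E X)) X"
      by (rule norm_iter_le[OF assms(2)])
    also have "\<dots> \<le> iter n (\<lambda>X. \<epsilon> * (norm X)\<^sup>2 + K * ar X) X"
      using K by (intro iter_mono quad_norm quad_add quad_mult quad_area quad_norm_square assms) auto
    also have "\<dots> = \<epsilon> * (norm X)\<^sup>2 + K * iter n ar X"
      by (simp only: iter_add[OF quad_mult[OF quad_norm_square] quad_mult[OF quad_area]]
          iter_mult[OF quad_area] iter_mult[OF quad_norm_square] iter_norm_square)
    also have "K * iter n ar X \<le> K * (\<epsilon> / (K + 1) * ar X)"
      by (intro mult_left_mono n K)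
    also have "K * (\<epsilon> / (K + 1) * ar X) = (K / (K + 1)) * (\<epsilon> * ar X)"
      by simp
    also have "\<dots> \<le> 1 * (\<epsilon> * ar X)"
      using K(1) \<epsilon> by (intro mult_right_mono) auto
    finally show ?thesis by simp
  qed
  then have "\<bar>E X\<bar> \<le> 0 + \<delta>" if "\<delta> > 0" for \<delta>
  proof -
    let ?k = "(norm X)\<^sup>2 + ar X + 1"
    have k: "?k > 0"
      by (intro add_nonneg_pos add_nonneg_nonneg) auto
    have "\<bar>E X\<bar> \<le> \<delta> / ?k * ((norm X)\<^sup>2 + ar X)"
      using \<open>\<And>\<epsilon>. \<epsilon> > 0 \<Longrightarrow> _\<close>[of "\<delta> / ?k"] that k by (simp add: distrib_left)
    also have "\<dots> \<le> \<delta> / ?k * ?k"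
      using that k by (intro mult_left_mono) auto
    finally show ?thesis
      using k by simp
  qed
  then show ?thesis
    using field_le_epsilon[of "\<bar>E X\<bar>" 0] by simp
qed

text \<open>The defect of the parallelogram law is an invariant function of the pair \<open>(x, y)\<close>. It vanishes on
  pairs of area 0, that is on pairs in a common line, where \<open>\<phi>\<close> is a multiple of the squared norm.\<close>

lemma invariant_parallelogram:
  fixes \<phi> :: "complex^'d \<Rightarrow> real"
  assumes "purifying \<mu>" and \<phi>: "homog \<phi>" and inv: "mean \<mu> \<phi> = \<phi>"
  shows "\<phi> (x + y) + \<phi> (x - y) = 2 * \<phi> x + 2 * \<phi> y"
proof -
  define P where "P a b = (\<lambda>X :: (complex^'d) \<times> (complex^'d). \<phi> (fst (comb a b 0 0 X)))" for a b
  have P: "P a b (x, y) = \<phi> (a *s x + b *s y)" for a b x y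
    by (simp add: P_def comb_def)
  have quad_P: "quad (P a b)" for a b
    unfolding P_def using quad_comb[OF quad_homog_fst[OF \<phi>]] .
  have pair_mean_P: "pair_mean \<mu> (P a b) = P a b" for a b
    unfolding P_def using pair_mean_comb[of \<mu> "\<lambda>X. \<phi> (fst X)" a b 0 0] by (simp add: pair_mean_fst inv)
  have hom: "\<phi> (c *s x) = (cmod c)\<^sup>2 * \<phi> x" for c x
    using \<phi> by (simp add: homog_def)
  define E where "E = (\<lambda>X. (P 1 1 X + P 1 (-1) X) - 2 * (P 1 0 X + P 0 1 X))"
  have "E (x, y) = 0"
  proof (rule invariant_vanishes[OF assms(1)])
    show "quad E"
      unfolding E_def by (intro quad_diff quad_add quad_mult quad_P)
    have a2: "pair_mean \<mu> (\<lambda>X. P a b X + P c d X) = (\<lambda>X. P a b X + P c d X)" for a b c d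
      by (simp only: pair_mean_add[OF quad_P quad_P] pair_mean_P)
    have "pair_mean \<mu> E = (\<lambda>X. pair_mean \<mu> (\<lambda>X. P 1 1 X + P 1 (-1) X) X - pair_mean \<mu> (\<lambda>X. 2 * (P 1 0 X + P 0 1 X)) X)"
      unfolding E_def by (intro pair_mean_diff quad_add quad_mult quad_P)
    also have "pair_mean \<mu> (\<lambda>X. 2 * (P 1 0 X + P 0 1 X)) = (\<lambda>X. 2 * (P 1 0 X + P 0 1 X))"
      by (simp only: pair_mean_bounded_linear[OF quad_add[OF quad_P quad_P] bounded_linear_mult_right] a2)
    finally show "pair_mean \<mu> E = E"
      by (simp only: a2 E_def)
    show "E (t *\<^sub>R X) = t\<^sup>2 * E X" for t X
    proof -
      have "P a b (t *\<^sub>R X) = t\<^sup>2 * P a b X" for a b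
      proof -
        obtain x y where X: "X = (x, y)" by fastforce
        have "a *s (t *\<^sub>R x) + b *s (t *\<^sub>R y) = complex_of_real t *s (a *s x + b *s y)"
          unfolding scaleR_eq_smult by (simp add: vec_eq_iff algebra_simps)
        then have "P a b (t *\<^sub>R X) = \<phi> (complex_of_real t *s (a *s x + b *s y))"
          by (simp only: X P scaleR_Pair)
        then show ?thesis
          by (simp only: hom X P norm_of_real power2_abs)
      qed
      then show ?thesis
        by (simp add: E_def algebra_simps)
    qed
    fix X :: "(complex^'d) \<times> (complex^'d)"
    obtain x y where X: "X = (x, y)" by fastforce
    assume "area (fst X) (snd X) = 0"
    then consider "x = 0" | c where "y = c *s x"
      using area_eq_0_imp X by auto
    then show "E X = 0"
    proof cases
      case 1
      then show ?thesis
        using hom[of "-1" y] by (simp add: X E_def P homog_zero[OF \<phi>])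
    next
      case 2
      have "x + c *s x = (1 + c) *s x" "x - c *s x = (1 - c) *s x"
        by (simp_all add: vec_eq_iff algebra_simps)
      then have "\<phi> (x + c *s x) = (cmod (1 + c))\<^sup>2 * \<phi> x" "\<phi> (x - c *s x) = (cmod (1 - c))\<^sup>2 * \<phi> x"
        by (simp_all only: hom)
      then have "E X = ((cmod (1 + c))\<^sup>2 + (cmod (1 - c))\<^sup>2 - (2 + 2 * (cmod c)\<^sup>2)) * \<phi> x"
        by (simp add: X 2 E_def P hom algebra_simps)
      then show ?thesis
        by (simp only: norm_cmod_parallelogram) simp
    qed
  qed
  then show ?thesis
    by (simp add: E_def P)
qed

text \<open>Applied to \<open>max \<phi> - \<phi>\<close> and \<open>\<phi> - min \<phi>\<close>. The zeros of a nonnegative function satisfying the parallelogram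
  law are closed under addition; invariance makes \<open>q (v x)\<close> vanish for almost every \<open>v\<close>, hence on the
  support by continuity.\<close>

lemma zero_set_stable:
  fixes q :: "complex^'d \<Rightarrow> real"
  assumes "purifying \<mu>" and q: "homog q" "mean \<mu> q = q" "\<And>x. 0 \<le> q x" and "x \<noteq> 0" "q x = 0"
  shows "stable_subspace \<mu> {x. q x = 0}"
  unfolding stable_subspace_def
proof (intro conjI ballI)
  show "vec.subspace {x. q x = 0}"
  proof (rule vec.subspaceI)
    show "0 \<in> {x. q x = 0}"
      using homog_zero[OF q(1)] by simp
    show "x + y \<in> {x. q x = 0}" if "x \<in> {x. q x = 0}" "y \<in> {x. q x = 0}" for x y
      using invariant_parallelogram[OF assms(1) q(1,2), of x y] that q(3)[of "x + y"] q(3)[of "x - y"] by simp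
    show "c *s x \<in> {x. q x = 0}" if "x \<in> {x. q x = 0}" for c x
      using q(1) that by (simp add: homog_def)
  qed
  show "{x. q x = 0} \<noteq> {0}"
    using assms by blast
  fix v assume v: "v \<in> support \<mu>"
  show "(*v) v ` {x. q x = 0} \<subseteq> {x. q x = 0}"
  proof clarsimp
    fix x assume x: "q x = 0"
    have cont: "continuous_on UNIV (\<lambda>v. q (v *v x))"
      using q(1) by (intro continuous_on_compose2[of UNIV q _ "\<lambda>v. v *v x"])
        (auto simp: homog_def intro!: continuous_intros)
    have "(\<integral> v. q (v *v x) \<partial>\<mu>) = 0"
      using q(2) x by (simp add: mean_def fun_eq_iff)
    then have "AE v in \<mu>. q (v *v x) = 0"
      using integral_nonneg_eq_0_iff_AE[OF integrable_homog[OF q(1)]] q(3) by simp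
    moreover have o: "open {v. q (v *v x) \<noteq> 0}"
      by (intro open_Collect_neq cont continuous_intros)
    ultimately have "emeasure \<mu> {v. q (v *v x) \<noteq> 0} = 0"
      by (subst (asm) AE_iff_measurable[of "{v. q (v *v x) \<noteq> 0}"])
         (auto simp: sets_\<mu> sets_eq_imp_space_eq[OF sets_\<mu>] borel_open)
    with o v show "q (v *v x) = 0"
      unfolding support_def by fastforce
  qed
qed

end

lemma stable_subspace_contains_minimal:
  assumes "stable_subspace \<mu> F"
  shows "\<exists>E\<subseteq>F. stable_subspace \<mu> E \<and> (\<forall>G. stable_subspace \<mu> G \<and> G \<subseteq> E \<longrightarrow> G = E)"
proof -
  obtain E where E: "stable_subspace \<mu> E" "E \<subseteq> F"
    "\<And>G. stable_subspace \<mu> G \<Longrightarrow> G \<subseteq> F \<Longrightarrow> vec.dim E \<le> vec.dim G"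
    using ex_has_least_nat[of "\<lambda>E. stable_subspace \<mu> E \<and> E \<subseteq> F" F vec.dim] assms by blast
  have "G = E" if "stable_subspace \<mu> G" "G \<subseteq> E" for G
    using that E by (intro vec.subspace_dim_equal) (auto simp: stable_subspace_def)
  with E show ?thesis by blast
qed

text \<open>In finite dimension each stable subspace contains a minimal one, and there is only one of those.\<close>

lemma ergodic_stable_meet:
  assumes "ergodic \<mu>" "stable_subspace \<mu> F" "stable_subspace \<mu> G"
  shows "\<exists>x. x \<noteq> 0 \<and> x \<in> F \<and> x \<in> G"
proof -
  obtain E where E: "E \<subseteq> F" "stable_subspace \<mu> E" "\<forall>H. stable_subspace \<mu> H \<and> H \<subseteq> E \<longrightarrow> H = E"
    using stable_subspace_contains_minimal[OF assms(2)] by blast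
  obtain E' where E': "E' \<subseteq> G" "stable_subspace \<mu> E'" "\<forall>H. stable_subspace \<mu> H \<and> H \<subseteq> E' \<longrightarrow> H = E'"
    using stable_subspace_contains_minimal[OF assms(3)] by blast
  from E E' have "E = E'"
    using assms(1) unfolding ergodic_def by blast
  moreover have "\<exists>x\<in>E. x \<noteq> 0"
    using E(2) vec.subspace_0 unfolding stable_subspace_def by blast
  ultimately show ?thesis
    using E(1) E'(1) by blast
qed

context stochastic
begin

lemma invariant_real_constant:
  fixes \<phi> :: "complex^'d \<Rightarrow> real"
  assumes "purifying \<mu>" "ergodic \<mu>" and \<phi>: "homog \<phi>" "mean \<mu> \<phi> = \<phi>"
  shows "\<exists>c. \<forall>x. \<phi> x = c * (norm x)\<^sup>2"
proof -
  have cont: "continuous_on (sphere 0 1) \<phi>"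
    using \<phi> by (auto simp: homog_def intro: continuous_on_subset)
  have ne: "sphere 0 1 \<noteq> ({} :: (complex^'d) set)"
    using unit_vector_exists by auto
  obtain a where a: "norm a = 1" "\<And>x. norm x = 1 \<Longrightarrow> \<phi> x \<le> \<phi> a"
    using continuous_attains_sup[OF compact_sphere ne cont] by auto
  obtain b where b: "norm b = 1" "\<And>x. norm x = 1 \<Longrightarrow> \<phi> b \<le> \<phi> x"
    using continuous_attains_inf[OF compact_sphere ne cont] by auto
  define q1 where "q1 = (\<lambda>x. \<phi> a * (norm x)\<^sup>2 - \<phi> x)"
  define q2 where "q2 = (\<lambda>x. \<phi> x - \<phi> b * (norm x)\<^sup>2)"
  have hc: "homog (\<lambda>x :: complex^'d. c * (norm x)\<^sup>2)" for c
    by (rule homog_bounded_linear[OF homog_norm_square bounded_linear_mult_right])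
  have mc: "mean \<mu> (\<lambda>x. c * (norm x)\<^sup>2) = (\<lambda>x. c * (norm x)\<^sup>2)" for c
    by (simp only: mean_bounded_linear[OF homog_norm_square bounded_linear_mult_right] mean_norm_square)
  have h1: "homog q1" and h2: "homog q2"
    unfolding q1_def q2_def by (intro homog_diff hc \<phi>)+
  have m1: "mean \<mu> q1 = q1" and m2: "mean \<mu> q2 = q2"
    unfolding q1_def q2_def by (simp_all only: mean_diff[OF hc \<phi>(1)] mean_diff[OF \<phi>(1) hc] mc \<phi>(2))
  have nonneg: "0 \<le> q x" if "homog q" "\<And>x. norm x = 1 \<Longrightarrow> 0 \<le> q x" for q :: "complex^'d \<Rightarrow> real" and x
  proof (cases "x = 0")
    case False
    then show ?thesis
      using homog_normalise[OF that(1) False] that(2) by simp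
  qed (use homog_zero[OF that(1)] in simp)
  have p1: "0 \<le> q1 x" and p2: "0 \<le> q2 x" for x
    by (rule nonneg[OF h1], simp add: q1_def a, rule nonneg[OF h2], simp add: q2_def b)
  have "stable_subspace \<mu> {x. q1 x = 0}"
    by (rule zero_set_stable[OF assms(1) h1 m1 p1, of a]) (use a in \<open>auto simp: q1_def\<close>)
  moreover have "stable_subspace \<mu> {x. q2 x = 0}"
    by (rule zero_set_stable[OF assms(1) h2 m2 p2, of b]) (use b in \<open>auto simp: q2_def\<close>)
  ultimately obtain x where "x \<noteq> 0" "q1 x = 0" "q2 x = 0"
    using ergodic_stable_meet[OF assms(2)] by blast
  then have eq: "\<phi> a = \<phi> b"
    by (simp add: q1_def q2_def)
  have "\<phi> x = \<phi> a * (norm x)\<^sup>2" for x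
    using p1[of x] p2[of x] by (simp add: q1_def q2_def eq)
  then show ?thesis by blast
qed

lemma invariant_constant:
  fixes \<phi> :: "complex^'d \<Rightarrow> complex"
  assumes "purifying \<mu>" "ergodic \<mu>" and \<phi>: "homog \<phi>" "mean \<mu> \<phi> = \<phi>"
  shows "\<exists>c. \<forall>x. \<phi> x = c * complex_of_real ((norm x)\<^sup>2)"
proof -
  have "\<exists>c. \<forall>x. L (\<phi> x) = c * (norm x)\<^sup>2" if "bounded_linear L" for L :: "complex \<Rightarrow> real"
    using homog_bounded_linear[OF \<phi>(1) that] mean_bounded_linear[OF \<phi>(1) that] \<phi>(2)
    by (intro invariant_real_constant assms) auto
  from this[OF bounded_linear_Re] this[OF bounded_linear_Im]
  obtain c d where "\<And>x. Re (\<phi> x) = c * (norm x)\<^sup>2" "\<And>x. Im (\<phi> x) = d * (norm x)\<^sup>2"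
    by blast
  then show ?thesis
    by (intro exI[of _ "Complex c d"]) (simp add: complex_eq_iff del: of_real_power)
qed

end

section \<open>Averaging improves Hoelder constants\<close>

text \<open>For unit vectors the area is the distance of their lines, so this is Hoelder continuity on the
  projective space.\<close>

definition holder :: "real \<Rightarrow> real \<Rightarrow> (complex^'d \<Rightarrow> complex) \<Rightarrow> bool" where
  "holder \<alpha> C \<phi> \<longleftrightarrow> (\<forall>x y. norm x = 1 \<longrightarrow> norm y = 1 \<longrightarrow> norm (\<phi> x - \<phi> y) \<le> C * area x y powr \<alpha>)"

lemma holderD: "holder \<alpha> C \<phi> \<Longrightarrow> norm x = 1 \<Longrightarrow> norm y = 1 \<Longrightarrow> norm (\<phi> x - \<phi> y) \<le> C * area x y powr \<alpha>"
  by (simp add: holder_def)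

lemma holder_mono: "holder \<alpha> C \<phi> \<Longrightarrow> C \<le> D \<Longrightarrow> holder \<alpha> D \<phi>"
  unfolding holder_def by (meson mult_right_mono order_trans powr_ge_zero)

lemma holder_add: "holder \<alpha> C \<phi> \<Longrightarrow> holder \<alpha> D \<psi> \<Longrightarrow> holder \<alpha> (C + D) (\<lambda>x. \<phi> x + \<psi> x)"
  unfolding holder_def
proof (intro allI impI)
  fix x y :: "complex^'a"
  assume *: "\<forall>x y. norm x = 1 \<longrightarrow> norm y = 1 \<longrightarrow> cmod (\<phi> x - \<phi> y) \<le> C * area x y powr \<alpha>"
    "\<forall>x y. norm x = 1 \<longrightarrow> norm y = 1 \<longrightarrow> cmod (\<psi> x - \<psi> y) \<le> D * area x y powr \<alpha>"
    and xy: "norm x = 1" "norm y = 1"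
  have "cmod (\<phi> x + \<psi> x - (\<phi> y + \<psi> y)) \<le> cmod (\<phi> x - \<phi> y) + cmod (\<psi> x - \<psi> y)"
    using norm_triangle_ineq[of "\<phi> x - \<phi> y" "\<psi> x - \<psi> y"] by (simp add: algebra_simps)
  also have "\<dots> \<le> C * area x y powr \<alpha> + D * area x y powr \<alpha>"
    using * xy by (intro add_mono) auto
  finally show "cmod (\<phi> x + \<psi> x - (\<phi> y + \<psi> y)) \<le> (C + D) * area x y powr \<alpha>"
    by (simp add: distrib_right)
qed

lemma holder_scaleR: "holder \<alpha> C \<phi> \<Longrightarrow> holder \<alpha> (\<bar>r\<bar> * C) (\<lambda>x. r *\<^sub>R \<phi> x)"
  unfolding holder_def by (simp add: mult.assoc mult_left_mono flip: scaleR_diff_right)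

lemma holder_sum:
  "finite I \<Longrightarrow> (\<And>i. i \<in> I \<Longrightarrow> holder \<alpha> (C i) (\<phi> i)) \<Longrightarrow> holder \<alpha> (\<Sum>i\<in>I. C i) (\<lambda>x. \<Sum>i\<in>I. \<phi> i x)"
proof (induction I rule: finite_induct)
  case empty
  then show ?case by (simp add: holder_def)
next
  case (insert i I)
  then show ?case by (simp add: holder_add)
qed

text \<open>An additive substitute for Hoelder's inequality: it separates the two factors pointwise.
  With \<open>\<delta>\<close> fixed, the term with \<open>s\<close>, later an area, is made small by averaging over more steps.\<close>

lemma powr_interpolation:
  fixes s m :: real
  assumes "0 < \<alpha>" "\<alpha> \<le> 1" "0 \<le> s" "0 \<le> m" "0 < \<delta>" "\<delta> \<le> 1"
  shows "s powr \<alpha> * m powr (1 - \<alpha>) \<le> \<delta> powr \<alpha> * m + s / \<delta>"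
proof (cases "s \<le> \<delta> * m")
  case True
  have "s powr \<alpha> * m powr (1 - \<alpha>) \<le> (\<delta> * m) powr \<alpha> * m powr (1 - \<alpha>)"
    using assms True by (intro mult_right_mono powr_mono2) auto
  also have "\<dots> = \<delta> powr \<alpha> * m"
    using assms by (simp add: powr_mult powr_add[symmetric] mult.assoc)
  finally show ?thesis
    using assms by (simp add: add_increasing2)
next
  case False
  then have m: "m \<le> s / \<delta>" "s \<le> s / \<delta>"
    using assms mult_left_le[of \<delta> s] by (auto simp: field_simps)
  have "s powr \<alpha> * m powr (1 - \<alpha>) \<le> (s / \<delta>) powr \<alpha> * (s / \<delta>) powr (1 - \<alpha>)"
    using assms m by (intro mult_mono powr_mono2) auto
  also have "\<dots> = s / \<delta>"
    using assms by (simp add: powr_add[symmetric])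
  finally show ?thesis
    using assms by (simp add: add_increasing)
qed

lemma norm_add_square: "(norm (x + y))\<^sup>2 = (norm x)\<^sup>2 + (norm y)\<^sup>2 + 2 * Re (herm x y)"
proof -
  have "herm (x + y) (x + y) = herm x x + herm y y + (herm x y + cnj (herm x y))"
    by (simp add: herm_simps cnj_herm)
  then have "complex_of_real ((norm (x + y))\<^sup>2)
      = complex_of_real ((norm x)\<^sup>2) + complex_of_real ((norm y)\<^sup>2) + (herm x y + cnj (herm x y))"
    by (simp only: herm_self)
  also have "\<dots> = complex_of_real ((norm x)\<^sup>2 + (norm y)\<^sup>2 + 2 * Re (herm x y))"
    by (simp only: complex_add_cnj of_real_add)
  finally show ?thesis
    using of_real_eq_iff by blast
qed

lemma cmod_herm_le: "cmod (herm x y) \<le> norm x * norm y"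
proof (rule power2_le_imp_le)
  have "0 \<le> (area x y)\<^sup>2" by simp
  then show "(cmod (herm x y))\<^sup>2 \<le> (norm x * norm y)\<^sup>2"
    unfolding area_square by (simp add: power_mult_distrib)
qed simp

text \<open>With \<open>u\<close>, \<open>w\<close> the directions of \<open>a\<close>, \<open>b\<close> and \<open>m\<close> the smaller of their lengths, the difference is split into
  \<open>m\<^sup>2 (\<phi> u - \<phi> w)\<close> and two radial terms. Weighting the Hoelder term by the smaller length is what
  cancels the denominator in \<open>area u w = area a b / (\<parallel>a\<parallel> \<parallel>b\<parallel>)\<close>.\<close>

lemma homog_difference_bound:
  assumes \<phi>: "homog \<phi>" and hol: "holder \<alpha> C \<phi>" and B: "\<And>x. cmod (\<phi> x) \<le> B * (norm x)\<^sup>2"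
    and C: "0 \<le> C" and \<alpha>: "0 < \<alpha>" "\<alpha> \<le> 1"
  shows "cmod (\<phi> a - \<phi> b)
    \<le> C * (area a b powr \<alpha> * ((norm a)\<^sup>2) powr (1 - \<alpha>)) + B * \<bar>(norm a)\<^sup>2 - (norm b)\<^sup>2\<bar>"
proof (cases "a = 0 \<or> b = 0")
  case True
  then have "cmod (\<phi> a - \<phi> b) \<le> B * \<bar>(norm a)\<^sup>2 - (norm b)\<^sup>2\<bar>"
    using B[of a] B[of b] homog_zero[OF \<phi>] by auto
  then show ?thesis
    using C by (simp add: add_increasing)
next
  case False
  define u where "u = (1 / norm a) *\<^sub>R a"
  define w where "w = (1 / norm b) *\<^sub>R b"
  define m where "m = min (norm a) (norm b)"
  have m: "0 < m" "m \<le> norm a" "m \<le> norm b"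
    using False by (auto simp: m_def)
  have u: "norm u = 1" "\<phi> a = (norm a)\<^sup>2 *\<^sub>R \<phi> u" and w: "norm w = 1" "\<phi> b = (norm b)\<^sup>2 *\<^sub>R \<phi> w"
    using homog_normalise[OF \<phi>, of a] homog_normalise[OF \<phi>, of b] False unfolding u_def w_def by blast+
  have Bu: "cmod (\<phi> u) \<le> B" "cmod (\<phi> w) \<le> B"
    using B[of u] B[of w] u w by auto
  have area: "area a b = norm a * norm b * area u w"
    using area_combination[of "norm a" u 0 "norm b" w] False
    by (simp add: u_def w_def flip: scaleR_eq_smult)
  have "m\<^sup>2 * area u w powr \<alpha> \<le> area a b powr \<alpha> * ((norm a)\<^sup>2) powr (1 - \<alpha>)"
  proof -
    have "m\<^sup>2 * area u w powr \<alpha> = ((m * m) * area u w) powr \<alpha> * (m\<^sup>2) powr (1 - \<alpha>)"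
      using m by (simp add: powr_mult power2_eq_square mult_ac flip: powr_add)
    also have "\<dots> \<le> area a b powr \<alpha> * ((norm a)\<^sup>2) powr (1 - \<alpha>)"
      unfolding area using \<alpha> m by (intro mult_mono powr_mono2 power_mono mult_nonneg_nonneg) auto
    finally show ?thesis .
  qed
  then have 1: "m\<^sup>2 * (C * area u w powr \<alpha>) \<le> C * (area a b powr \<alpha> * ((norm a)\<^sup>2) powr (1 - \<alpha>))"
    using mult_left_mono[OF _ C] by (simp add: mult.left_commute)
  have le: "m\<^sup>2 \<le> (norm a)\<^sup>2" "m\<^sup>2 \<le> (norm b)\<^sup>2"
    using m by (auto intro!: power_mono)
  have "\<phi> a - \<phi> b = m\<^sup>2 *\<^sub>R (\<phi> u - \<phi> w) + ((norm a)\<^sup>2 - m\<^sup>2) *\<^sub>R \<phi> u - ((norm b)\<^sup>2 - m\<^sup>2) *\<^sub>R \<phi> w"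
    unfolding u(2) w(2) by (simp add: algebra_simps)
  then have "cmod (\<phi> a - \<phi> b) \<le> m\<^sup>2 * cmod (\<phi> u - \<phi> w) + ((norm a)\<^sup>2 - m\<^sup>2) * cmod (\<phi> u) + ((norm b)\<^sup>2 - m\<^sup>2) * cmod (\<phi> w)"
    using le norm_triangle_ineq4[of "m\<^sup>2 *\<^sub>R (\<phi> u - \<phi> w) + ((norm a)\<^sup>2 - m\<^sup>2) *\<^sub>R \<phi> u" "((norm b)\<^sup>2 - m\<^sup>2) *\<^sub>R \<phi> w"]
      norm_triangle_ineq[of "m\<^sup>2 *\<^sub>R (\<phi> u - \<phi> w)" "((norm a)\<^sup>2 - m\<^sup>2) *\<^sub>R \<phi> u"]
    by simp
  also have "\<dots> \<le> m\<^sup>2 * (C * area u w powr \<alpha>) + ((norm a)\<^sup>2 - m\<^sup>2) * B + ((norm b)\<^sup>2 - m\<^sup>2) * B"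
    using le u(1) w(1) Bu by (intro add_mono mult_left_mono holderD[OF hol]) auto
  also have "\<dots> = m\<^sup>2 * (C * area u w powr \<alpha>) + B * \<bar>(norm a)\<^sup>2 - (norm b)\<^sup>2\<bar>"
  proof -
    have "((norm a)\<^sup>2 - m\<^sup>2) + ((norm b)\<^sup>2 - m\<^sup>2) = \<bar>(norm a)\<^sup>2 - (norm b)\<^sup>2\<bar>"
      using le by (auto simp: m_def min_def)
    then have "\<bar>(norm a)\<^sup>2 - (norm b)\<^sup>2\<bar> = ((norm a)\<^sup>2 - m\<^sup>2) + ((norm b)\<^sup>2 - m\<^sup>2)" ..
    then show ?thesis
      by (simp only: distrib_left) (simp add: mult.commute)
  qed
  finally show ?thesis
    using 1 by linarith
qed

text \<open>Moving a line by the distance \<open>r\<close> changes the weight \<open>\<parallel>v x\<parallel>\<^sup>2\<close> by at most order \<open>r\<close>, measured by the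
  weights of the two orthonormal directions.\<close>

lemma norm_rotation_difference:
  assumes c: "(cmod c)\<^sup>2 + r\<^sup>2 = 1" and r: "0 \<le> r" "r \<le> 1"
  shows "\<bar>(norm a)\<^sup>2 - (norm (c *s a + complex_of_real r *s b))\<^sup>2\<bar> \<le> 2 * r * ((norm a)\<^sup>2 + (norm b)\<^sup>2)"
proof -
  let ?h = "Re (herm (c *s a) (complex_of_real r *s b))"
  have "(norm (c *s a + complex_of_real r *s b))\<^sup>2 = (cmod c)\<^sup>2 * (norm a)\<^sup>2 + r\<^sup>2 * (norm b)\<^sup>2 + 2 * ?h"
    by (simp only: norm_add_square norm_smult_complex power_mult_distrib norm_of_real power2_abs)
  moreover have "(cmod c)\<^sup>2 = 1 - r\<^sup>2"
    using c by simp
  ultimately have eq: "(norm a)\<^sup>2 - (norm (c *s a + complex_of_real r *s b))\<^sup>2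
      = r\<^sup>2 * (norm a)\<^sup>2 - r\<^sup>2 * (norm b)\<^sup>2 - 2 * ?h"
    by (simp add: algebra_simps)
  have "(cmod c)\<^sup>2 \<le> 1\<^sup>2"
    using c zero_le_power2[of r] unfolding one_power2 by linarith
  then have c1: "cmod c \<le> 1"
    by (rule power2_le_imp_le) simp
  have "\<bar>?h\<bar> \<le> cmod (herm (c *s a) (complex_of_real r *s b))"
    by (rule abs_Re_le_cmod)
  also have "\<dots> \<le> (cmod c * norm a) * (r * norm b)"
    using cmod_herm_le[of "c *s a" "complex_of_real r *s b"] r by (simp add: norm_smult_complex)
  also have "\<dots> = cmod c * (r * (norm a * norm b))"
    by simp
  also have "\<dots> \<le> 1 * (r * (norm a * norm b))"
    using c1 r by (intro mult_right_mono) auto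
  finally have h: "2 * \<bar>?h\<bar> \<le> r * (2 * norm a * norm b)"
    by simp
  have "r * (2 * norm a * norm b) \<le> r * ((norm a)\<^sup>2 + (norm b)\<^sup>2)"
    using r by (intro mult_left_mono sum_squares_bound)
  moreover have r2: "r\<^sup>2 \<le> r"
    using r by (simp add: power2_eq_square mult_left_le)
  have "r\<^sup>2 * (norm a)\<^sup>2 \<le> r * (norm a)\<^sup>2" "r\<^sup>2 * (norm b)\<^sup>2 \<le> r * (norm b)\<^sup>2"
    "0 \<le> r\<^sup>2 * (norm a)\<^sup>2" "0 \<le> r\<^sup>2 * (norm b)\<^sup>2"
    using r2 by (auto intro: mult_right_mono)
  ultimately have "\<bar>r\<^sup>2 * (norm a)\<^sup>2 - r\<^sup>2 * (norm b)\<^sup>2 - 2 * ?h\<bar> \<le> 2 * (r * (norm a)\<^sup>2 + r * (norm b)\<^sup>2)"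
    using h unfolding distrib_left by linarith
  then show ?thesis
    unfolding eq by (simp add: algebra_simps)
qed

context stochastic
begin

lemma mean_iter_bound:
  fixes \<phi> :: "complex^'d \<Rightarrow> 'b::{banach, second_countable_topology}"
  assumes "homog \<phi>" "\<And>x. norm (\<phi> x) \<le> B * (norm x)\<^sup>2"
  shows "norm ((mean \<mu> ^^ n) \<phi> x) \<le> B * (norm x)\<^sup>2"
proof (induction n arbitrary: x)
  case (Suc n)
  have h: "homog ((mean \<mu> ^^ n) \<phi>)"
    by (rule homog_iter_mean[OF assms(1)])
  have "norm ((mean \<mu> ^^ Suc n) \<phi> x) \<le> (\<integral> v. norm ((mean \<mu> ^^ n) \<phi> (v *v x)) \<partial>\<mu>)"
    by (simp add: mean_def)
  also have "\<dots> \<le> (\<integral> v. B * (norm (v *v x))\<^sup>2 \<partial>\<mu>)"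
    by (intro integral_mono integrable_norm integrable_homog h Suc integrable_mult_right integral_norm_square)
  also have "\<dots> = B * (norm x)\<^sup>2"
    by (simp add: integral_norm_square)
  finally show ?case .
qed (use assms in simp)

text \<open>Write the second point as \<open>y = c x + r w\<close> with \<open>(x, w)\<close> orthonormal and average the pointwise bound
  on \<open>\<phi> a - \<phi> (c a + r b)\<close> over \<open>(a, b) = W (x, w)\<close>. The Hoelder part is damped through the contracted area,
  while the change of the weight only costs a multiple of the sup norm.\<close>

lemma lasota_yorke:
  assumes \<phi>: "homog \<phi>" and hol: "holder \<alpha> C \<phi>" and B: "\<And>x. cmod (\<phi> x) \<le> B * (norm x)\<^sup>2"
    and C: "0 \<le> C" and \<alpha>: "0 < \<alpha>" "\<alpha> \<le> 1" and \<delta>: "0 < \<delta>" "\<delta> \<le> 1"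
    and \<eta>: "0 \<le> \<eta>" "\<And>X. iter n ar X \<le> \<eta> * ar X"
  shows "holder \<alpha> (C * (\<delta> powr \<alpha> + \<eta> / \<delta>) + 4 * B) ((mean \<mu> ^^ n) \<phi>)"
  unfolding holder_def
proof (intro allI impI)
  let ?\<phi>n = "(mean \<mu> ^^ n) \<phi>"
  let ?D = "C * (\<delta> powr \<alpha> + \<eta> / \<delta>) + 4 * B"
  fix x y :: "complex^'d"
  assume x: "norm x = 1" and y: "norm y = 1"
  have B0: "0 \<le> B"
    using order_trans[OF norm_ge_zero B[of x]] x by simp
  then have D0: "0 \<le> ?D"
    using C \<delta> \<eta> by simp
  show "cmod (?\<phi>n x - ?\<phi>n y) \<le> ?D * area x y powr \<alpha>"
  proof (cases "\<exists>c. y = c *s x")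
    case True
    then obtain c where c: "y = c *s x" by blast
    then have "cmod c = 1"
      using x y by (simp add: norm_smult_complex)
    then have "?\<phi>n y = ?\<phi>n x"
      using homog_iter_mean[OF \<phi>, of n] by (simp add: homog_def c)
    then show ?thesis
      using D0 by simp
  next
    case False
    from gram_schmidt_unit[OF x this]
    obtain c r w where w: "orthonormal x w" "r > 0" "y = c *s x + complex_of_real r *s w" "r = area x y"
      by blast
    have "1 = (norm (c *s x + complex_of_real r *s w))\<^sup>2"
      using y w(3) by simp
    also have "\<dots> = (cmod c)\<^sup>2 + r\<^sup>2"
      using w(1) by (simp add: norm_add_square norm_smult_complex herm_simps orthonormal_def)
    finally have c: "(cmod c)\<^sup>2 + r\<^sup>2 = 1" ..
    then have "r\<^sup>2 \<le> 1\<^sup>2"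
      using zero_le_power2[of "cmod c"] unfolding one_power2 by linarith
    then have r1: "r \<le> 1"
      by (rule power2_le_imp_le) simp
    \<comment> \<open>\<open>F\<close> at \<open>W (x, w)\<close> is the difference of \<open>\<phi>\<close> at \<open>W x\<close> and \<open>W y\<close>; \<open>G\<close> is its bound\<close>
    define F where "F = (\<lambda>X :: (complex^'d) \<times> (complex^'d). \<phi> (fst X) - \<phi> (fst (comb c r 0 0 X)))"
    define G1 where "G1 = (\<lambda>X :: (complex^'d) \<times> (complex^'d). (norm (fst X))\<^sup>2)"
    define k where "k = C * r powr \<alpha>"
    define G where "G = (\<lambda>X :: (complex^'d) \<times> (complex^'d). (k * \<delta> powr \<alpha>) * G1 X + ((k / \<delta>) * ar X + (2 * B * r) * (norm X)\<^sup>2))"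
    have qF: "quad F"
      unfolding F_def by (intro quad_diff quad_homog_fst \<phi> quad_comb[where F = "\<lambda>X. \<phi> (fst X)"])
    have qG1: "quad G1"
      unfolding G1_def by (intro quad_homog_fst homog_norm_square)
    have qG: "quad G"
      unfolding G_def by (intro quad_add quad_mult qG1 quad_area quad_norm_square)
    have FG: "norm (F X) \<le> G X" for X
    proof -
      obtain a b where X: "X = (a, b)" by fastforce
      let ?b = "c *s a + complex_of_real r *s b"
      have F: "F X = \<phi> a - \<phi> ?b"
        by (simp add: F_def X comb_def)
      have a: "area a ?b = r * area a b"
        using area_combination[of 1 a c r b] w(2) by simp
      have "area a ?b powr \<alpha> * ((norm a)\<^sup>2) powr (1 - \<alpha>)
          = r powr \<alpha> * (area a b powr \<alpha> * ((norm a)\<^sup>2) powr (1 - \<alpha>))"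
        unfolding a using w(2) by (simp add: powr_mult)
      also have "\<dots> \<le> r powr \<alpha> * (\<delta> powr \<alpha> * (norm a)\<^sup>2 + area a b / \<delta>)"
        using \<alpha> \<delta> by (intro mult_left_mono powr_interpolation) auto
      finally have "C * (area a ?b powr \<alpha> * ((norm a)\<^sup>2) powr (1 - \<alpha>))
          \<le> C * (r powr \<alpha> * (\<delta> powr \<alpha> * (norm a)\<^sup>2 + area a b / \<delta>))"
        using C by (rule mult_left_mono)
      moreover have "B * \<bar>(norm a)\<^sup>2 - (norm ?b)\<^sup>2\<bar> \<le> B * (2 * r * ((norm a)\<^sup>2 + (norm b)\<^sup>2))"
        using w(2) r1 by (intro mult_left_mono norm_rotation_difference c B0) auto
      ultimately have "cmod (\<phi> a - \<phi> ?b) \<le> C * (r powr \<alpha> * (\<delta> powr \<alpha> * (norm a)\<^sup>2 + area a b / \<delta>))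
          + B * (2 * r * ((norm a)\<^sup>2 + (norm b)\<^sup>2))"
        using homog_difference_bound[OF \<phi> hol B C \<alpha>, of a ?b] by linarith
      also have "\<dots> = G X"
        by (simp add: G_def G1_def X norm_pair_square k_def algebra_simps)
      finally show ?thesis
        by (simp add: F)
    qed
    have "?\<phi>n x - ?\<phi>n y = iter n F (x, w)"
    proof -
      have "iter n F = (\<lambda>X. iter n (\<lambda>X. \<phi> (fst X)) X - iter n (\<lambda>X. \<phi> (fst (comb c r 0 0 X))) X)"
        unfolding F_def by (intro iter_diff quad_homog_fst \<phi> quad_comb[where F = "\<lambda>X. \<phi> (fst X)"])
      also have "iter n (\<lambda>X. \<phi> (fst (comb c r 0 0 X))) = (\<lambda>X. iter n (\<lambda>X. \<phi> (fst X)) (comb c r 0 0 X))"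
        by (rule iter_pair_mean_comb[where F = "\<lambda>X. \<phi> (fst X)"])
      finally show ?thesis
        by (simp add: iter_pair_mean_fst comb_def w(3))
    qed
    then have "cmod (?\<phi>n x - ?\<phi>n y) \<le> iter n (\<lambda>X. norm (F X)) (x, w)"
      using norm_iter_le[OF qF] by simp
    also have "\<dots> \<le> iter n G (x, w)"
      by (intro iter_mono quad_norm qF qG FG)
    also have "iter n G = (\<lambda>X. (k * \<delta> powr \<alpha>) * iter n G1 X + ((k / \<delta>) * iter n ar X + (2 * B * r) * (norm X)\<^sup>2))"
      unfolding G_def
      by (simp only: iter_add[OF quad_mult[OF qG1] quad_add[OF quad_mult[OF quad_area] quad_mult[OF quad_norm_square]]]
          iter_add[OF quad_mult[OF quad_area] quad_mult[OF quad_norm_square]]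
          iter_mult[OF qG1] iter_mult[OF quad_area] iter_mult[OF quad_norm_square] iter_norm_square)
    also have "iter n G1 = G1"
    proof -
      have "(mean \<mu> ^^ n) (\<lambda>x. (norm x)\<^sup>2) = (\<lambda>x. (norm x)\<^sup>2)"
        by (induction n) (simp_all add: mean_norm_square)
      then show ?thesis
        unfolding G1_def iter_pair_mean_fst[where \<phi> = "\<lambda>x. (norm x)\<^sup>2"] by simp
    qed
    also have "(k * \<delta> powr \<alpha>) * G1 (x, w) + ((k / \<delta>) * iter n ar (x, w) + (2 * B * r) * (norm (x, w))\<^sup>2)
        \<le> (k * \<delta> powr \<alpha>) * 1 + ((k / \<delta>) * \<eta> + (2 * B * r) * 2)"
    proof (intro add_mono mult_left_mono)
      show "iter n ar (x, w) \<le> \<eta>"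
        using \<eta>(2)[of "(x, w)"] area_orthonormal[OF w(1)] by simp
    qed (use w(1,2) B0 C \<delta> in \<open>auto simp: G1_def k_def norm_pair_square orthonormal_def\<close>)
    also have "\<dots> = C * (\<delta> powr \<alpha> + \<eta> / \<delta>) * r powr \<alpha> + 4 * B * r"
      by (simp add: k_def algebra_simps)
    also have "4 * B * r \<le> 4 * B * r powr \<alpha>"
    proof -
      have "r powr 1 \<le> r powr \<alpha>"
        using w(2) r1 \<alpha> by (intro powr_mono') auto
      then show ?thesis
        using w(2) B0 by (intro mult_left_mono) auto
    qed
    finally show ?thesis
      by (simp add: w(4)[symmetric] distrib_right)
  qed
qed

lemma holder_iter:
  assumes "homog \<phi>" "holder \<alpha> C \<phi>" "\<And>x. cmod (\<phi> x) \<le> B * (norm x)\<^sup>2" "0 \<le> C" "0 < \<alpha>" "\<alpha> \<le> 1"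
  shows "holder \<alpha> (2 * C + 4 * B) ((mean \<mu> ^^ n) \<phi>)"
  using lasota_yorke[OF assms, of 1 1 n] iter_area_le by (simp add: mult.commute)

text \<open>Choose \<open>\<delta>\<close> with \<open>\<delta>\<^sup>\<alpha> = 1/4\<close>, and then enough steps to contract areas by \<open>\<delta>/4\<close>.\<close>

lemma lasota_yorke_half:
  assumes "purifying \<mu>" "0 < \<alpha>" "\<alpha> \<le> 1"
  shows "\<exists>n. \<forall>\<phi> C B. homog \<phi> \<longrightarrow> holder \<alpha> C \<phi> \<longrightarrow> (\<forall>x. cmod (\<phi> x) \<le> B * (norm x)\<^sup>2) \<longrightarrow> 0 \<le> C
      \<longrightarrow> holder \<alpha> (C / 2 + 4 * B) ((mean \<mu> ^^ n) \<phi>)"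
proof -
  define \<delta> :: real where "\<delta> = (1 / 4) powr (1 / \<alpha>)"
  have \<delta>: "0 < \<delta>" "\<delta> \<le> 1" "\<delta> powr \<alpha> = 1 / 4"
    using assms by (auto simp: \<delta>_def powr_powr intro!: powr_le1)
  have "\<delta> / 4 > 0"
    using \<delta>(1) by simp
  then obtain n where n: "\<And>X. iter n ar X \<le> \<delta> / 4 * ar X"
    using iter_area_tends_to_0[OF assms(1)] by blast
  have "holder \<alpha> (C / 2 + 4 * B) ((mean \<mu> ^^ n) \<phi>)"
    if "homog \<phi>" "holder \<alpha> C \<phi>" "\<forall>x. cmod (\<phi> x) \<le> B * (norm x)\<^sup>2" "0 \<le> C" for \<phi> C B
    using lasota_yorke[OF that(1,2) _ that(4) assms(2,3) \<delta>(1,2) _ n, of B] that(3) \<delta> by simp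
  then show ?thesis by blast
qed

end

section \<open>Functions on the projective space and the invariant measure\<close>

definition lift :: "('d::finite cproj \<Rightarrow> complex) \<Rightarrow> complex^'d \<Rightarrow> complex" where
  "lift f x = f (line x) * complex_of_real ((norm x)\<^sup>2)"

lemma line_smult: "c \<noteq> 0 \<Longrightarrow> x \<noteq> 0 \<Longrightarrow> line (c *s x) = line (x :: complex^'d)"
  by (subst line_eq_iff) (auto simp: vector_smult_assoc intro!: exI[of _ "inverse c"])

lemma continuous_on_line: "continuous_on (- {0}) (line :: complex^'d \<Rightarrow> 'd::finite cproj)"
  unfolding continuous_on_def
proof (intro ballI)
  fix x :: "complex^'d" assume "x \<in> - {0}"
  then have x: "x \<noteq> 0" by simp
  have "continuous_on (- {0}) (\<lambda>y :: complex^'d. area y x / (norm y * norm x))"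
    using x by (intro continuous_intros) auto
  then have "((\<lambda>y. area y x / (norm y * norm x)) \<longlongrightarrow> area x x / (norm x * norm x)) (at x within - {0})"
    using x unfolding continuous_on_def by blast
  moreover have "area x x = 0"
    using area_combination[of 1 x 1 0 0] by simp
  ultimately have "((\<lambda>y. area y x / (norm y * norm x)) \<longlongrightarrow> 0) (at x within - {0})"
    by simp
  then have "((\<lambda>y. dist (line y) (line x)) \<longlongrightarrow> 0) (at x within - {0})"
    by (rule Lim_transform_eventually) (use x in \<open>auto simp: eventually_at_filter dist_line_area\<close>)
  then show "(line \<longlongrightarrow> line x) (at x within - {0})"
    by (rule tendsto_dist_iff[THEN iffD2])
qed

lemma lift_unit_rep: "lift f (unit_rep p) = f p"
  by (simp add: lift_def unit_rep)

lemma homog_eq_unit_rep: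
  assumes "homog \<phi>" "x \<noteq> 0"
  shows "\<phi> x = (norm x)\<^sup>2 *\<^sub>R \<phi> (unit_rep (line x))"
proof -
  obtain c where c: "x = c *s unit_rep (line x)"
    using line_eq_iff[of "unit_rep (line x)" x] assms(2) unit_rep_nonzero unit_rep(2) by metis
  then have "norm x = cmod c"
    using norm_smult_complex[of c "unit_rep (line x)"] by (simp add: unit_rep(1))
  then show ?thesis
    using assms(1) c unfolding homog_def by metis
qed

lemma lift_homog: "homog \<phi> \<Longrightarrow> lift (\<lambda>p. \<phi> (unit_rep p)) = \<phi>"
proof
  fix x assume \<phi>: "homog \<phi>"
  show "lift (\<lambda>p. \<phi> (unit_rep p)) x = \<phi> x"
  proof (cases "x = 0")
    case True
    then show ?thesis by (simp add: lift_def homog_zero[OF \<phi>])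
  next
    case False
    then show ?thesis
      using homog_eq_unit_rep[OF \<phi> False] by (simp add: lift_def scaleR_conv_of_real mult.commute)
  qed
qed

lemma continuous_bounded_cproj:
  fixes f :: "'d::finite cproj \<Rightarrow> complex"
  assumes "continuous_on UNIV f"
  obtains B where "\<And>p. cmod (f p) \<le> B"
proof -
  have "continuous_on (sphere 0 1) (line :: complex^'d \<Rightarrow> _)"
    by (rule continuous_on_subset[OF continuous_on_line]) auto
  then have "continuous_on (sphere 0 1) (\<lambda>x. f (line x))"
    by (intro continuous_on_compose2[OF assms]) auto
  then have "bounded ((\<lambda>x. f (line x)) ` sphere 0 1)"
    by (intro compact_imp_bounded compact_continuous_image compact_sphere)
  then obtain B where B: "\<forall>y\<in>(\<lambda>x. f (line x)) ` sphere 0 1. cmod y \<le> B"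
    unfolding bounded_iff by blast
  have "cmod (f p) \<le> B" for p
    using B unit_rep[of p] by force
  then show thesis by (rule that)
qed

lemma homog_lift:
  assumes "continuous_on UNIV f"
  shows "homog (lift f)"
  unfolding homog_def
proof
  obtain B where B: "\<And>p. cmod (f p) \<le> B"
    using continuous_bounded_cproj[OF assms] by blast
  have "isCont (lift f) x" for x
  proof (cases "x = 0")
    case True
    have lim: "((\<lambda>y :: complex^'a. B * (norm y)\<^sup>2) \<longlongrightarrow> 0) (at 0)"
      by (intro tendsto_mult_right_zero tendsto_null_power tendsto_norm_zero tendsto_ident_at) simp
    have "cmod (lift f y) \<le> B * (norm y)\<^sup>2" for y
      using B by (simp add: lift_def norm_mult mult_right_mono flip: of_real_power)
    then have "(lift f \<longlongrightarrow> 0) (at 0)"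
      by (intro Lim_null_comparison[OF _ lim] always_eventually allI)
    then show ?thesis
      using True by (simp add: isCont_def lift_def)
  next
    case False
    have "continuous_on (- {0}) (\<lambda>x. f (line x) * complex_of_real ((norm x)\<^sup>2))"
      by (intro continuous_intros continuous_on_compose2[OF assms continuous_on_line]) auto
    then have "continuous_on (- {0}) (lift f)"
      by (rule continuous_on_cong[THEN iffD1, rotated 2]) (auto simp: lift_def)
    then show ?thesis
      by (rule continuous_on_interior) (use False in \<open>simp add: interior_open open_Compl\<close>)
  qed
  then show "continuous_on UNIV (lift f)"
    by (simp add: continuous_on_eq_continuous_at)
  show "\<forall>c x. lift f (c *s x) = (cmod c)\<^sup>2 *\<^sub>R lift f x"
  proof (intro allI)
    fix c x
    show "lift f (c *s x) = (cmod c)\<^sup>2 *\<^sub>R lift f x"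
      by (cases "c = 0 \<or> x = 0")
         (auto simp: lift_def line_smult norm_smult_complex power_mult_distrib scaleR_conv_of_real)
  qed
qed

text \<open>The chosen unit vectors need not depend continuously on the line, but the orthogonal projectors
  onto the lines do. Near \<open>p\<^sub>0\<close>, the projection \<open>z p\<close> of a unit vector of \<open>p\<^sub>0\<close> onto \<open>p\<close> is a nonzero
  representative of \<open>p\<close> that varies continuously.\<close>

lemma continuous_on_unit_rep:
  fixes \<phi> :: "complex^'d::finite \<Rightarrow> 'b::real_normed_vector"
  assumes \<phi>: "homog \<phi>"
  shows "continuous_on UNIV (\<lambda>p. \<phi> (unit_rep p))"
proof -
  have "isCont (\<lambda>p. \<phi> (unit_rep p)) p0" for p0
  proof -
    define x0 where "x0 = unit_rep p0"
    define z where "z p = outer (unit_rep p) *v x0" for p :: "'d cproj"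
    have D: "dist p q = norm (outer (unit_rep p) - outer (unit_rep q)) / sqrt 2" for p q :: "'d cproj"
      unfolding dist_cproj_def by (intro norm_outer_diff unit_rep)
    have outer: "continuous_on UNIV (\<lambda>p :: 'd cproj. outer (unit_rep p))"
      unfolding continuous_on_def
    proof (intro ballI)
      fix p :: "'d cproj"
      have "((\<lambda>q. sqrt 2 * dist q p) \<longlongrightarrow> sqrt 2 * dist p p) (at p within UNIV)"
        by (intro tendsto_intros)
      then have "((\<lambda>q. dist (outer (unit_rep q)) (outer (unit_rep p))) \<longlongrightarrow> 0) (at p within UNIV)"
        by (simp add: D dist_norm)
      then show "((\<lambda>p. outer (unit_rep p)) \<longlongrightarrow> outer (unit_rep p)) (at p within UNIV)"
        by (rule tendsto_dist_iff[THEN iffD2])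
    qed
    have z: "continuous_on UNIV z"
      unfolding z_def by (intro continuous_intros outer)
    have zp: "z p = herm (unit_rep p) x0 *s unit_rep p" for p
      by (simp add: z_def outer_vector)
    have h2: "(cmod (herm (unit_rep p) x0))\<^sup>2 = (norm (z p))\<^sup>2" for p
      by (simp add: zp norm_smult_complex unit_rep(1))
    have eq: "\<phi> (z p) = (norm (z p))\<^sup>2 *\<^sub>R \<phi> (unit_rep p)" for p
      using \<phi> unfolding homog_def h2[symmetric] by (simp add: zp)
    have z0: "norm (z p0) = 1"
      by (simp add: zp norm_smult_complex unit_rep(1) x0_def herm_self)
    have "isCont z p0"
      using z by (simp add: continuous_on_eq_continuous_at)
    moreover have "isCont \<phi> (z p0)"
      using \<phi> by (simp add: homog_def continuous_on_eq_continuous_at)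
    ultimately have c: "isCont (\<lambda>p. (1 / (norm (z p))\<^sup>2) *\<^sub>R \<phi> (z p)) p0"
      using z0 by (intro continuous_intros isCont_o2[of p0 z \<phi>]) auto
    have "eventually (\<lambda>p. z p \<noteq> 0) (nhds p0)"
      using \<open>isCont z p0\<close> z0 by (intro tendsto_imp_eventually_ne[of z "z p0"]) (auto simp: isCont_def tendsto_at_iff_tendsto_nhds)
    then have "eventually (\<lambda>p. (1 / (norm (z p))\<^sup>2) *\<^sub>R \<phi> (z p) = \<phi> (unit_rep p)) (nhds p0)"
      by eventually_elim (simp add: eq)
    from isCont_cong[OF this] c show ?thesis by simp
  qed
  then show ?thesis
    by (simp add: continuous_on_eq_continuous_at)
qed

context stochastic
begin

lemma kernel_op_eq_mean: "kernel_op \<mu> f p = mean \<mu> (lift f) (unit_rep p)"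
  by (simp add: kernel_op_def mean_def lift_def act_def)

text \<open>The law of the next point of the Markov chain started at \<open>p\<close>.\<close>

definition step_law :: "'d cproj \<Rightarrow> 'd cproj measure" where
  "step_law p = distr (density \<mu> (\<lambda>v. ennreal ((norm (v *v unit_rep p))\<^sup>2))) borel (\<lambda>v. act v p)"

lemma measurable_act: "(\<lambda>v. act v p) \<in> borel_measurable \<mu>"
proof -
  have l: "(line :: complex^'d \<Rightarrow> 'd cproj) \<in> borel_measurable borel"
    by (rule borel_measurable_continuous_countable_exceptions[of "{0}"]) (auto intro: continuous_on_line)
  have "(\<lambda>v. v *v unit_rep p) \<in> borel_measurable \<mu>"
    by (intro measurable_continuous continuous_intros)
  from measurable_compose[OF this l] show ?thesis
    by (simp add: act_def)
qed

lemma measurable_weight: "(\<lambda>v. (norm (v *v x))\<^sup>2) \<in> borel_measurable \<mu>"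
  by (intro measurable_continuous continuous_intros)

lemma emeasure_step_law:
  assumes "S \<in> sets borel"
  shows "emeasure (step_law p) S = kernel \<mu> p S"
proof -
  let ?w = "\<lambda>v. ennreal ((norm (v *v unit_rep p))\<^sup>2)"
  let ?A = "(\<lambda>v. act v p) -` S \<inter> space \<mu>"
  have A: "?A \<in> sets \<mu>"
    by (rule measurable_sets[OF measurable_act assms])
  have "emeasure (step_law p) S = emeasure (density \<mu> ?w) ?A"
    unfolding step_law_def using measurable_act assms by (subst emeasure_distr) auto
  also have "\<dots> = (\<integral>\<^sup>+ v. ?w v * indicator ?A v \<partial>\<mu>)"
    using measurable_weight A by (intro emeasure_density) auto
  also have "\<dots> = kernel \<mu> p S"
    unfolding kernel_def by (intro nn_integral_cong) (auto simp: indicator_def)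
  finally show ?thesis .
qed

lemma kernel_UNIV: "kernel \<mu> p UNIV = 1"
proof -
  have "kernel \<mu> p UNIV = ennreal (\<integral> v. (norm (v *v unit_rep p))\<^sup>2 \<partial>\<mu>)"
    unfolding kernel_def using integral_norm_square(1)[of "unit_rep p"] by (subst nn_integral_eq_integral[symmetric]) auto
  then show ?thesis
    by (simp add: integral_norm_square unit_rep(1))
qed

lemma prob_space_step_law: "prob_space (step_law p)"
proof (rule prob_spaceI)
  have "space (step_law p) = UNIV"
    by (simp add: step_law_def)
  then show "emeasure (step_law p) (space (step_law p)) = 1"
    by (simp add: emeasure_step_law kernel_UNIV)
qed

lemma integral_step_law:
  fixes f :: "'d cproj \<Rightarrow> real"
  assumes "continuous_on UNIV f"
  shows "(\<integral> q. f q \<partial>step_law p) = Re (mean \<mu> (lift (\<lambda>q. complex_of_real (f q))) (unit_rep p))"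
proof -
  have f: "f \<in> borel_measurable borel"
    by (rule borel_measurable_continuous_onI[OF assms])
  have "continuous_on UNIV (\<lambda>q. complex_of_real (f q))"
    by (intro continuous_intros assms)
  note h = homog_lift[OF this]
  have "(\<integral> q. f q \<partial>step_law p) = (\<integral> v. f (act v p) \<partial>density \<mu> (\<lambda>v. ennreal ((norm (v *v unit_rep p))\<^sup>2)))"
    unfolding step_law_def using measurable_act by (intro integral_distr f) auto
  also have "\<dots> = (\<integral> v. (norm (v *v unit_rep p))\<^sup>2 * f (act v p) \<partial>\<mu>)"
    using measurable_compose[OF measurable_act f] measurable_weight by (intro integral_real_density) auto
  also have "\<dots> = (\<integral> v. Re (lift (\<lambda>q. complex_of_real (f q)) (v *v unit_rep p)) \<partial>\<mu>)"
    by (intro Bochner_Integration.integral_cong) (simp_all add: lift_def act_def mult.commute flip: of_real_mult del: of_real_power)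
  also have "\<dots> = Re (mean \<mu> (lift (\<lambda>q. complex_of_real (f q))) (unit_rep p))"
    unfolding mean_def by (intro integral_bounded_linear bounded_linear_Re integrable_homog h)
  finally show ?thesis .
qed

text \<open>It suffices to test open sets, whose indicator functions are increasing limits of continuous
  functions; for the latter the dependence on \<open>p\<close> is continuous.\<close>

lemma measurable_step_law: "step_law \<in> measurable borel (subprob_algebra borel)"
proof (rule measurable_subprob_algebra_generated[where \<Omega> = UNIV and G = "{U. open U}"])
  show "sets borel = sigma_sets UNIV {U :: 'd cproj set. open U}"
    by (simp add: borel_def)
  show "Int_stable {U :: 'd cproj set. open U}"
    by (auto simp: Int_stable_def)
  show "subprob_space (step_law p)" for p
    by (rule prob_space_imp_subprob_space[OF prob_space_step_law])
  show "sets (step_law p) = sets borel" for p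
    by (simp add: step_law_def)
  show "(\<lambda>p. emeasure (step_law p) UNIV) \<in> borel_measurable borel"
    by (simp add: emeasure_step_law kernel_UNIV)
  fix U :: "'d cproj set" assume "U \<in> {U. open U}"
  then have U: "open U" by simp
  show "(\<lambda>p. emeasure (step_law p) U) \<in> borel_measurable borel"
  proof (cases "U = UNIV")
    case True
    then show ?thesis by (simp add: emeasure_step_law kernel_UNIV)
  next
    case False
    define F where "F m q = min 1 (real m * infdist q (- U))" for m q
    have F01: "0 \<le> F m q" "F m q \<le> 1" for m q
      by (auto simp: F_def infdist_nonneg)
    have cF: "continuous_on UNIV (F m)" for m
      unfolding F_def by (intro continuous_intros)
    have sup: "(SUP m. ennreal (F m q)) = indicator U q" for q
    proof (cases "q \<in> U")
      case True
      have "closed (- U)" "- U \<noteq> {}"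
        using U False by auto
      then have "infdist q (- U) > 0"
        using True infdist_pos_not_in_closed[of "- U" q] by auto
      then obtain m where "1 \<le> real m * infdist q (- U)"
        using ex_less_of_nat_mult[of "infdist q (- U)" 1] by (auto intro: less_imp_le)
      then have "F m q = 1"
        by (simp add: F_def)
      then have "1 \<le> (SUP m. ennreal (F m q))"
        by (intro SUP_upper2[of m]) auto
      moreover have "(SUP m. ennreal (F m q)) \<le> 1"
        using F01 by (intro SUP_least) simp
      ultimately have "(SUP m. ennreal (F m q)) = 1"
        by (rule antisym[rotated])
      then show ?thesis
        using True by simp
    next
      case False
      then have "F m q = 0" for m
        by (simp add: F_def)
      then show ?thesis
        using False by simp
    qed
    have inc: "incseq (\<lambda>m q. ennreal (F m q))"
      unfolding incseq_def le_fun_def F_def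
      by (intro allI impI ennreal_leI min.mono mult_right_mono) (auto simp: infdist_nonneg)
    have "emeasure (step_law p) U = (SUP m. ennreal (Re (mean \<mu> (lift (\<lambda>q. complex_of_real (F m q))) (unit_rep p))))" for p
    proof -
      interpret K: prob_space "step_law p" by (rule prob_space_step_law)
      have mF: "F m \<in> borel_measurable (step_law p)" for m
        using borel_measurable_continuous_onI[OF cF] by (simp add: step_law_def)
      have "emeasure (step_law p) U = (\<integral>\<^sup>+ q. (SUP m. ennreal (F m q)) \<partial>step_law p)"
        unfolding sup using U by (simp add: step_law_def)
      also have "\<dots> = (SUP m. \<integral>\<^sup>+ q. ennreal (F m q) \<partial>step_law p)"
        by (intro nn_integral_monotone_convergence_SUP inc) (use mF in measurable)
      also have "\<dots> = (SUP m. ennreal (\<integral> q. F m q \<partial>step_law p))"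
        using F01 mF by (intro SUP_cong refl nn_integral_eq_integral K.integrable_const_bound[of _ 1]) auto
      finally show ?thesis
        by (simp only: integral_step_law[OF cF])
    qed
    moreover have "(\<lambda>p. Re (mean \<mu> (lift (\<lambda>q. complex_of_real (F m q))) (unit_rep p))) \<in> borel_measurable borel" for m
      by (intro borel_measurable_continuous_onI continuous_on_Re continuous_on_unit_rep homog_mean homog_lift continuous_intros cF)
    ultimately show ?thesis by simp
  qed
qed simp

text \<open>Invariance on measurable sets says that \<open>\<nu>\<close> is its own composition with the one-step law, and
  integrals pass through such a composition.\<close>

lemma invariant_integral_real:
  assumes \<nu>: "invariant_prob \<mu> \<nu>" and f: "continuous_on UNIV (f :: 'd cproj \<Rightarrow> real)"
  shows "(\<integral> p. f p \<partial>\<nu>) = (\<integral> p. Re (mean \<mu> (lift (\<lambda>q. complex_of_real (f q))) (unit_rep p)) \<partial>\<nu>)"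
proof -
  have prob: "prob_space \<nu>" and sets: "sets \<nu> = sets borel"
    using \<nu> by (auto simp: invariant_prob_def borel_prob_def)
  interpret prob_space \<nu> by fact
  have sl: "step_law \<in> measurable \<nu> (subprob_algebra borel)"
    using measurable_step_law measurable_cong_sets[OF sets refl] by blast
  have "bind \<nu> step_law = \<nu>"
  proof (rule measure_eqI)
    show s: "sets (bind \<nu> step_law) = sets \<nu>"
      using sets_bind[OF _ not_empty, of step_law borel] sets by (simp add: step_law_def)
    fix S assume "S \<in> sets (bind \<nu> step_law)"
    then have S: "S \<in> sets borel"
      using s sets by simp
    show "emeasure (bind \<nu> step_law) S = emeasure \<nu> S"
      using emeasure_bind[OF not_empty sl S] \<nu> S by (simp add: emeasure_step_law invariant_prob_def)
  qed
  then have "(\<integral> p. f p \<partial>\<nu>) = (\<integral> p. f p \<partial>bind \<nu> step_law)"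
    by simp
  obtain B where B: "\<And>p. cmod (complex_of_real (f p)) \<le> B"
    by (rule continuous_bounded_cproj[of "\<lambda>p. complex_of_real (f p)"]) (auto intro!: continuous_intros f)
  have "(\<integral> p. f p \<partial>bind \<nu> step_law) = (\<integral> p. \<integral> q. f q \<partial>step_law p \<partial>\<nu>)"
  proof (rule integral_bind[where B = B and B' = 1])
    show "AE p in \<nu>. emeasure (step_law p) (space (step_law p)) \<le> ennreal 1"
      by (intro always_eventually allI) (simp add: prob_space.emeasure_space_1[OF prob_space_step_law])
  qed (use B sl in \<open>auto intro: borel_measurable_continuous_onI f finite_measure_axioms\<close>)
  then show ?thesis
    using \<open>bind \<nu> step_law = \<nu>\<close> by (simp add: integral_step_law[OF f])
qed

end

section \<open>The Poisson equation\<close>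

context stochastic
begin

lemma integrable_unit_rep:
  fixes \<phi> :: "complex^'d \<Rightarrow> 'b::{banach, second_countable_topology}"
  assumes "borel_prob \<nu>" "homog \<phi>"
  shows "integrable \<nu> (\<lambda>p. \<phi> (unit_rep p))"
proof -
  interpret prob_space \<nu>
    using assms(1) by (simp add: borel_prob_def)
  have sets: "sets \<nu> = sets borel"
    using assms(1) by (simp add: borel_prob_def)
  obtain C where C: "\<And>x. norm (\<phi> x) \<le> C * (norm x)\<^sup>2"
    using homog_quad[OF assms(2)] by (auto simp: quad_def)
  show ?thesis
  proof (rule integrable_const_bound)
    show "AE p in \<nu>. norm (\<phi> (unit_rep p)) \<le> C"
      using C[of "unit_rep p" for p] by (intro always_eventually allI) (simp add: unit_rep(1))
    show "(\<lambda>p. \<phi> (unit_rep p)) \<in> borel_measurable \<nu>"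
      using borel_measurable_continuous_onI[OF continuous_on_unit_rep[OF assms(2)]]
        measurable_cong_sets[OF sets refl] by blast
  qed
qed

lemma integral_mean_unit_rep:
  fixes \<phi> :: "complex^'d \<Rightarrow> complex"
  assumes \<nu>: "invariant_prob \<mu> \<nu>" and \<phi>: "homog \<phi>"
  shows "(\<integral> p. mean \<mu> \<phi> (unit_rep p) \<partial>\<nu>) = (\<integral> p. \<phi> (unit_rep p) \<partial>\<nu>)"
proof -
  have b: "borel_prob \<nu>"
    using \<nu> by (simp add: invariant_prob_def)
  have L: "L (\<integral> p. mean \<mu> \<phi> (unit_rep p) \<partial>\<nu>) = L (\<integral> p. \<phi> (unit_rep p) \<partial>\<nu>)"
    if L: "bounded_linear L" for L :: "complex \<Rightarrow> real"
  proof -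
    have L': "bounded_linear (\<lambda>z. complex_of_real (L z))"
      by (rule bounded_linear_compose[OF bounded_linear_of_real L])
    have h: "homog (\<lambda>x. complex_of_real (L (\<phi> x)))"
      by (rule homog_bounded_linear[OF \<phi> L'])
    have "L (\<integral> p. \<phi> (unit_rep p) \<partial>\<nu>) = (\<integral> p. L (\<phi> (unit_rep p)) \<partial>\<nu>)"
      using integral_bounded_linear[OF L integrable_unit_rep[OF b \<phi>]] by simp
    also have "\<dots> = (\<integral> p. Re (mean \<mu> (lift (\<lambda>q. complex_of_real (L (\<phi> (unit_rep q))))) (unit_rep p)) \<partial>\<nu>)"
      by (intro invariant_integral_real[OF \<nu>] continuous_on_unit_rep[OF homog_bounded_linear[OF \<phi> L]])
    also have "lift (\<lambda>q. complex_of_real (L (\<phi> (unit_rep q)))) = (\<lambda>x. complex_of_real (L (\<phi> x)))"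
      by (rule lift_homog[OF h])
    also have "mean \<mu> \<dots> = (\<lambda>x. complex_of_real (L (mean \<mu> \<phi> x)))"
      by (rule mean_bounded_linear[OF \<phi> L'])
    also have "(\<integral> p. Re (complex_of_real (L (mean \<mu> \<phi> (unit_rep p)))) \<partial>\<nu>) = L (\<integral> p. mean \<mu> \<phi> (unit_rep p) \<partial>\<nu>)"
      using integral_bounded_linear[OF L integrable_unit_rep[OF b homog_mean[OF \<phi>]]] by simp
    finally show ?thesis ..
  qed
  show ?thesis
    using L[OF bounded_linear_Re] L[OF bounded_linear_Im] by (rule complex_eqI)
qed

lemma mean_add_scaleR:
  fixes \<phi> \<psi> :: "complex^'d \<Rightarrow> complex"
  assumes "homog \<phi>" "homog \<psi>"
  shows "mean \<mu> (\<lambda>x. \<phi> x + r *\<^sub>R \<psi> x) = (\<lambda>x. mean \<mu> \<phi> x + r *\<^sub>R mean \<mu> \<psi> x)"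
  using assms by (simp add: fun_eq_iff mean_def integrable_homog)

lemma homog_scaleR: "homog \<phi> \<Longrightarrow> homog (\<lambda>x. r *\<^sub>R \<phi> x)"
  by (rule homog_bounded_linear[OF _ bounded_linear_scaleR_right])

lemma iter_mean_add_scaleR:
  fixes \<phi> \<psi> :: "complex^'d \<Rightarrow> complex"
  assumes "homog \<phi>" "homog \<psi>"
  shows "(mean \<mu> ^^ n) (\<lambda>x. \<phi> x + r *\<^sub>R \<psi> x) = (\<lambda>x. (mean \<mu> ^^ n) \<phi> x + r *\<^sub>R (mean \<mu> ^^ n) \<psi> x)"
  by (induction n) (simp_all add: mean_add_scaleR homog_iter_mean assms)

text \<open>A partial sum of the Neumann series of \<open>(Id - r T)\<^sup>-\<^sup>1 \<phi>\<close>.\<close>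

definition resolvent_sum :: "real \<Rightarrow> nat \<Rightarrow> (complex^'d \<Rightarrow> complex) \<Rightarrow> complex^'d \<Rightarrow> complex" where
  "resolvent_sum r N \<phi> = (\<lambda>x. \<Sum>k<N. r ^ k *\<^sub>R (mean \<mu> ^^ k) \<phi> x)"

lemma homog_resolvent_sum: "homog \<phi> \<Longrightarrow> homog (resolvent_sum r N \<phi>)"
  unfolding resolvent_sum_def by (intro homog_sum homog_scaleR homog_iter_mean)

lemma mean_resolvent_sum:
  assumes \<phi>: "homog \<phi>"
  shows "mean \<mu> (resolvent_sum r N \<phi>) x = (\<Sum>k<N. r ^ k *\<^sub>R (mean \<mu> ^^ Suc k) \<phi> x)"
proof -
  have "mean \<mu> (resolvent_sum r N \<phi>) x = (\<Sum>k<N. mean \<mu> (\<lambda>x. r ^ k *\<^sub>R (mean \<mu> ^^ k) \<phi> x) x)"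
    unfolding resolvent_sum_def by (subst mean_sum) (auto intro: homog_scaleR homog_iter_mean \<phi>)
  also have "\<dots> = (\<Sum>k<N. r ^ k *\<^sub>R (mean \<mu> ^^ Suc k) \<phi> x)"
    by (intro sum.cong refl)
       (subst mean_bounded_linear[OF homog_iter_mean[OF \<phi>] bounded_linear_scaleR_right], simp)
  finally show ?thesis .
qed

lemma resolvent_sum_equation:
  assumes \<phi>: "homog \<phi>"
  shows "resolvent_sum r N \<phi> x = (\<phi> x - r ^ N *\<^sub>R (mean \<mu> ^^ N) \<phi> x) + r *\<^sub>R mean \<mu> (resolvent_sum r N \<phi>) x"
proof -
  have "resolvent_sum r N \<phi> x - r *\<^sub>R mean \<mu> (resolvent_sum r N \<phi>) x
      = (\<Sum>k<N. r ^ k *\<^sub>R (mean \<mu> ^^ k) \<phi> x - r ^ Suc k *\<^sub>R (mean \<mu> ^^ Suc k) \<phi> x)"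
    unfolding mean_resolvent_sum[OF \<phi>]
    by (simp add: resolvent_sum_def sum_subtractf scaleR_sum_right)
  also have "\<dots> = \<phi> x - r ^ N *\<^sub>R (mean \<mu> ^^ N) \<phi> x"
    by (subst sum_lessThan_telescope'[where f = "\<lambda>k. r ^ k *\<^sub>R (mean \<mu> ^^ k) \<phi> x"]) simp
  finally show ?thesis
    by (simp add: algebra_simps)
qed

lemma integral_iter_mean:
  assumes "invariant_prob \<mu> \<nu>" "homog \<phi>"
  shows "(\<integral> p. (mean \<mu> ^^ n) \<phi> (unit_rep p) \<partial>\<nu>) = (\<integral> p. (\<phi> :: _ \<Rightarrow> complex) (unit_rep p) \<partial>\<nu>)"
  by (induction n) (simp_all add: integral_mean_unit_rep[OF assms(1)] homog_iter_mean assms(2))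

lemma integral_resolvent_sum:
  assumes \<nu>: "invariant_prob \<mu> \<nu>" and \<phi>: "homog \<phi>" and "(\<integral> p. \<phi> (unit_rep p) \<partial>\<nu>) = 0"
  shows "(\<integral> p. resolvent_sum r N \<phi> (unit_rep p) \<partial>\<nu>) = 0"
proof -
  have b: "borel_prob \<nu>"
    using \<nu> by (simp add: invariant_prob_def)
  show ?thesis
    unfolding resolvent_sum_def
    using integrable_unit_rep[OF b homog_iter_mean[OF \<phi>]]
    by (subst Bochner_Integration.integral_sum) (auto simp: integral_iter_mean[OF \<nu> \<phi>] assms(3))
qed

lemma iterate_resolvent_equation:
  fixes f g :: "complex^'d \<Rightarrow> complex"
  assumes f: "homog f" and g: "homog g" and eq: "\<And>x. f x = g x + r *\<^sub>R mean \<mu> f x"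
  shows "f x = resolvent_sum r n g x + r ^ n *\<^sub>R (mean \<mu> ^^ n) f x"
proof (induction n)
  case 0
  then show ?case by (simp add: resolvent_sum_def)
next
  case (Suc n)
  have "(mean \<mu> ^^ n) f = (mean \<mu> ^^ n) (\<lambda>x. g x + r *\<^sub>R mean \<mu> f x)"
    using eq by (metis (no_types, lifting) ext)
  also have "\<dots> = (\<lambda>x. (mean \<mu> ^^ n) g x + r *\<^sub>R (mean \<mu> ^^ Suc n) f x)"
    by (simp only: iter_mean_add_scaleR[OF g homog_mean[OF f]] funpow_Suc_right o_apply)
  finally have "(mean \<mu> ^^ n) f x = (mean \<mu> ^^ n) g x + r *\<^sub>R (mean \<mu> ^^ Suc n) f x"
    by (rule fun_cong)
  with Suc show ?case
    by (simp add: resolvent_sum_def scaleR_add_right mult.commute)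
qed

lemma holder_resolvent_sum:
  assumes "homog \<phi>" "holder \<alpha> C \<phi>" "\<And>x. cmod (\<phi> x) \<le> B * (norm x)\<^sup>2" "0 \<le> C" "0 < \<alpha>" "\<alpha> \<le> 1"
    and r: "0 \<le> r" "r \<le> 1"
  shows "holder \<alpha> (real N * (2 * C + 4 * B)) (resolvent_sum r N \<phi>)"
proof -
  obtain x :: "complex^'d" where "norm x = 1"
    using unit_vector_exists by blast
  then have B: "0 \<le> B"
    using order_trans[OF norm_ge_zero assms(3)[of x]] by simp
  have "holder \<alpha> (2 * C + 4 * B) (\<lambda>x. r ^ k *\<^sub>R (mean \<mu> ^^ k) \<phi> x)" for k
  proof (rule holder_mono[OF holder_scaleR[OF holder_iter[OF assms(1-6), of k]]])
    show "\<bar>r ^ k\<bar> * (2 * C + 4 * B) \<le> 2 * C + 4 * B"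
      using r B assms(4) by (intro mult_left_le_one_le) (auto simp: power_le_one)
  qed
  then have "holder \<alpha> (\<Sum>k<N. 2 * C + 4 * B) (resolvent_sum r N \<phi>)"
    unfolding resolvent_sum_def by (intro holder_sum) auto
  then show ?thesis by simp
qed

text \<open>The map \<open>c \<mapsto> c / 2 + E\<close> has fixed point \<open>2 E\<close>, to which its iterates converge. The finite
  constant \<open>c\<close> is needed only to start, and leaves no trace in the result.\<close>

lemma holder_self_improvement:
  fixes f :: "complex^'d \<Rightarrow> complex"
  assumes step: "\<And>c. 0 \<le> c \<Longrightarrow> holder \<alpha> c f \<Longrightarrow> holder \<alpha> (c / 2 + E) f"
    and "0 \<le> E" "0 \<le> c" "holder \<alpha> c f"
  shows "holder \<alpha> (2 * E) f"
proof -
  have pow: "holder \<alpha> (2 * E + c / 2 ^ j) f" for j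
  proof (induction j)
    case 0
    then show ?case
      using assms by (auto intro: holder_mono)
  next
    case (Suc j)
    have "0 \<le> 2 * E + c / 2 ^ j"
      using assms by simp
    from step[OF this Suc] show ?case
      by (rule holder_mono) (simp add: field_simps)
  qed
  show ?thesis
    unfolding holder_def
  proof (intro allI impI)
    fix x y :: "complex^'d"
    assume xy: "norm x = 1" "norm y = 1"
    have "(\<lambda>j. (2 * E + c * (1 / 2) ^ j) * area x y powr \<alpha>) \<longlonglongrightarrow> (2 * E + c * 0) * area x y powr \<alpha>"
      by (intro tendsto_intros LIMSEQ_power_zero) simp
    moreover have "cmod (f x - f y) \<le> (2 * E + c * (1 / 2) ^ j) * area x y powr \<alpha>" for j
      using holderD[OF pow[of j] xy] by (simp add: power_one_over divide_simps)
    ultimately show "cmod (f x - f y) \<le> 2 * E * area x y powr \<alpha>"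
      by (intro LIMSEQ_le_const) auto
  qed
qed

text \<open>Unfolding \<open>f = g + r T f\<close> for \<open>n\<close> steps writes \<open>f\<close> as a sum of \<open>n\<close> terms controlled by \<open>g\<close> plus
  \<open>r\<^sup>n T\<^sup>n f\<close>, whose Hoelder constant is half that of \<open>f\<close> up to the sup norm \<open>b\<close> of \<open>f\<close>.\<close>

lemma holder_resolvent_solution:
  assumes pur: "purifying \<mu>" and \<alpha>: "0 < \<alpha>" "\<alpha> \<le> 1"
  shows "\<exists>n. \<forall>f g r b c D B. homog f \<longrightarrow> homog g \<longrightarrow> (\<forall>x. f x = g x + r *\<^sub>R mean \<mu> f x) \<longrightarrow> 0 \<le> r \<longrightarrow> r \<le> 1
    \<longrightarrow> 0 \<le> c \<longrightarrow> holder \<alpha> c f \<longrightarrow> 0 \<le> D \<longrightarrow> holder \<alpha> D g \<longrightarrow> (\<forall>x. cmod (g x) \<le> B * (norm x)\<^sup>2)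
    \<longrightarrow> (\<forall>x. cmod (f x) \<le> b * (norm x)\<^sup>2) \<longrightarrow> holder \<alpha> (2 * (real n * (2 * D + 4 * B) + 4 * b)) f"
proof -
  obtain n where n: "\<And>\<phi> C B. homog \<phi> \<Longrightarrow> holder \<alpha> C \<phi> \<Longrightarrow> (\<forall>x. cmod (\<phi> x) \<le> B * (norm x)\<^sup>2) \<Longrightarrow> 0 \<le> C
      \<Longrightarrow> holder \<alpha> (C / 2 + 4 * B) ((mean \<mu> ^^ n) \<phi>)"
    using lasota_yorke_half[OF assms] by blast
  have "holder \<alpha> (2 * (real n * (2 * D + 4 * B) + 4 * b)) f"
    if f: "homog f" and g: "homog g" and eq: "\<forall>x. f x = g x + r *\<^sub>R mean \<mu> f x" and r: "0 \<le> r" "r \<le> 1"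
      and c: "0 \<le> c" "holder \<alpha> c f" and D: "0 \<le> D" "holder \<alpha> D g"
      and B: "\<forall>x. cmod (g x) \<le> B * (norm x)\<^sup>2" and b: "\<forall>x. cmod (f x) \<le> b * (norm x)\<^sup>2"
    for f g r b c D B
  proof (rule holder_self_improvement[OF _ _ c])
    obtain x :: "complex^'d" where x: "norm x = 1"
      using unit_vector_exists by blast
    have b0: "0 \<le> b"
      using order_trans[OF norm_ge_zero b[rule_format, of x]] x by simp
    have B0: "0 \<le> B"
      using order_trans[OF norm_ge_zero B[rule_format, of x]] x by simp
    show "0 \<le> real n * (2 * D + 4 * B) + 4 * b"
      using b0 B0 D by simp
    fix c assume c: "0 \<le> c" "holder \<alpha> c f"
    have "holder \<alpha> (\<bar>r ^ n\<bar> * (c / 2 + 4 * b)) (\<lambda>x. r ^ n *\<^sub>R (mean \<mu> ^^ n) f x)"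
      by (intro holder_scaleR n f c b)
    moreover have "\<bar>r ^ n\<bar> * (c / 2 + 4 * b) \<le> c / 2 + 4 * b"
      using r c b0 by (intro mult_left_le_one_le) (auto simp: power_le_one)
    ultimately have "holder \<alpha> (c / 2 + 4 * b) (\<lambda>x. r ^ n *\<^sub>R (mean \<mu> ^^ n) f x)"
      by (rule holder_mono)
    moreover have "holder \<alpha> (real n * (2 * D + 4 * B)) (resolvent_sum r n g)"
      using B by (intro holder_resolvent_sum g D r \<alpha>) auto
    ultimately have "holder \<alpha> (real n * (2 * D + 4 * B) + (c / 2 + 4 * b))
        (\<lambda>x. resolvent_sum r n g x + r ^ n *\<^sub>R (mean \<mu> ^^ n) f x)"
      by (intro holder_add)
    also have "(\<lambda>x. resolvent_sum r n g x + r ^ n *\<^sub>R (mean \<mu> ^^ n) f x) = f"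
      using iterate_resolvent_equation[OF f g, of r _ n] eq by (intro ext) simp
    finally show "holder \<alpha> (c / 2 + (real n * (2 * D + 4 * B) + 4 * b)) f"
      by (rule holder_mono) simp
  qed
  then show ?thesis by blast
qed

end

lemma powr_modulus:
  fixes C :: real
  assumes "0 \<le> C" "0 < \<alpha>" "0 < e"
  shows "\<exists>d>0. \<forall>t. 0 \<le> t \<longrightarrow> t < d \<longrightarrow> C * t powr \<alpha> < e"
proof (intro exI conjI allI impI)
  let ?d = "(e / (C + 1)) powr (1 / \<alpha>)"
  show "0 < ?d"
    using assms by simp
  fix t :: real assume t: "0 \<le> t" "t < ?d"
  have "t powr \<alpha> < ?d powr \<alpha>"
    using t assms by (intro powr_less_mono2) auto
  then have "t powr \<alpha> < e / (C + 1)"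
    using assms by (simp add: powr_powr)
  then have "(C + 1) * t powr \<alpha> < e"
    using assms by (simp add: field_simps)
  moreover have "C * t powr \<alpha> \<le> (C + 1) * t powr \<alpha>"
    by (intro mult_right_mono) auto
  ultimately show "C * t powr \<alpha> < e"
    by linarith
qed

lemma area_le_dist:
  assumes "norm x = 1"
  shows "area x y \<le> norm (x - y)"
proof -
  have "area x y = area (1 *s x) (1 *s x + (-1) *s (x - y))"
    by simp
  also have "\<dots> = area x (x - y)"
    by (subst area_combination) simp
  also have "\<dots> \<le> norm (x - y)"
    using area_le_norms[of x "x - y"] assms by simp
  finally show ?thesis .
qed

lemma homog_uniform_limit:
  fixes h :: "nat \<Rightarrow> complex^'d \<Rightarrow> complex"
  assumes h: "\<And>m. homog (h m)"
    and lim: "\<And>e. 0 < e \<Longrightarrow> \<exists>N. \<forall>m\<ge>N. \<forall>x. cmod (h m x - H x) \<le> e * (norm x)\<^sup>2"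
  shows "homog H" "\<And>x. (\<lambda>m. h m x) \<longlonglongrightarrow> H x"
proof -
  have unif: "uniform_limit (ball 0 R) h H sequentially" if "R > 0" for R
  proof (rule uniform_limitI)
    fix e :: real assume e: "0 < e"
    have "0 < e / (2 * R\<^sup>2)"
      using e that by simp
    then obtain N where N: "\<forall>m\<ge>N. \<forall>x. cmod (h m x - H x) \<le> e / (2 * R\<^sup>2) * (norm x)\<^sup>2"
      using lim by blast
    have "dist (h m x) (H x) < e" if m: "m \<ge> N" and x: "x \<in> ball 0 R" for m x
    proof -
      have "cmod (h m x - H x) \<le> e / (2 * R\<^sup>2) * (norm x)\<^sup>2"
        using N m by blast
      also have "\<dots> \<le> e / (2 * R\<^sup>2) * R\<^sup>2"
        using x e by (intro mult_left_mono power_mono) auto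
      also have "\<dots> < e"
        using e \<open>R > 0\<close> by simp
      finally show ?thesis by (simp add: dist_norm)
    qed
    then show "\<forall>\<^sub>F m in sequentially. \<forall>x\<in>ball 0 R. dist (h m x) (H x) < e"
      unfolding eventually_sequentially by blast
  qed
  show ptw: "(\<lambda>m. h m x) \<longlonglongrightarrow> H x" for x
  proof -
    have "0 < norm x + 1"
      by (simp add: add_nonneg_pos)
    from tendsto_uniform_limitI[OF unif[OF this]] show ?thesis
      by simp
  qed
  show "homog H"
    unfolding homog_def
  proof
    have "isCont H x" for x
    proof -
      have pos: "norm x + 1 > 0"
        by (simp add: add_nonneg_pos)
      have "continuous_on (ball 0 (norm x + 1)) H"
      proof (rule uniform_limit_theorem[OF _ unif[OF pos]])
        show "\<forall>\<^sub>F m in sequentially. continuous_on (ball 0 (norm x + 1)) (h m)"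
          using h by (intro always_eventually allI) (auto simp: homog_def intro: continuous_on_subset)
      qed simp
      then show ?thesis
        by (rule continuous_on_interior) (simp add: interior_open)
    qed
    then show "continuous_on UNIV H"
      by (simp add: continuous_on_eq_continuous_at)
    show "\<forall>c x. H (c *s x) = (cmod c)\<^sup>2 *\<^sub>R H x"
    proof (intro allI)
      fix c x
      have "(\<lambda>m. h m (c *s x)) = (\<lambda>m. (cmod c)\<^sup>2 *\<^sub>R h m x)"
        using h by (simp add: homog_def)
      then have "(\<lambda>m. h m (c *s x)) \<longlonglongrightarrow> (cmod c)\<^sup>2 *\<^sub>R H x"
        using tendsto_scaleR[OF tendsto_const ptw] by simp
      then show "H (c *s x) = (cmod c)\<^sup>2 *\<^sub>R H x"
        using ptw LIMSEQ_unique by blast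
    qed
  qed
qed

text \<open>Arzela and Ascoli on the unit sphere, transported to the whole space by homogeneity.\<close>

lemma homog_holder_compact:
  fixes h :: "nat \<Rightarrow> complex^'d \<Rightarrow> complex"
  assumes h: "\<And>m. homog (h m)" and hol: "\<And>m. holder \<alpha> C (h m)" and C: "0 \<le> C" "0 < \<alpha>"
    and bound: "\<And>m x. cmod (h m x) \<le> (norm x)\<^sup>2"
  shows "\<exists>k H. strict_mono (k :: nat \<Rightarrow> nat) \<and>
    (\<forall>e>0. \<exists>N. \<forall>m\<ge>N. \<forall>x. cmod (h (k m) x - H x) \<le> e * (norm x)\<^sup>2)"
proof -
  have "\<exists>g k. continuous_on (sphere 0 1) g \<and> strict_mono (k :: nat \<Rightarrow> nat) \<and>
      (\<forall>e>0. \<exists>N. \<forall>n x. n \<ge> N \<and> x \<in> sphere 0 1 \<longrightarrow> cmod (h (k n) x - g x) < e)"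
  proof (rule Arzela_Ascoli[of "sphere 0 1 :: (complex^'d) set" h 1])
    show "cmod (h n x) \<le> 1" if "x \<in> sphere 0 1" for n x
      using bound[of n x] that by simp
    fix x :: "complex^'d" and e :: real
    assume x: "x \<in> sphere 0 1" and e: "0 < e"
    obtain d where d: "d > 0" "\<And>t. 0 \<le> t \<Longrightarrow> t < d \<Longrightarrow> C * t powr \<alpha> < e"
      using powr_modulus[OF C e] by blast
    have "cmod (h n x - h n y) < e" if y: "y \<in> sphere 0 1" "norm (x - y) < d" for n y
    proof -
      have "cmod (h n x - h n y) \<le> C * area x y powr \<alpha>"
        using holderD[OF hol] x y by simp
      also have "\<dots> < e"
        using area_le_dist[of x y] x y by (intro d) auto
      finally show ?thesis .
    qed
    with d(1) show "\<exists>d>0. \<forall>n y. y \<in> sphere 0 1 \<and> norm (x - y) < d \<longrightarrow> cmod (h n x - h n y) < e"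
      by blast
  qed (rule compact_sphere, blast)
  then obtain g k where k: "strict_mono (k :: nat \<Rightarrow> nat)"
    and g: "\<And>e. e > 0 \<Longrightarrow> \<exists>N. \<forall>n x. n \<ge> N \<and> x \<in> sphere 0 1 \<longrightarrow> cmod (h (k n) x - g x) < e"
    by blast
  define H where "H x = (norm x)\<^sup>2 *\<^sub>R g ((1 / norm x) *\<^sub>R x)" for x
  have "\<exists>N. \<forall>m\<ge>N. \<forall>x. cmod (h (k m) x - H x) \<le> e * (norm x)\<^sup>2" if e: "e > 0" for e
  proof -
    obtain N where N: "\<And>n x. n \<ge> N \<Longrightarrow> x \<in> sphere 0 1 \<Longrightarrow> cmod (h (k n) x - g x) < e"
      using g[OF e] by blast
    have "cmod (h (k m) x - H x) \<le> e * (norm x)\<^sup>2" if m: "m \<ge> N" for m x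
    proof (cases "x = 0")
      case True
      then show ?thesis
        by (simp add: H_def homog_zero[OF h])
    next
      case False
      let ?u = "(1 / norm x) *\<^sub>R x"
      have "cmod (h (k m) x - H x) = cmod ((norm x)\<^sup>2 *\<^sub>R (h (k m) ?u - g ?u))"
        using homog_normalise(1)[OF h False, of "k m"] by (simp add: H_def scaleR_diff_right)
      also have "\<dots> = (norm x)\<^sup>2 * cmod (h (k m) ?u - g ?u)"
        by simp
      also have "\<dots> \<le> (norm x)\<^sup>2 * e"
        using N[OF m, of ?u] homog_normalise(2)[OF h False] by (intro mult_left_mono) auto
      finally show ?thesis by (simp add: mult.commute)
    qed
    then show ?thesis by blast
  qed
  with k show ?thesis by blast
qed

context stochastic
begin

lemma mean_uniform_limit:
  fixes h :: "nat \<Rightarrow> complex^'d \<Rightarrow> complex"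
  assumes h: "\<And>m. homog (h m)"
    and lim: "\<And>e. 0 < e \<Longrightarrow> \<exists>N. \<forall>m\<ge>N. \<forall>x. cmod (h m x - H x) \<le> e * (norm x)\<^sup>2"
  shows "(\<lambda>m. mean \<mu> (h m) x) \<longlonglongrightarrow> mean \<mu> H x"
proof -
  note H = homog_uniform_limit(1)[OF h lim]
  have "(\<lambda>m. mean \<mu> (h m) x) \<longlonglongrightarrow> mean \<mu> H x"
  proof (rule homog_uniform_limit(2)[where h = "\<lambda>m. mean \<mu> (h m)"])
    show "homog (mean \<mu> (h m))" for m
      by (rule homog_mean[OF h])
    fix e :: real assume "0 < e"
    then obtain N where N: "\<forall>m\<ge>N. \<forall>x. cmod (h m x - H x) \<le> e * (norm x)\<^sup>2"
      using lim by blast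
    have "cmod (mean \<mu> (h m) x - mean \<mu> H x) \<le> e * (norm x)\<^sup>2" if "m \<ge> N" for m x
      using mean_iter_bound[OF homog_diff[OF h H], of m e 1 x] N that by (simp add: mean_diff[OF h H])
    then show "\<exists>N. \<forall>m\<ge>N. \<forall>x. cmod (mean \<mu> (h m) x - mean \<mu> H x) \<le> e * (norm x)\<^sup>2"
      by blast
  qed
  then show ?thesis .
qed

lemma integral_uniform_limit:
  fixes h :: "nat \<Rightarrow> complex^'d \<Rightarrow> complex"
  assumes \<nu>: "borel_prob \<nu>" and h: "\<And>m. homog (h m)"
    and lim: "\<And>e. 0 < e \<Longrightarrow> \<exists>N. \<forall>m\<ge>N. \<forall>x. cmod (h m x - H x) \<le> e * (norm x)\<^sup>2"
    and zero: "\<And>m. (\<integral> p. h m (unit_rep p) \<partial>\<nu>) = 0"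
  shows "(\<integral> p. H (unit_rep p) \<partial>\<nu>) = 0"
proof -
  interpret prob_space \<nu>
    using \<nu> by (simp add: borel_prob_def)
  note H = homog_uniform_limit(1)[OF h lim]
  have "cmod (\<integral> p. H (unit_rep p) \<partial>\<nu>) \<le> 0 + e" if e: "e > 0" for e
  proof -
    obtain N where N: "\<forall>m\<ge>N. \<forall>x. cmod (h m x - H x) \<le> e * (norm x)\<^sup>2"
      using lim[OF e] by blast
    have hd: "homog (\<lambda>x. h N x - H x)"
      by (rule homog_diff[OF h H])
    have "cmod (\<integral> p. H (unit_rep p) \<partial>\<nu>) = cmod (\<integral> p. h N (unit_rep p) - H (unit_rep p) \<partial>\<nu>)"
      using integrable_unit_rep[OF \<nu> h] integrable_unit_rep[OF \<nu> H] zero by simp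
    also have "\<dots> \<le> (\<integral> p. cmod (h N (unit_rep p) - H (unit_rep p)) \<partial>\<nu>)"
      by simp
    also have "\<dots> \<le> (\<integral> p. e \<partial>\<nu>)"
    proof (rule integral_mono)
      show "integrable \<nu> (\<lambda>p. cmod (h N (unit_rep p) - H (unit_rep p)))"
        by (intro integrable_norm integrable_unit_rep[OF \<nu> hd])
      show "cmod (h N (unit_rep p) - H (unit_rep p)) \<le> e" for p
        using N[rule_format, of N "unit_rep p"] by (simp add: unit_rep(1))
    qed simp
    finally show ?thesis
      by (simp add: prob_space)
  qed
  then have "cmod (\<integral> p. H (unit_rep p) \<partial>\<nu>) \<le> 0"
    by (rule field_le_epsilon)
  then show ?thesis by simp
qed

text \<open>The functions \<open>f m\<close> need not be bounded in \<open>m\<close>; only after division by \<open>s m = max 1 \<parallel>f m\<parallel>\<close> do they have a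
  limit point. The 1 in the maximum keeps \<open>1 / s m\<close> bounded, so that along a further subsequence it
  converges to some \<open>\<tau>\<close> and the right-hand sides \<open>g m / s m\<close> converge to \<open>\<tau> \<phi>\<close>.\<close>

lemma poisson_limit:
  fixes f g :: "nat \<Rightarrow> complex^'d \<Rightarrow> complex"
  assumes pur: "purifying \<mu>" and erg: "ergodic \<mu>" and \<nu>: "invariant_prob \<mu> \<nu>"
    and \<alpha>: "0 < \<alpha>" "\<alpha> \<le> 1"
    and f: "\<And>m. homog (f m)" and g: "\<And>m. homog (g m)"
    and r: "\<And>m. 0 \<le> r m" "\<And>m. r m \<le> 1" "r \<longlonglongrightarrow> 1"
    and eq: "\<And>m x. f m x = g m x + r m *\<^sub>R mean \<mu> (f m) x"
    and fhol: "\<And>m. \<exists>c\<ge>0. holder \<alpha> c (f m)" and ghol: "0 \<le> D" "\<And>m. holder \<alpha> D (g m)"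
    and B: "\<And>m x. cmod (g m x) \<le> B * (norm x)\<^sup>2"
    and glim: "\<And>x. (\<lambda>m. g m x) \<longlonglongrightarrow> \<phi> x"
    and zero: "\<And>m. (\<integral> p. f m (unit_rep p) \<partial>\<nu>) = 0"
  shows "\<exists>F. homog F \<and> (\<forall>x. F x - mean \<mu> F x = \<phi> x)"
proof -
  have b': "borel_prob \<nu>"
    using \<nu> by (simp add: invariant_prob_def)
  interpret prob_space \<nu>
    using b' by (simp add: borel_prob_def)
  have "\<exists>z. norm z = 1 \<and> (\<forall>x. cmod (f m x) \<le> cmod (f m z) * (norm x)\<^sup>2)" for m
  proof -
    have "continuous_on (sphere 0 1) (\<lambda>x. cmod (f m x))"
      using f[of m] by (auto simp: homog_def intro!: continuous_intros intro: continuous_on_subset)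
    moreover have "sphere 0 1 \<noteq> ({} :: (complex^'d) set)"
      using unit_vector_exists by auto
    ultimately obtain z where "z \<in> sphere 0 1" "\<forall>x\<in>sphere 0 1. cmod (f m x) \<le> cmod (f m z)"
      using continuous_attains_sup[OF compact_sphere] by blast
    then show ?thesis
      by (intro exI[of _ z] conjI allI homog_bound_sphere[OF f]) auto
  qed
  then obtain z where z: "\<And>m. norm (z m) = 1" "\<And>m x. cmod (f m x) \<le> cmod (f m (z m)) * (norm x)\<^sup>2"
    by metis
  define b where "b m = cmod (f m (z m))" for m
  define s where "s m = max 1 (b m)" for m
  define h where "h m = (\<lambda>x. (1 / s m) *\<^sub>R f m x)" for m
  have s: "1 \<le> s m" "b m \<le> s m" "0 \<le> b m" for m
    by (auto simp: s_def b_def)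
  have s0: "0 < s m" for m
    using s(1)[of m] by simp
  have h: "homog (h m)" for m
    unfolding h_def by (rule homog_scaleR[OF f])
  have h_bound: "cmod (h m x) \<le> (norm x)\<^sup>2" for m x
  proof -
    have "cmod (f m (z m)) * (norm x)\<^sup>2 \<le> s m * (norm x)\<^sup>2"
      using s(2)[of m] by (intro mult_right_mono) (auto simp: b_def)
    then have "cmod (f m x) \<le> s m * (norm x)\<^sup>2"
      by (rule order_trans[OF z(2)])
    then show ?thesis
      using s0[of m] by (simp add: h_def divide_simps mult.commute)
  qed
  obtain x0 :: "complex^'d" where x0: "norm x0 = 1"
    using unit_vector_exists by blast
  have B0: "0 \<le> B"
    using order_trans[OF norm_ge_zero B[of 0 x0]] x0 by simp
  obtain n where n: "\<And>f g r b c D B. homog f \<Longrightarrow> homog g \<Longrightarrow> (\<forall>x. f x = g x + r *\<^sub>R mean \<mu> f x) \<Longrightarrow> 0 \<le> r \<Longrightarrow> r \<le> 1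
    \<Longrightarrow> 0 \<le> c \<Longrightarrow> holder \<alpha> c f \<Longrightarrow> 0 \<le> D \<Longrightarrow> holder \<alpha> D g \<Longrightarrow> (\<forall>x. cmod (g x) \<le> B * (norm x)\<^sup>2)
    \<Longrightarrow> (\<forall>x. cmod (f x) \<le> b * (norm x)\<^sup>2) \<Longrightarrow> holder \<alpha> (2 * (real n * (2 * D + 4 * B) + 4 * b)) f"
    using holder_resolvent_solution[OF pur \<alpha>] by blast
  define K where "K = 2 * (real n * (2 * D + 4 * B) + 4)"
  have K0: "0 \<le> K"
    using ghol(1) B0 by (simp add: K_def)
  have h_hol: "holder \<alpha> K (h m)" for m
  proof -
    obtain c where c: "0 \<le> c" "holder \<alpha> c (f m)"
      using fhol by blast
    have "holder \<alpha> (2 * (real n * (2 * D + 4 * B) + 4 * b m)) (f m)"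
      using f g eq r c ghol B z(2) unfolding b_def
      by (intro n[of "f m" "g m" "r m" c D B]) auto
    then have "holder \<alpha> (\<bar>1 / s m\<bar> * (2 * (real n * (2 * D + 4 * B) + 4 * b m))) (h m)"
      unfolding h_def by (rule holder_scaleR)
    then show ?thesis
    proof (rule holder_mono)
      have "real n * (2 * D + 4 * B) * 1 \<le> real n * (2 * D + 4 * B) * s m"
        using s(1) ghol(1) B0 by (intro mult_left_mono) auto
      then have "2 * (real n * (2 * D + 4 * B) + 4 * b m) \<le> K * s m"
        using s(2)[of m] unfolding K_def by (simp add: algebra_simps)
      then show "\<bar>1 / s m\<bar> * (2 * (real n * (2 * D + 4 * B) + 4 * b m)) \<le> K"
        using s0[of m] by (simp add: divide_simps)
    qed
  qed
  obtain k H where k: "strict_mono (k :: nat \<Rightarrow> nat)"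
    and kH: "\<And>e. e > 0 \<Longrightarrow> \<exists>N. \<forall>m\<ge>N. \<forall>x. cmod (h (k m) x - H x) \<le> e * (norm x)\<^sup>2"
    using homog_holder_compact[of h, OF h h_hol K0 \<alpha>(1) h_bound] by blast
  have "1 / s (k m) \<in> {0..1}" for m
    using s[of "k m"] by simp
  then obtain \<tau> l where l: "strict_mono (l :: nat \<Rightarrow> nat)" "\<tau> \<in> {0..1}" "((\<lambda>m. 1 / s (k m)) \<circ> l) \<longlonglongrightarrow> \<tau>"
    using compact_Icc[of "0::real" 1] unfolding compact_def by metis
  define \<kappa> where "\<kappa> = k \<circ> l"
  have \<kappa>: "strict_mono \<kappa>"
    unfolding \<kappa>_def by (rule strict_mono_o[OF k l(1)])
  have sl: "(\<lambda>m. 1 / s (\<kappa> m)) \<longlonglongrightarrow> \<tau>"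
    using l(3) by (simp add: \<kappa>_def o_def)
  have lim: "\<exists>N. \<forall>m\<ge>N. \<forall>x. cmod (h (\<kappa> m) x - H x) \<le> e * (norm x)\<^sup>2" if "e > 0" for e
    using kH[OF that] seq_suble[OF l(1)] unfolding \<kappa>_def o_def by (meson order_trans)
  note hom = homog_uniform_limit[OF h lim]
  have H_eq: "H x = \<tau> *\<^sub>R \<phi> x + mean \<mu> H x" for x
  proof (rule LIMSEQ_unique[OF hom(2)])
    have "h (\<kappa> m) x = (1 / s (\<kappa> m)) *\<^sub>R g (\<kappa> m) x + r (\<kappa> m) *\<^sub>R mean \<mu> (h (\<kappa> m)) x" for m
    proof -
      have "mean \<mu> (h (\<kappa> m)) x = (1 / s (\<kappa> m)) *\<^sub>R mean \<mu> (f (\<kappa> m)) x"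
        unfolding h_def by (subst mean_bounded_linear[OF f bounded_linear_scaleR_right]) simp
      then show ?thesis
        unfolding h_def by (subst eq) (simp add: scaleR_add_right mult.commute)
    qed
    moreover have "(\<lambda>m. (1 / s (\<kappa> m)) *\<^sub>R g (\<kappa> m) x + r (\<kappa> m) *\<^sub>R mean \<mu> (h (\<kappa> m)) x)
        \<longlonglongrightarrow> \<tau> *\<^sub>R \<phi> x + 1 *\<^sub>R mean \<mu> H x"
      using LIMSEQ_subseq_LIMSEQ[OF glim \<kappa>, of x] LIMSEQ_subseq_LIMSEQ[OF r(3) \<kappa>]
      by (intro tendsto_intros sl mean_uniform_limit[OF h lim]) (simp_all add: o_def)
    ultimately show "(\<lambda>m. h (\<kappa> m) x) \<longlonglongrightarrow> \<tau> *\<^sub>R \<phi> x + mean \<mu> H x"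
      by simp
  qed
  \<comment> \<open>otherwise the limit would be an invariant function of norm 1 with integral 0\<close>
  have "\<tau> \<noteq> 0"
  proof
    assume "\<tau> = 0"
    then have "mean \<mu> H = H"
      using H_eq by (simp add: fun_eq_iff)
    then obtain c where c: "\<And>x. H x = c * complex_of_real ((norm x)\<^sup>2)"
      using invariant_constant[OF pur erg hom(1)] by blast
    have "(\<integral> p. h (\<kappa> m) (unit_rep p) \<partial>\<nu>) = 0" for m
      unfolding h_def by (simp add: zero)
    from integral_uniform_limit[OF b' h lim this] have "c = 0"
      by (simp add: c unit_rep(1) prob_space)
    then have H0: "H x = 0" for x
      by (simp add: c)
    obtain N where N: "\<forall>m\<ge>N. \<forall>x. cmod (h (\<kappa> m) x - H x) \<le> 1 / 2 * (norm x)\<^sup>2"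
      using lim[of "1 / 2"] by auto
    have "\<forall>\<^sub>F m in sequentially. 1 / s (\<kappa> m) < 1"
      using order_tendstoD(2)[OF sl, of 1] \<open>\<tau> = 0\<close> by simp
    then obtain N' where N': "\<And>m. m \<ge> N' \<Longrightarrow> 1 / s (\<kappa> m) < 1"
      unfolding eventually_sequentially by blast
    define m where "m = max N N'"
    have "1 < s (\<kappa> m)"
      using N'[of m] s0[of "\<kappa> m"] by (simp add: m_def divide_simps)
    then have "s (\<kappa> m) = b (\<kappa> m)"
      unfolding s_def by (auto simp: max_def split: if_splits)
    then have "cmod (h (\<kappa> m) (z (\<kappa> m))) = 1"
      using s0[of "\<kappa> m"] by (simp add: h_def b_def)
    moreover have "cmod (h (\<kappa> m) (z (\<kappa> m))) \<le> 1 / 2"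
      using N[rule_format, of m "z (\<kappa> m)"] by (simp add: H0 z(1) m_def)
    ultimately show False by simp
  qed
  define F where "F = (\<lambda>x. (1 / \<tau>) *\<^sub>R H x)"
  have "mean \<mu> F = (\<lambda>x. (1 / \<tau>) *\<^sub>R mean \<mu> H x)"
    unfolding F_def by (rule mean_bounded_linear[OF hom(1) bounded_linear_scaleR_right])
  then have "F x - mean \<mu> F x = (1 / \<tau>) *\<^sub>R (H x - mean \<mu> H x)" for x
    by (simp add: F_def scaleR_diff_right)
  also have "(1 / \<tau>) *\<^sub>R (H x - mean \<mu> H x) = \<phi> x" for x
  proof -
    have "H x - mean \<mu> H x = \<tau> *\<^sub>R \<phi> x"
      by (subst H_eq) simp
    then show ?thesis
      using \<open>\<tau> \<noteq> 0\<close> by simp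
  qed
  finally have "F x - mean \<mu> F x = \<phi> x" for x .
  moreover have "homog F"
    unfolding F_def by (rule homog_scaleR[OF hom(1)])
  ultimately show ?thesis by blast
qed

lemma poisson_solution:
  fixes \<phi> :: "complex^'d \<Rightarrow> complex"
  assumes pur: "purifying \<mu>" and erg: "ergodic \<mu>" and \<nu>: "invariant_prob \<mu> \<nu>"
    and \<alpha>: "0 < \<alpha>" "\<alpha> \<le> 1" and \<phi>: "homog \<phi>" "holder \<alpha> C \<phi>" "0 \<le> C"
    and zero: "(\<integral> p. \<phi> (unit_rep p) \<partial>\<nu>) = 0"
  shows "\<exists>F. homog F \<and> (\<forall>x. F x - mean \<mu> F x = \<phi> x)"
proof -
  obtain B where B: "\<And>x. cmod (\<phi> x) \<le> B * (norm x)\<^sup>2"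
    using homog_quad[OF \<phi>(1)] by (auto simp: quad_def)
  obtain x0 :: "complex^'d" where x0: "norm x0 = 1"
    using unit_vector_exists by blast
  have B0: "0 \<le> B"
    using order_trans[OF norm_ge_zero B[of x0]] x0 by simp
  \<comment> \<open>the shift by 2 keeps \<open>0 \<le> r m < 1\<close> with room for \<open>m = 0\<close>; the length of the series is then chosen
    so that its remainder is at most \<open>1 / (m + 2)\<close>\<close>
  define r where "r m = 1 - 1 / real (m + 2)" for m
  have r: "0 \<le> r m" "r m < 1" for m
    by (auto simp: r_def)
  have r_lim: "r \<longlonglongrightarrow> 1"
    unfolding r_def by real_asymp
  have "\<exists>N. r m ^ N < 1 / real (m + 2)" for m
    by (rule real_arch_pow_inv) (use r in auto)
  then obtain N where N: "\<And>m. r m ^ N m < 1 / real (m + 2)"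
    by metis
  define g where "g m = (\<lambda>x. \<phi> x - r m ^ N m *\<^sub>R (mean \<mu> ^^ N m) \<phi> x)" for m
  have rN: "0 \<le> r m ^ N m" "r m ^ N m \<le> 1" for m
    using r[of m] by (auto intro: power_le_one)
  have it: "cmod ((mean \<mu> ^^ k) \<phi> x) \<le> B * (norm x)\<^sup>2" for k x
    by (rule mean_iter_bound[OF \<phi>(1) B])
  have small: "cmod (r m ^ N m *\<^sub>R (mean \<mu> ^^ N m) \<phi> x) \<le> 1 / real (m + 2) * (B * (norm x)\<^sup>2)" for m x
    using N[of m] it[of "N m" x] rN[of m] by (simp only: norm_scaleR abs_of_nonneg) (intro mult_mono, auto)
  show ?thesis
  proof (rule poisson_limit[OF pur erg \<nu> \<alpha>, of "\<lambda>m. resolvent_sum (r m) (N m) \<phi>" g r])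
    show "homog (resolvent_sum (r m) (N m) \<phi>)" for m
      by (rule homog_resolvent_sum[OF \<phi>(1)])
    show "homog (g m)" for m
      unfolding g_def by (intro homog_diff homog_scaleR homog_iter_mean \<phi>)
    show "0 \<le> r m" "r m \<le> 1" for m
      using r[of m] by auto
    show "resolvent_sum (r m) (N m) \<phi> x = g m x + r m *\<^sub>R mean \<mu> (resolvent_sum (r m) (N m) \<phi>) x" for m x
      unfolding g_def by (rule resolvent_sum_equation[OF \<phi>(1)])
    show "\<exists>c\<ge>0. holder \<alpha> c (resolvent_sum (r m) (N m) \<phi>)" for m
      using holder_resolvent_sum[OF \<phi>(1,2) B \<phi>(3) \<alpha>, of "r m" "N m"] r[of m] B0 \<phi>(3)
      by (intro exI[of _ "real (N m) * (2 * C + 4 * B)"]) auto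
    show "0 \<le> C + (2 * C + 4 * B)"
      using B0 \<phi>(3) by simp
    show "holder \<alpha> (C + (2 * C + 4 * B)) (g m)" for m
    proof -
      have "holder \<alpha> (\<bar>- (r m ^ N m)\<bar> * (2 * C + 4 * B)) (\<lambda>x. - (r m ^ N m) *\<^sub>R (mean \<mu> ^^ N m) \<phi> x)"
        by (rule holder_scaleR[OF holder_iter[OF \<phi>(1,2) B \<phi>(3) \<alpha>]])
      then have "holder \<alpha> (2 * C + 4 * B) (\<lambda>x. - (r m ^ N m) *\<^sub>R (mean \<mu> ^^ N m) \<phi> x)"
        by (rule holder_mono) (use rN[of m] B0 \<phi>(3) in \<open>auto intro!: mult_left_le_one_le\<close>)
      from holder_add[OF \<phi>(2) this] show ?thesis
        by (simp add: g_def)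
    qed
    show "cmod (g m x) \<le> (2 * B) * (norm x)\<^sup>2" for m x
    proof -
      have "cmod (r m ^ N m *\<^sub>R (mean \<mu> ^^ N m) \<phi> x) \<le> 1 * (B * (norm x)\<^sup>2)"
        unfolding norm_scaleR using rN[of m] it[of "N m" x] by (intro mult_mono) auto
      then show ?thesis
        using norm_triangle_ineq4[of "\<phi> x" "r m ^ N m *\<^sub>R (mean \<mu> ^^ N m) \<phi> x"] B[of x]
        unfolding g_def by linarith
    qed
    show "(\<lambda>m. g m x) \<longlonglongrightarrow> \<phi> x" for x
    proof -
      have "(\<lambda>m. 1 / real (m + 2) * (B * (norm x)\<^sup>2)) \<longlonglongrightarrow> 0"
        by real_asymp
      then have "(\<lambda>m. r m ^ N m *\<^sub>R (mean \<mu> ^^ N m) \<phi> x) \<longlonglongrightarrow> 0"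
        by (rule Lim_null_comparison[rotated]) (intro always_eventually allI small)
      from tendsto_diff[OF tendsto_const this, of "\<phi> x"] show ?thesis
        by (simp add: g_def)
    qed
    show "(\<integral> p. resolvent_sum (r m) (N m) \<phi> (unit_rep p) \<partial>\<nu>) = 0" for m
      by (rule integral_resolvent_sum[OF \<nu> \<phi>(1) zero])
  qed (rule r_lim)
qed

text \<open>The difference of two solutions is invariant.\<close>

lemma poisson_solution_unique:
  assumes pur: "purifying \<mu>" and erg: "ergodic \<mu>"
    and f: "continuous_on UNIV f\<^sub>1" "continuous_on UNIV f\<^sub>2"
    and eq: "\<And>p. f\<^sub>1 p - kernel_op \<mu> f\<^sub>1 p = f\<^sub>2 p - kernel_op \<mu> f\<^sub>2 p"
  shows "\<exists>c. \<forall>p. f\<^sub>1 p = f\<^sub>2 p + c"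
proof -
  note h = homog_lift[OF f(1)] homog_lift[OF f(2)]
  define H where "H = (\<lambda>x. lift f\<^sub>1 x - lift f\<^sub>2 x)"
  have H: "homog H"
    unfolding H_def by (rule homog_diff[OF h])
  have mH: "mean \<mu> H = (\<lambda>x. mean \<mu> (lift f\<^sub>1) x - mean \<mu> (lift f\<^sub>2) x)"
    unfolding H_def by (rule mean_diff[OF h])
  have u: "mean \<mu> H (unit_rep p) = H (unit_rep p)" for p
    using eq[of p] unfolding mH by (simp add: H_def lift_unit_rep kernel_op_eq_mean algebra_simps)
  have "mean \<mu> H = H"
  proof
    fix x
    show "mean \<mu> H x = H x"
    proof (cases "x = 0")
      case True
      then show ?thesis
        using homog_zero[OF H] homog_zero[OF homog_mean[OF H]] by simp
    next
      case False
      then show ?thesis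
        using homog_eq_unit_rep[OF H False] homog_eq_unit_rep[OF homog_mean[OF H] False] u by simp
    qed
  qed
  then obtain c where c: "\<And>x. H x = c * complex_of_real ((norm x)\<^sup>2)"
    using invariant_constant[OF pur erg H] by blast
  have "f\<^sub>1 p = f\<^sub>2 p + c" for p
    using c[of "unit_rep p"] by (simp add: H_def lift_unit_rep unit_rep(1) algebra_simps)
  then show ?thesis by blast
qed

end

lemma hoelder_imp_continuous:
  assumes "0 < \<alpha>" "\<And>p q. cmod (g p - g q) \<le> C * dist p q powr \<alpha>"
  shows "continuous_on UNIV (g :: 'd::finite cproj \<Rightarrow> complex)"
  unfolding continuous_on_iff
proof (intro ballI allI impI)
  fix p :: "'d cproj" and e :: real assume e: "0 < e"
  obtain d where d: "d > 0" "\<And>t. 0 \<le> t \<Longrightarrow> t < d \<Longrightarrow> \<bar>C\<bar> * t powr \<alpha> < e"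
    using powr_modulus[of "\<bar>C\<bar>" \<alpha> e] assms(1) e by auto
  have "dist (g q) (g p) < e" if "dist q p < d" for q
  proof -
    have "cmod (g q - g p) \<le> \<bar>C\<bar> * dist q p powr \<alpha>"
      by (rule order_trans[OF assms(2)]) (intro mult_right_mono, auto)
    also have "\<dots> < e"
      using that by (intro d) auto
    finally show ?thesis by (simp add: dist_norm)
  qed
  with d(1) show "\<exists>d>0. \<forall>q\<in>UNIV. dist q p < d \<longrightarrow> dist (g q) (g p) < e"
    by blast
qed

lemma poisson_solution_exists:
  fixes \<mu> :: "(complex^'d::finite^'d) measure"
  assumes "stochastic_measure \<mu>" "purifying \<mu>" "ergodic \<mu>" "invariant_prob \<mu> \<nu>" "hoelder_continuous g"
  shows "\<exists>f. continuous_poisson_solution \<mu> (centred \<nu> g) f"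
proof -
  interpret stochastic \<mu>
    using assms(1) by unfold_locales
  have b: "borel_prob \<nu>"
    using assms(4) by (simp add: invariant_prob_def)
  interpret prob_space \<nu>
    using b by (simp add: borel_prob_def)
  obtain \<alpha> C where \<alpha>: "0 < \<alpha>" "\<alpha> \<le> 1" and g: "\<And>p q. cmod (g p - g q) \<le> C * dist p q powr \<alpha>"
    using assms(5) by (auto simp: hoelder_continuous_def)
  have cont: "continuous_on UNIV g"
    by (rule hoelder_imp_continuous[OF \<alpha>(1) g])
  then have "continuous_on UNIV (centred \<nu> g)"
    unfolding centred_def by (intro continuous_intros)
  note h = homog_lift[OF this]
  have "holder \<alpha> \<bar>C\<bar> (lift (centred \<nu> g))"
    unfolding holder_def
  proof (intro allI impI)
    fix x y :: "complex^'d" assume xy: "norm x = 1" "norm y = 1"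
    then have ne: "x \<noteq> 0" "y \<noteq> 0" by auto
    have "cmod (lift (centred \<nu> g) x - lift (centred \<nu> g) y) = cmod (g (line x) - g (line y))"
      by (simp add: lift_def xy centred_def)
    also have "\<dots> \<le> \<bar>C\<bar> * dist (line x) (line y) powr \<alpha>"
      by (rule order_trans[OF g]) (intro mult_right_mono, auto)
    also have "dist (line x) (line y) = area x y"
      using dist_line_area[OF ne] xy by simp
    finally show "cmod (lift (centred \<nu> g) x - lift (centred \<nu> g) y) \<le> \<bar>C\<bar> * area x y powr \<alpha>" .
  qed
  moreover have "(\<integral> p. lift (centred \<nu> g) (unit_rep p) \<partial>\<nu>) = 0"
  proof -
    have "integrable \<nu> g"
      using integrable_unit_rep[OF b homog_lift[OF cont]] by (simp add: lift_unit_rep)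
    then show ?thesis
      by (simp add: lift_unit_rep centred_def prob_space)
  qed
  ultimately obtain F where F: "homog F" "\<And>x. F x - mean \<mu> F x = lift (centred \<nu> g) x"
    using poisson_solution[OF assms(2-4) \<alpha> h] by (metis abs_ge_zero)
  have "continuous_poisson_solution \<mu> (centred \<nu> g) (\<lambda>p. F (unit_rep p))"
    using continuous_on_unit_rep[OF F(1)] F(2)
    by (simp add: continuous_poisson_solution_def kernel_op_eq_mean lift_homog[OF F(1)] lift_unit_rep)
  then show ?thesis by blast
qed

text \<open>Pathwise telescoping: each summand of the Birkhoff sum is \<open>f (x\<^sub>k) - \<Pi> f (x\<^sub>k)\<close>, and the martingale
  carries the same terms \<open>\<Pi> f (x\<^sub>k)\<close>.\<close>

lemma birkhoff_sum_decomposition: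
  assumes "\<And>p. f p - kernel_op \<mu> f p = h p"
  shows "birkhoff_sum h n z - poisson_martingale \<mu> f n z = f (xhat 0 z) - f (xhat n z)"
proof (induction n)
  case 0
  then show ?case by (simp add: birkhoff_sum_def poisson_martingale_def)
next
  case (Suc n)
  then show ?case
    using assms[of "xhat n z"] by (simp add: birkhoff_sum_def poisson_martingale_def algebra_simps)
qed

lemma bounded_osc:
  assumes "\<And>p. cmod (f p) \<le> B"
  shows "cmod (f p - f q) \<le> osc f" "osc f \<le> 2 * sup_norm f"
proof -
  have bdd: "bdd_above (range (\<lambda>p. cmod (f p)))"
    using assms by (auto intro!: bdd_aboveI)
  have S: "cmod (f p) \<le> sup_norm f" for p
    unfolding sup_norm_def by (rule cSUP_upper[OF UNIV_I bdd])
  have le: "cmod (f p - f q) \<le> 2 * sup_norm f" for p q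
    using norm_triangle_ineq4[of "f p" "f q"] S[of p] S[of q] by linarith
  then show "osc f \<le> 2 * sup_norm f"
    unfolding osc_def by (intro cSUP_least) auto
  have "bdd_above (range (\<lambda>(p, q). cmod (f p - f q)))"
    using le by (auto intro!: bdd_aboveI)
  from cSUP_upper[OF UNIV_I this, of "(p, q)"] show "cmod (f p - f q) \<le> osc f"
    by (simp add: osc_def)
qed

theorem proposition4p2:
  fixes \<mu> :: "(complex^'d^'d) measure"
    and \<nu>_inv :: "'d::finite cproj measure"
    and g :: "'d cproj \<Rightarrow> complex"
  assumes "stochastic_measure \<mu>"
    and "purifying \<mu>"
    and "ergodic \<mu>"
    and "invariant_prob \<mu> \<nu>_inv"
    and "hoelder_continuous g"
  shows
    "(\<exists>f. continuous_poisson_solution \<mu> (centred \<nu>_inv g) f) \<and>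
     (\<forall>f\<^sub>1 f\<^sub>2. continuous_poisson_solution \<mu> (centred \<nu>_inv g) f\<^sub>1 \<and>
              continuous_poisson_solution \<mu> (centred \<nu>_inv g) f\<^sub>2 \<longrightarrow>
        (\<exists>c. \<forall>p. f\<^sub>1 p = f\<^sub>2 p + c)) \<and>
     (\<forall>f. continuous_poisson_solution \<mu> (centred \<nu>_inv g) f \<longrightarrow>
        (\<forall>\<nu> P. borel_prob \<nu> \<and> trajectory_law \<mu> \<nu> P \<longrightarrow>
           (AE z in P. (SUP n. ennreal (cmod (birkhoff_sum (centred \<nu>_inv g) n z
                                 - poisson_martingale \<mu> f n z))) \<le> ennreal (osc f))) \<and>
        osc f \<le> 2 * sup_norm f)"
proof -
  interpret stochastic \<mu>
    using assms(1) by unfold_locales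
  have uniq: "\<exists>c. \<forall>p. f\<^sub>1 p = f\<^sub>2 p + c"
    if "continuous_poisson_solution \<mu> (centred \<nu>_inv g) f\<^sub>1" "continuous_poisson_solution \<mu> (centred \<nu>_inv g) f\<^sub>2"
    for f\<^sub>1 f\<^sub>2
    using that by (intro poisson_solution_unique assms) (auto simp: continuous_poisson_solution_def)
  have bound: "cmod (birkhoff_sum (centred \<nu>_inv g) n z - poisson_martingale \<mu> f n z) \<le> osc f"
    "osc f \<le> 2 * sup_norm f"
    if f: "continuous_poisson_solution \<mu> (centred \<nu>_inv g) f" for f n z
  proof -
    obtain B where B: "\<And>p. cmod (f p) \<le> B"
      using continuous_bounded_cproj f unfolding continuous_poisson_solution_def by blast
    show "osc f \<le> 2 * sup_norm f"
      by (rule bounded_osc[OF B])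
    have "birkhoff_sum (centred \<nu>_inv g) n z - poisson_martingale \<mu> f n z = f (xhat 0 z) - f (xhat n z)"
      using f by (intro birkhoff_sum_decomposition) (simp add: continuous_poisson_solution_def)
    then show "cmod (birkhoff_sum (centred \<nu>_inv g) n z - poisson_martingale \<mu> f n z) \<le> osc f"
      using bounded_osc(1)[OF B] by simp
  qed
  show ?thesis
    using poisson_solution_exists[OF assms] uniq bound by (auto intro!: always_eventually SUP_least ennreal_leI)
qed

end
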